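(* Let $n$ be odd and let $\mathrm{USp}(2^n)$ be the unitary symplectic group with respect to $J=i^n\bigotimes_{j=1}^nY_j$. Let $k\ge2$ and let $\mathcal{E}$ be an ensemble of circuits implementing elements of $\mathrm{USp}(2^n)$ which is an $\varepsilon$-approximate additive-error unitary $k$-design over $\mathrm{USp}(2^n)$ with $\varepsilon<1/4$. Then at least one circuit in the ensemble has a lightcone containing at least a $1/4$ fraction of the $n$ qubits. Consequently, $\mathcal{E}$ must have circuit depth $d=\Omega(n)$ if the circuits are one-dimensional, and $d=\Omega(\log n)$ if the circuits have all-to-all connectivity.
   Context: $Y_j$ is the Pauli-$Y$ matrix on qubit $j$. $\mathrm{USp}(2^n)=\{U\in\mathrm{U}(2^n):UJU^T=J\}$. For an ensemble (probability distribution) $\mathcal{E}$ of unitaries on $(\mathbb{C}^2)^{\otimes n}$, the $k$-wise twirl is $\Phi^{(k)}_{\mathcal{E}}(A)=\mathbb{E}_{U\sim\mathcal{E}}U^{\otimes k}A\,U^{\dagger,\otimes k}$; $\Phi^{(k)}_G$ is the twirl over the Haar measure of a compact group $G$. $\mathcal{E}$ is an $\varepsilon$-approximate additive-error unitary $k$-design over $G$ if $\mathcal{E}$ is supported on $G$ and $\|\Phi_G^{(k)}-\Phi_{\mathcal{E}}^{(k)}\|_\diamond\le\varepsilon$ (diamond norm). Circuits: a depth-$d$ circuit is a product $U=U_d\cdots U_1$ of $d$ layers; each layer is a product of gates with disjoint supports, each gate acting on at most a constant number $r$ of qubits that are connected in the architecture graph (vertices = qubits). One-dimensional: the graph is a path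 or cycle; all-to-all: the complete graph. The individual gates need not belong to the group, only the total unitary. The depth of an ensemble is the maximal depth of its circuits. The implied constants in $\Omega(\cdot)$ may depend on $r$. Lightcone: fix an arbitrary ordering of the qubits. The lightcone of a circuit is the lightcone starting from the first qubit, i.e. the set $S_d$ defined by $S_0=\{1\}$ and $S_t=S_{t-1}\cup\bigcup\{\text{supports of gates in layer } t \text{ that intersect } S_{t-1}\}$. *)

theory Defs
  imports
    "HOL-Probability.Probability"
    "Jordan_Normal_Form.Schur_Decomposition"
begin

section \<open>Unitary and unitary symplectic matrices\<close>

definition kron :: "complex mat \<Rightarrow> complex mat \<Rightarrow> complex mat" where
  "kron A B = Matrix.mat (dim_row A * dim_row B) (dim_col A * dim_col B)
     (\<lambda>(i, j). A $$ (i div dim_row B, j div dim_col B) * B $$ (i mod dim_row B, j mod dim_col B))"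

fun kron_pow :: "nat \<Rightarrow> complex mat \<Rightarrow> complex mat" where
  "kron_pow 0 A = 1\<^sub>m 1"
| "kron_pow (Suc k) A = kron A (kron_pow k A)"

definition unitary_group :: "nat \<Rightarrow> complex mat set" where
  "unitary_group N = {U \<in> carrier_mat N N. U * mat_adjoint U = 1\<^sub>m N \<and> mat_adjoint U * U = 1\<^sub>m N}"

definition pauli_Y :: "complex mat" where
  "pauli_Y = mat_of_rows_list 2 [[0, - \<i>], [\<i>, 0]]"

definition symplectic_form :: "nat \<Rightarrow> complex mat" where
  "symplectic_form n = \<i> ^ n \<cdot>\<^sub>m kron_pow n pauli_Y"

definition USp :: "nat \<Rightarrow> complex mat set" where
  "USp n = {U \<in> unitary_group (2 ^ n).
     U * symplectic_form n * transpose_mat U = symplectic_form n}"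

section \<open>Random matrices, twirls and designs\<close>

text \<open>The Borel sigma-algebra on the N by N complex matrices. As \<^typ>\<open>complex mat\<close> carries no
  topology, it is generated by the matrix entries.\<close>

definition mat_borel :: "nat \<Rightarrow> complex mat measure" where
  "mat_borel N = sigma (carrier_mat N N)
     {{A \<in> carrier_mat N N. A $$ (i, j) \<in> B} | i j B. i < N \<and> j < N \<and> B \<in> sets borel}"

text \<open>For a compact matrix group \<open>G\<close> exactly one measure satisfies this predicate.\<close>

definition haar_measure :: "nat \<Rightarrow> complex mat set \<Rightarrow> complex mat measure \<Rightarrow> bool" where
  "haar_measure N G \<mu> \<longleftrightarrow>
     prob_space \<mu> \<and> space \<mu> = G \<and> sets \<mu> = sets (restrict_space (mat_borel N) G) \<and>
     (\<forall>V\<in>G. distr \<mu> \<mu> (\<lambda>U. V * U) = \<mu>) \<and> (\<forall>V\<in>G. distr \<mu> \<mu> (\<lambda>U. U * V) = \<mu>)"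

definition twirl :: "nat \<Rightarrow> nat \<Rightarrow> complex mat measure \<Rightarrow> complex mat \<Rightarrow> complex mat" where
  "twirl N k \<nu> A = Matrix.mat (N ^ k) (N ^ k)
     (\<lambda>(i, j). \<integral>U. (kron_pow k U * A * kron_pow k (mat_adjoint U)) $$ (i, j) \<partial>\<nu>)"

text \<open>Sum of the singular values, with multiplicity.\<close>

definition trace_norm :: "complex mat \<Rightarrow> real" where
  "trace_norm A = (\<Sum>x\<in>#proots (char_poly (mat_adjoint A * A)). sqrt (Re x))"

text \<open>The map \<open>\<Phi> \<otimes> id\<^sub>m\<close>, where \<open>\<Phi>\<close> is a linear map on the D by D matrices: \<open>\<Phi>\<close> is
  applied to each of the D by D blocks of \<open>X\<close> that are labelled by a pair of basis vectors
  of the m-dimensional ancilla (the right tensor factor).\<close>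

definition tensor_id :: "nat \<Rightarrow> nat \<Rightarrow> (complex mat \<Rightarrow> complex mat) \<Rightarrow> complex mat \<Rightarrow> complex mat" where
  "tensor_id D m \<Phi> X = Matrix.mat (D * m) (D * m) (\<lambda>(a, b).
     \<Phi> (Matrix.mat D D (\<lambda>(i, j). X $$ (i * m + a mod m, j * m + b mod m))) $$ (a div m, b div m))"

definition diamond_norm :: "nat \<Rightarrow> (complex mat \<Rightarrow> complex mat) \<Rightarrow> ereal" where
  "diamond_norm D \<Phi> =
     (SUP m\<in>{1..}. SUP X\<in>{X \<in> carrier_mat (D * m) (D * m). trace_norm X \<le> 1}.
        ereal (trace_norm (tensor_id D m \<Phi> X)))"

text \<open>The measure \<open>\<mu>\<close> is determined by \<open>G\<close>; it is named by an existential quantifier in order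
  not to presuppose a construction of Haar measure.\<close>

definition approx_unitary_design ::
    "nat \<Rightarrow> complex mat set \<Rightarrow> nat \<Rightarrow> real \<Rightarrow> complex mat measure \<Rightarrow> bool" where
  "approx_unitary_design N G k \<epsilon> \<nu> \<longleftrightarrow>
     prob_space \<nu> \<and> sets \<nu> = sets (mat_borel N) \<and> (AE U in \<nu>. U \<in> G) \<and>
     (\<exists>\<mu>. haar_measure N G \<mu> \<and>
        diamond_norm (N ^ k) (\<lambda>A. twirl N k \<mu> A - twirl N k \<nu> A) \<le> ereal \<epsilon>)"

section \<open>Circuits\<close>

text \<open>The qubits are \<open>0, \<dots>, n - 1\<close>, and bit \<open>q\<close> of a row or column index is the state
  of qubit \<open>q\<close>. A gate \<open>(qs, g)\<close> is a matrix \<open>g\<close> acting on the distinct qubits \<open>qs\<close>,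
  where bit \<open>l\<close> of an index of \<open>g\<close> belongs to qubit \<open>qs ! l\<close>. A circuit
  \<open>[L\<^sub>1, \<dots>, L\<^sub>d]\<close> lists its layers in the order of application.\<close>

type_synonym gate = "nat list \<times> complex mat"
type_synonym layer = "gate list"
type_synonym circuit = "layer list"

definition supp :: "gate \<Rightarrow> nat set" where
  "supp G = set (fst G)"

definition sub_index :: "nat list \<Rightarrow> nat \<Rightarrow> nat" where
  "sub_index qs i = horner_sum of_bool 2 (map (bit i) qs)"

definition gate_unitary :: "nat \<Rightarrow> gate \<Rightarrow> complex mat" where
  "gate_unitary n G = Matrix.mat (2 ^ n) (2 ^ n) (\<lambda>(i, j).
     if \<forall>q<n. q \<notin> supp G \<longrightarrow> bit i q = bit j q
     then snd G $$ (sub_index (fst G) i, sub_index (fst G) j) else 0)"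

definition layer_unitary :: "nat \<Rightarrow> layer \<Rightarrow> complex mat" where
  "layer_unitary n L = foldr (\<lambda>G A. gate_unitary n G * A) L (1\<^sub>m (2 ^ n))"

fun circuit_unitary :: "nat \<Rightarrow> circuit \<Rightarrow> complex mat" where
  "circuit_unitary n [] = 1\<^sub>m (2 ^ n)"
| "circuit_unitary n (L # C) = circuit_unitary n C * layer_unitary n L"

text \<open>An architecture graph on the qubits is given by its set of edges.\<close>

definition connected_in :: "nat set set \<Rightarrow> nat set \<Rightarrow> bool" where
  "connected_in E S \<longleftrightarrow> (\<forall>x\<in>S. \<forall>y\<in>S. (x, y) \<in> {(u, v). u \<in> S \<and> v \<in> S \<and> {u, v} \<in> E}\<^sup>*)"

definition valid_gate :: "nat \<Rightarrow> nat set set \<Rightarrow> nat \<Rightarrow> gate \<Rightarrow> bool" where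
  "valid_gate n E r G \<longleftrightarrow>
     distinct (fst G) \<and> supp G \<subseteq> {..<n} \<and> card (supp G) \<le> r \<and> connected_in E (supp G) \<and>
     snd G \<in> unitary_group (2 ^ length (fst G))"

definition valid_circuit :: "nat \<Rightarrow> nat set set \<Rightarrow> nat \<Rightarrow> circuit \<Rightarrow> bool" where
  "valid_circuit n E r C \<longleftrightarrow>
     (\<forall>L\<in>set C. (\<forall>G\<in>set L. valid_gate n E r G) \<and>
        sorted_wrt (\<lambda>G H. supp G \<inter> supp H = {}) L)"

fun lightcone :: "nat set \<Rightarrow> circuit \<Rightarrow> nat set" where
  "lightcone S [] = S"
| "lightcone S (L # C) = lightcone (S \<union> \<Union>{supp G | G. G \<in> set L \<and> supp G \<inter> S \<noteq> {}}) C"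

text \<open>The labelling \<open>\<pi>\<close> of the vertices along the path or cycle is arbitrary.\<close>

definition one_dimensional :: "nat \<Rightarrow> nat set set \<Rightarrow> bool" where
  "one_dimensional n E \<longleftrightarrow> (\<exists>\<pi>. bij_betw \<pi> {..<n} {..<n} \<and>
     (E = {{\<pi> i, \<pi> (Suc i)} | i. Suc i < n} \<or>
      3 \<le> n \<and> E = {{\<pi> i, \<pi> (Suc i mod n)} | i. i < n}))"

definition all_to_all :: "nat \<Rightarrow> nat set set" where
  "all_to_all n = {{i, j} | i j. i < n \<and> j < n \<and> i \<noteq> j}"

text \<open>An ensemble is a probability space \<open>M\<close> of circuits; \<open>space M\<close> is the set of circuits
  in the ensemble. Its sigma-algebra only has to make the implemented unitary a random matrix.\<close>

definition circuit_ensemble ::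
    "nat \<Rightarrow> nat set set \<Rightarrow> nat \<Rightarrow> complex mat set \<Rightarrow> circuit measure \<Rightarrow> bool" where
  "circuit_ensemble n E r \<G> M \<longleftrightarrow>
     prob_space M \<and> circuit_unitary n \<in> M \<rightarrow>\<^sub>M mat_borel (2 ^ n) \<and>
     (\<forall>C\<in>space M. valid_circuit n E r C \<and> circuit_unitary n C \<in> \<G>)"

definition unitary_ensemble :: "nat \<Rightarrow> circuit measure \<Rightarrow> complex mat measure" where
  "unitary_ensemble n M = distr M (mat_borel (2 ^ n)) (circuit_unitary n)"

definition design_circuit_ensemble ::
    "nat \<Rightarrow> nat set set \<Rightarrow> nat \<Rightarrow> complex mat set \<Rightarrow> nat \<Rightarrow> real \<Rightarrow> circuit measure \<Rightarrow> bool" where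
  "design_circuit_ensemble n E r \<G> k \<epsilon> M \<longleftrightarrow>
     circuit_ensemble n E r \<G> M \<and> approx_unitary_design (2 ^ n) \<G> k \<epsilon> (unitary_ensemble n M)"

definition ensemble_depth :: "circuit measure \<Rightarrow> enat" where
  "ensemble_depth M = (SUP C\<in>space M. enat (length C))"

end

(* A symplectic U satisfies U J U^T = J, so U (x) U maps the maximally entangled vector vec(P J) to
   vec(U P U^dagger J), for P a Pauli operator on the first qubit. For a circuit, U P U^dagger lives
   on the lightcone, so if all lightcones have fewer than n/4 qubits then measuring this state in the
   basis vec(R J), R a Pauli string, always yields a string of weight below n/4. For Haar random U the
   distribution of R is invariant under R -> R T for every odd-weight T anticommuting with R. Two such
   steps turn a string that is trivial at a given qubit injectively into one that is not, so every
   qubit is trivial with probability at most 1/2, and by Markov's inequality the weight is below n/4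
   with probability at most 2/3. Hence the two twirls differ by at least 1/3 in diamond norm. *)
theory Submission
  imports Defs
begin

text \<open>Of Haar measure only left invariance under the rotations (1 + t T) / sqrt 2 is used, so
  no moments of the group are computed. With Q = t T, such a rotation is symplectic if Q J = - J
  Q^T, and as J is a product of Y on all qubits this says that T has an odd number of non-identity
  factors. This parity is the obstacle: moving a Pauli factor from one qubit to another multiplies
  the string by an operator of weight two. That operator is therefore split into two commuting
  strings of weight three which share a factor on an auxiliary third qubit. Three qubits are
  available, since a lightcone is never empty and a lightcone below n/4 forces n > 4. The identity
  string has no partner under such moves, but it has probability zero because the measured operator
  is traceless. Copies beyond the first two start in a basis state and their outcomes are summed
  out. The constant 2/3 is (n/2) / (3n/4): the mean number of trivial qubits is at most n/2, while a
  string of weight below n/4 is trivial at more than 3n/4 qubits. The gap 1/3 exceeds 1/4.\<close>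

unbundle bit_operations_syntax

section \<open>Adjoints, unitaries and Kronecker products\<close>

lemma mat_adjoint_dim [simp]:
  "dim_row (mat_adjoint A) = dim_col A" "dim_col (mat_adjoint A) = dim_row A"
  by (simp_all add: mat_adjoint_def)

lemma mat_adjoint_carrier [simp, intro]:
  "A \<in> carrier_mat m n \<Longrightarrow> mat_adjoint A \<in> carrier_mat n m"
  by (rule carrier_matI) (simp_all add: carrier_matD)

lemma mat_adjoint_index [simp]:
  "i < dim_col A \<Longrightarrow> j < dim_row A \<Longrightarrow> mat_adjoint (A :: complex mat) $$ (i, j) = cnj (A $$ (j, i))"
  by (simp add: mat_adjoint_def mat_of_rows_def)

lemma mat_adjoint_adjoint [simp]: "mat_adjoint (mat_adjoint (A :: complex mat)) = A"
  by (rule eq_matI) auto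

lemma mat_adjoint_one [simp]: "mat_adjoint (1\<^sub>m n :: complex mat) = 1\<^sub>m n"
  by (rule eq_matI) auto

lemma mat_mult_index:
  "A \<in> carrier_mat m n \<Longrightarrow> B \<in> carrier_mat n l \<Longrightarrow> i < m \<Longrightarrow> j < l \<Longrightarrow>
    (A * B) $$ (i, j) = (\<Sum>k<n. A $$ (i, k) * B $$ (k, j))"
  by (simp add: scalar_prod_def atLeast0LessThan)

lemma mat_adjoint_mult:
  fixes A B :: "complex mat"
  assumes "A \<in> carrier_mat m n" "B \<in> carrier_mat n l"
  shows "mat_adjoint (A * B) = mat_adjoint B * mat_adjoint A"
proof (rule eq_matI)
  have [simp]: "dim_row A = m" "dim_col A = n" "dim_row B = n" "dim_col B = l"
    using assms by auto
  fix i j assume "i < dim_row (mat_adjoint B * mat_adjoint A)" "j < dim_col (mat_adjoint B * mat_adjoint A)"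
  hence ij: "i < l" "j < m" by simp_all
  have "mat_adjoint (A * B) $$ (i, j) = cnj ((A * B) $$ (j, i))"
    using ij by (subst mat_adjoint_index) simp_all
  also have "(A * B) $$ (j, i) = (\<Sum>k<n. A $$ (j, k) * B $$ (k, i))"
    by (rule mat_mult_index[OF assms ij(2,1)])
  also have "cnj (\<Sum>k<n. A $$ (j, k) * B $$ (k, i)) = (\<Sum>k<n. mat_adjoint B $$ (i, k) * mat_adjoint A $$ (k, j))"
    using ij by (auto intro!: sum.cong)
  also have "\<dots> = (mat_adjoint B * mat_adjoint A) $$ (i, j)"
    by (rule mat_mult_index[symmetric]) (use assms ij in auto)
  finally show "mat_adjoint (A * B) $$ (i, j) = (mat_adjoint B * mat_adjoint A) $$ (i, j)" .
next
  show "dim_row (mat_adjoint (A * B)) = dim_row (mat_adjoint B * mat_adjoint A)" by simp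
  show "dim_col (mat_adjoint (A * B)) = dim_col (mat_adjoint B * mat_adjoint A)" by simp
qed

lemma unitary_groupD:
  assumes "U \<in> unitary_group N"
  shows "U \<in> carrier_mat N N" "U * mat_adjoint U = 1\<^sub>m N" "mat_adjoint U * U = 1\<^sub>m N"
    "mat_adjoint U \<in> carrier_mat N N"
  using assms by (auto simp: unitary_group_def)

lemma unitary_group_one [simp]: "1\<^sub>m N \<in> unitary_group N"
  by (simp add: unitary_group_def)

lemma mat_mult_regroup:
  assumes "A \<in> carrier_mat n n" "B \<in> carrier_mat n n" "C \<in> carrier_mat n n" "D \<in> carrier_mat n n"
  shows "(A * B) * (C * D) = A * (B * C) * D"
proof -
  have "(A * B) * (C * D) = A * (B * (C * D))"
    by (rule assoc_mult_mat) (use assms in auto)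
  also have "B * (C * D) = B * C * D"
    by (rule assoc_mult_mat[symmetric]) (use assms in auto)
  also have "A * (B * C * D) = A * (B * C) * D"
    by (rule assoc_mult_mat[symmetric]) (use assms in auto)
  finally show ?thesis .
qed

lemma unitary_group_mult:
  assumes "U \<in> unitary_group N" "V \<in> unitary_group N"
  shows "U * V \<in> unitary_group N"
proof -
  note U = unitary_groupD[OF assms(1)] and V = unitary_groupD[OF assms(2)]
  have "U * V * mat_adjoint (U * V) = 1\<^sub>m N"
    unfolding mat_adjoint_mult[OF U(1) V(1)] mat_mult_regroup[OF U(1) V(1) V(4) U(4)] V(2)
    right_mult_one_mat[OF U(1)] by (rule U(2))
  moreover have "mat_adjoint (U * V) * (U * V) = 1\<^sub>m N"
    unfolding mat_adjoint_mult[OF U(1) V(1)] mat_mult_regroup[OF V(4) U(4) U(1) V(1)] U(3)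
    right_mult_one_mat[OF V(4)] by (rule V(3))
  ultimately show ?thesis using U(1) V(1) by (simp add: unitary_group_def)
qed

lemma unitary_group_adjoint:
  "U \<in> unitary_group N \<Longrightarrow> mat_adjoint U \<in> unitary_group N"
  by (auto simp: unitary_group_def)

lemma unitary_columns:
  assumes "U \<in> unitary_group N" "i < N" "j < N"
  shows "(\<Sum>k<N. cnj (U $$ (k, i)) * U $$ (k, j)) = of_bool (i = j)"
proof -
  note U = unitary_groupD[OF assms(1)]
  have "(\<Sum>k<N. cnj (U $$ (k, i)) * U $$ (k, j)) = (mat_adjoint U * U) $$ (i, j)"
    using U(1) assms(2,3) by (simp add: mat_mult_index[OF U(4,1)] del: index_mult_mat)
  thus ?thesis unfolding U(3) using assms by simp
qed

text \<open>Orthonormal columns suffice: a one-sided inverse of a square matrix is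
  two-sided.\<close>

lemma unitary_groupI:
  assumes "U \<in> carrier_mat N N"
    and "\<And>i j. i < N \<Longrightarrow> j < N \<Longrightarrow> (\<Sum>k<N. cnj (U $$ (k, i)) * U $$ (k, j)) = of_bool (i = j)"
  shows "U \<in> unitary_group N"
proof -
  have *: "mat_adjoint U * U = 1\<^sub>m N"
  proof (rule eq_matI)
    fix i j assume "i < dim_row (1\<^sub>m N :: complex mat)" "j < dim_col (1\<^sub>m N :: complex mat)"
    thus "(mat_adjoint U * U) $$ (i, j) = 1\<^sub>m N $$ (i, j)"
      using assms by (simp add: mat_mult_index[of _ N N _ N] del: index_mult_mat)
  qed (use assms in auto)
  have "U * mat_adjoint U = 1\<^sub>m N"
    by (rule mat_mult_left_right_inverse[OF _ _ *]) (use assms in auto)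
  thus ?thesis using * assms by (simp add: unitary_group_def)
qed

lemma sum_divmod:
  fixes f :: "nat \<Rightarrow> 'a :: comm_monoid_add"
  shows "(\<Sum>i<A * B. f i) = (\<Sum>a<A. \<Sum>b<B. f (a * B + b))"
proof -
  have "(\<Sum>i<A * B. f i) = (\<Sum>m<A. sum f {m * B..<m * B + B})"
    by (rule sum.nat_group[symmetric])
  also have "\<dots> = (\<Sum>a<A. \<Sum>b<B. f (a * B + b))"
  proof (rule sum.cong[OF refl])
    fix a
    show "sum f {a * B..<a * B + B} = (\<Sum>b<B. f (a * B + b))"
      by (rule sum.reindex_bij_witness[of _ "\<lambda>b. a * B + b" "\<lambda>i. i - a * B"]) auto
  qed
  finally show ?thesis .
qed

lemma kron_dim [simp]:
  "dim_row (kron A B) = dim_row A * dim_row B" "dim_col (kron A B) = dim_col A * dim_col B"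
  by (simp_all add: kron_def)

lemma kron_pow_dim [simp]:
  "dim_row (kron_pow k A) = dim_row A ^ k" "dim_col (kron_pow k A) = dim_col A ^ k"
  by (induction k) auto

lemma kron_pow_carrier [simp, intro]:
  "A \<in> carrier_mat m n \<Longrightarrow> kron_pow k A \<in> carrier_mat (m ^ k) (n ^ k)"
  by (rule carrier_matI) (simp_all add: carrier_matD)

lemma mat_adjoint_kron: "mat_adjoint (kron A B) = kron (mat_adjoint A) (mat_adjoint B)"
proof (rule eq_matI)
  fix i j
  assume "i < dim_row (kron (mat_adjoint A) (mat_adjoint B))" "j < dim_col (kron (mat_adjoint A) (mat_adjoint B))"
  hence ij: "i < dim_col A * dim_col B" "j < dim_row A * dim_row B" by simp_all
  hence "i div dim_col B < dim_col A" "j div dim_row B < dim_row A"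
    "i mod dim_col B < dim_col B" "j mod dim_row B < dim_row B"
    by (auto simp: less_mult_imp_div_less intro!: mod_less_divisor Nat.gr0I)
  thus "mat_adjoint (kron A B) $$ (i, j) = kron (mat_adjoint A) (mat_adjoint B) $$ (i, j)"
    using ij by (simp add: kron_def)
qed simp_all

lemma mat_adjoint_kron_pow: "mat_adjoint (kron_pow k A) = kron_pow k (mat_adjoint A)"
  by (induction k) (auto simp: mat_adjoint_kron)

section \<open>Hermitian matrices and the trace norm\<close>

definition diag_real :: "nat \<Rightarrow> (nat \<Rightarrow> real) \<Rightarrow> complex mat" where
  "diag_real n d = Matrix.mat n n (\<lambda>(i, j). if i = j then of_real (d i) else 0)"

lemma diag_real_carrier [simp]: "diag_real n d \<in> carrier_mat n n"
  by (simp add: diag_real_def)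

text \<open>Deflation step of the spectral theorem. The vector \<open>v\<close> is completed to a
  basis, Gram-Schmidt keeps its first vector, and normalising the resulting columns only rescales
  them, so column 0 stays parallel to \<open>v\<close>.\<close>

lemma unitary_with_first_column:
  fixes v :: "complex vec"
  assumes v: "v \<in> carrier_vec n" and v0: "v \<noteq> 0\<^sub>v n" and n: "n \<noteq> 0"
  obtains W c where "W \<in> unitary_group n" "c \<noteq> 0" "col W 0 = c \<cdot>\<^sub>v v"
proof -
  interpret cof_vec_space n "TYPE(complex)" .
  define b where "b = basis_completion v"
  define ws where "ws = gram_schmidt n b"
  from basis_completion[OF v v0, folded b_def]
  have dist_b: "distinct b" and indep: "\<not> lin_dep (set b)" and b: "set b \<subseteq> carrier_vec n"
    and hdb: "hd b = v" and len_b: "length b = n" by auto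
  from hdb len_b n obtain vs where bv: "b = v # vs" by (cases b) auto
  from gram_schmidt_result[OF b dist_b indep refl, folded ws_def]
  have ws: "set ws \<subseteq> carrier_vec n" "corthogonal ws" "length ws = n"
    by (auto simp: len_b)
  from gram_schmidt_hd[OF v, of vs, folded bv] have hdws: "hd ws = v" unfolding ws_def .
  have wsc: "ws ! i \<in> carrier_vec n" if "i < n" for i using ws that by auto
  define s where "s i = complex_of_real (sqrt (\<Sum>k<n. (cmod (ws ! i $ k))\<^sup>2))" for i
  have sp: "ws ! i \<bullet>c ws ! j = (\<Sum>k<n. ws ! i $ k * cnj (ws ! j $ k))" if "i < n" "j < n" for i j
    using wsc[OF that(1)] wsc[OF that(2)] by (simp add: scalar_prod_def atLeast0LessThan)
  have orth: "(\<Sum>k<n. ws ! i $ k * cnj (ws ! j $ k)) = 0 \<longleftrightarrow> i \<noteq> j" if "i < n" "j < n" for i j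
    using corthogonalD[OF ws(2), of i j] ws(3) that sp[OF that] by simp
  have ss: "(\<Sum>k<n. ws ! i $ k * cnj (ws ! i $ k)) = s i * s i" for i
    unfolding s_def of_real_mult[symmetric]
    by (simp add: sum_nonneg flip: complex_norm_square)
  have s0: "s i \<noteq> 0" if "i < n" for i
    using orth[OF that that] ss[of i] by auto
  have cs: "cnj (s i) = s i" for i by (simp add: s_def)
  define W where "W = Matrix.mat n n (\<lambda>(k, i). ws ! i $ k / s i)"
  have "W \<in> unitary_group n"
  proof (rule unitary_groupI)
    fix i j assume ij: "i < n" "j < n"
    have "(\<Sum>k<n. cnj (W $$ (k, i)) * W $$ (k, j)) = (\<Sum>k<n. ws ! j $ k * cnj (ws ! i $ k)) / (s i * s j)"
      using ij by (simp add: W_def sum_divide_distrib cs mult.commute)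
    also have "\<dots> = of_bool (i = j)"
      using orth[of j i] ij ss[of i] s0[OF ij(1)] by (cases "i = j") auto
    finally show "(\<Sum>k<n. cnj (W $$ (k, i)) * W $$ (k, j)) = of_bool (i = j)" .
  qed (simp add: W_def)
  moreover have "ws ! 0 = v" using hdws ws(3) n by (cases ws) auto
  hence "col W 0 = (1 / s 0) \<cdot>\<^sub>v v"
    using v n by (auto simp: W_def col_def)
  ultimately show ?thesis using that[of W "1 / s 0"] s0[of 0] n by auto
qed

text \<open>By induction on the dimension: an eigenvector becomes the first column of a unitary
  \<open>W\<close>, and in the new basis Hermitian symmetry turns the vanishing of the first column
  below the corner into the vanishing of the first row beside it. The remaining block is Hermitian
  of size \<open>n\<close>.\<close>

lemma hermitian_unitarily_diagonalizable:
  assumes "A \<in> carrier_mat n n" "mat_adjoint A = A"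
  shows "\<exists>Q d. Q \<in> unitary_group n \<and> A * Q = Q * diag_real n d"
  using assms
proof (induction n arbitrary: A)
  case 0
  show ?case
    by (intro exI[of _ "1\<^sub>m 0"] exI[of _ "\<lambda>_. 0"])
      (use 0 in \<open>auto simp: diag_real_def intro!: eq_matI\<close>)
next
  case (Suc n)
  note A = Suc.prems(1)
  have herm: "A $$ (j, i) = cnj (A $$ (i, j))" if "i < Suc n" "j < Suc n" for i j
    using mat_adjoint_index[of i A j] A that unfolding Suc.prems(2) by auto
  obtain es where "char_poly A = (\<Prod>a\<leftarrow>es. [:- a, 1:])" "length es = Suc n"
    using char_poly_factorized[OF A] by auto
  then obtain e where "poly (char_poly A) e = 0" by (cases es) auto
  hence "eigenvalue A e" using eigenvalue_root_char_poly[OF A] by simp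
  then obtain v where v: "v \<in> carrier_vec (Suc n)" "v \<noteq> 0\<^sub>v (Suc n)" "A *\<^sub>v v = e \<cdot>\<^sub>v v"
    using A unfolding eigenvalue_def eigenvector_def by auto
  obtain W c where W: "W \<in> unitary_group (Suc n)" and c: "c \<noteq> 0" and colW: "col W 0 = c \<cdot>\<^sub>v v"
    using unitary_with_first_column[OF v(1,2)] by auto
  note Wd = unitary_groupD[OF W]
  have AW0: "(A * W) $$ (i, 0) = e * W $$ (i, 0)" if "i < Suc n" for i
  proof -
    have "(A * W) $$ (i, 0) = row A i \<bullet> (c \<cdot>\<^sub>v v)" using A Wd that colW by simp
    also have "\<dots> = c * (row A i \<bullet> v)" using A v that by auto
    also have "row A i \<bullet> v = (A *\<^sub>v v) $ i" using A that by simp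
    also have "\<dots> = e * v $ i" unfolding v(3) using v that by simp
    also have "c * (e * v $ i) = e * (col W 0 $ i)" unfolding colW using v that by simp
    also have "col W 0 $ i = W $$ (i, 0)" using Wd that by simp
    finally show ?thesis .
  qed
  define B where "B = mat_adjoint W * (A * W)"
  have AW: "A * W \<in> carrier_mat (Suc n) (Suc n)" using A Wd by simp
  have B: "B \<in> carrier_mat (Suc n) (Suc n)" unfolding B_def by (rule mult_carrier_mat[OF Wd(4) AW])
  have "mat_adjoint B = mat_adjoint (A * W) * W"
    unfolding B_def using mat_adjoint_mult[OF Wd(4) AW] by simp
  also have "\<dots> = mat_adjoint W * A * W"
    using mat_adjoint_mult[OF A Wd(1)] Suc.prems(2) by simp
  also have "\<dots> = B" unfolding B_def by (rule assoc_mult_mat[OF Wd(4) A Wd(1)])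
  finally have hermB: "mat_adjoint B = B" .
  have hermB': "B $$ (j, i) = cnj (B $$ (i, j))" if "i < Suc n" "j < Suc n" for i j
    using mat_adjoint_index[of i B j] B that unfolding hermB by auto
  have B0: "B $$ (i, 0) = e * of_bool (i = 0)" if "i < Suc n" for i
  proof -
    have "B $$ (i, 0) = (\<Sum>k<Suc n. mat_adjoint W $$ (i, k) * (A * W) $$ (k, 0))"
      unfolding B_def by (rule mat_mult_index[OF Wd(4) AW]) (use that in auto)
    also have "\<dots> = e * (\<Sum>k<Suc n. cnj (W $$ (k, i)) * W $$ (k, 0))"
      unfolding sum_distrib_left
      by (intro sum.cong refl) (use Wd that AW0 in \<open>auto simp del: index_mult_mat\<close>)
    also have "\<dots> = e * of_bool (i = 0)"
      using unitary_columns[OF W that, of 0] by simp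
    finally show ?thesis .
  qed
  \<comment> \<open>Hermitian symmetry of the corner entry makes the eigenvalue real, as
    \<open>diag_real\<close> requires.\<close>
  have e: "cnj e = e" using hermB'[of 0 0] B0[of 0] by simp
  define B' where "B' = Matrix.mat n n (\<lambda>(i, j). B $$ (Suc i, Suc j))"
  have "mat_adjoint B' = B'"
  proof (rule eq_matI)
    fix i j assume "i < dim_row B'" "j < dim_col B'"
    hence ij: "i < n" "j < n" by (simp_all add: B'_def)
    show "mat_adjoint B' $$ (i, j) = B' $$ (i, j)"
      using ij by (simp add: B'_def hermB'[of "Suc j" "Suc i", symmetric])
  qed (simp_all add: B'_def)
  then obtain Q' d' where Q': "Q' \<in> unitary_group n" and BQ': "B' * Q' = Q' * diag_real n d'"
    using Suc.IH[of B'] by (auto simp: B'_def)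
  note Q'd = unitary_groupD[OF Q']
  \<comment> \<open>\<open>Q\<close> is the block sum of the scalar 1 and \<open>Q'\<close>.\<close>
  define Q where "Q = Matrix.mat (Suc n) (Suc n) (\<lambda>(i, j).
    if i = 0 \<or> j = 0 then of_bool (i = j) else Q' $$ (i - 1, j - 1))"
  have Qc: "Q \<in> carrier_mat (Suc n) (Suc n)" by (simp add: Q_def)
  have Q: "Q \<in> unitary_group (Suc n)"
  proof (rule unitary_groupI[OF Qc])
    fix i j assume "i < Suc n" "j < Suc n"
    thus "(\<Sum>k<Suc n. cnj (Q $$ (k, i)) * Q $$ (k, j)) = of_bool (i = j)"
      using unitary_columns[OF Q', of "i - 1" "j - 1"]
      by (cases i; cases j) (auto simp: Q_def sum.lessThan_Suc_shift simp del: sum.lessThan_Suc)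
  qed
  define d where "d i = (if i = 0 then Re e else d' (i - 1))" for i
  have Bz: "B $$ (0, Suc i) = 0" if "i < n" for i
    using hermB'[of "Suc i" 0] B0[of "Suc i"] that by simp
  have BQ: "B * Q = Q * diag_real (Suc n) d"
  proof (rule eq_matI)
    fix i j assume "i < dim_row (Q * diag_real (Suc n) d)" "j < dim_col (Q * diag_real (Suc n) d)"
    hence ij: "i < Suc n" "j < Suc n" by (auto simp: Q_def diag_real_def)
    have L: "(B * Q) $$ (i, j) = (\<Sum>k<Suc n. B $$ (i, k) * Q $$ (k, j))"
      by (rule mat_mult_index[OF B Qc ij])
    have R: "(Q * diag_real (Suc n) d) $$ (i, j) = (\<Sum>k<Suc n. Q $$ (i, k) * diag_real (Suc n) d $$ (k, j))"
      by (rule mat_mult_index[OF Qc diag_real_carrier ij])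
    have "(\<Sum>k<Suc n. B $$ (i, k) * Q $$ (k, j)) = (\<Sum>k<Suc n. Q $$ (i, k) * diag_real (Suc n) d $$ (k, j))"
    proof (cases j)
      case 0
      have "of_real (Re e) = e" using e by (simp add: complex_eq_iff)
      thus ?thesis using 0 ij B0[OF ij(1)]
        by (simp add: Q_def diag_real_def d_def sum.lessThan_Suc_shift of_bool_def del: sum.lessThan_Suc)
    next
      case (Suc j')
      show ?thesis
      proof (cases i)
        case 0
        thus ?thesis using Suc ij Bz
          by (simp add: Q_def diag_real_def d_def sum.lessThan_Suc_shift del: sum.lessThan_Suc)
      next
        case i: (Suc i')
        have ij': "i' < n" "j' < n" using ij Suc i by auto
        have "(\<Sum>k<n. B' $$ (i', k) * Q' $$ (k, j')) = (\<Sum>k<n. Q' $$ (i', k) * diag_real n d' $$ (k, j'))"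
          using arg_cong[OF BQ', of "\<lambda>M. M $$ (i', j')"] ij' Q'd(1)
          by (simp add: mat_mult_index[of _ n n _ n] B'_def del: index_mult_mat)
        thus ?thesis using Suc i ij'
          by (simp add: Q_def diag_real_def d_def B'_def sum.lessThan_Suc_shift
              del: sum.lessThan_Suc cong: if_cong)
      qed
    qed
    thus "(B * Q) $$ (i, j) = (Q * diag_real (Suc n) d) $$ (i, j)" unfolding L R .
  qed (use B Qc in \<open>auto simp: diag_real_def\<close>)
  have WB: "W * B = A * W"
  proof -
    have "W * B = W * mat_adjoint W * (A * W)" unfolding B_def
      by (rule assoc_mult_mat[symmetric, OF Wd(1) Wd(4) AW])
    thus ?thesis unfolding Wd(2) left_mult_one_mat[OF AW] .
  qed
  have "A * (W * Q) = A * W * Q" by (rule assoc_mult_mat[symmetric, OF A Wd(1) Qc])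
  also have "\<dots> = W * (B * Q)" unfolding WB[symmetric] by (rule assoc_mult_mat[OF Wd(1) B Qc])
  also have "\<dots> = W * Q * diag_real (Suc n) d" unfolding BQ
    by (rule assoc_mult_mat[symmetric, OF Wd(1) Qc diag_real_carrier])
  finally show ?case using unitary_group_mult[OF W Q] by blast
qed

text \<open>For Hermitian \<open>A\<close> the matrix in the definition of \<open>trace_norm\<close>
  is \<open>A * A\<close>, which is similar to the square of the diagonal matrix. Its characteristic
  roots, with multiplicity, are the squares of the \<open>d i\<close>, and their square roots are
  the absolute values.\<close>

lemma trace_norm_hermitian:
  assumes A: "A \<in> carrier_mat n n" "mat_adjoint A = A"
    and Q: "Q \<in> unitary_group n" and AQ: "A * Q = Q * diag_real n d"
  shows "trace_norm A = (\<Sum>i<n. \<bar>d i\<bar>)"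
proof -
  note Qd = unitary_groupD[OF Q]
  define D where "D = diag_real n d"
  have D: "D \<in> carrier_mat n n" by (simp add: D_def)
  have DD: "D * D = diag_real n (\<lambda>i. (d i)\<^sup>2)"
    by (rule eq_matI)
      (auto simp: D_def diag_real_def mat_mult_index[of _ n n _ n] power2_eq_square if_distrib
        simp del: index_mult_mat(1) cong: if_cong)
  have AA: "A * A \<in> carrier_mat n n" using A by simp
  have "(A * A) * Q = A * (A * Q)" by (rule assoc_mult_mat[OF A(1) A(1) Qd(1)])
  also have "A * Q = Q * D" using AQ by (simp only: D_def)
  also have "A * (Q * D) = A * Q * D" by (rule assoc_mult_mat[symmetric, OF A(1) Qd(1) D])
  also have "A * Q = Q * D" using AQ by (simp only: D_def)
  also have "Q * D * D = Q * (D * D)" by (rule assoc_mult_mat[OF Qd(1) D D])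
  finally have AAQ: "A * A * Q = Q * (D * D)" .
  have "A * A = A * A * (Q * mat_adjoint Q)" unfolding Qd(2) right_mult_one_mat[OF AA] ..
  also have "\<dots> = A * A * Q * mat_adjoint Q" by (rule assoc_mult_mat[symmetric, OF AA Qd(1,4)])
  also have "\<dots> = Q * (D * D) * mat_adjoint Q" unfolding AAQ ..
  finally have "A * A = Q * (D * D) * mat_adjoint Q" .
  hence "similar_mat_wit (A * A) (D * D) Q (mat_adjoint Q)"
    using AA Qd D by (auto intro!: similar_mat_witI[of _ _ n])
  hence "char_poly (A * A) = char_poly (D * D)"
    by (intro char_poly_similar) (auto simp: similar_mat_def)
  also have "\<dots> = (\<Prod>a\<leftarrow>diag_mat (D * D). [:- a, 1:])"
    by (rule char_poly_upper_triangular[of _ n]) (auto simp: DD diag_real_def)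
  also have "diag_mat (D * D) = map (\<lambda>i. complex_of_real ((d i)\<^sup>2)) [0..<n]"
    by (auto simp: DD diag_real_def diag_mat_def)
  finally have cp: "char_poly (A * A) = (\<Prod>i\<leftarrow>[0..<n]. [:- complex_of_real ((d i)\<^sup>2), 1:])"
    by (simp add: o_def)
  have pr: "proots (\<Prod>a\<leftarrow>xs. [:- a, 1:]) = mset (xs :: complex list)" for xs
  proof (induction xs)
    case (Cons a xs)
    have "(\<Prod>a\<leftarrow>xs. [:- a, 1:]) \<noteq> 0" by (auto simp: prod_list_zero_iff)
    thus ?case using Cons by (simp add: proots_mult del: mult_pCons_left)
  qed simp
  have "proots (char_poly (A * A)) = mset (map (\<lambda>i. complex_of_real ((d i)\<^sup>2)) [0..<n])"
    using pr[of "map (\<lambda>i. complex_of_real ((d i)\<^sup>2)) [0..<n]"] by (simp add: cp o_def)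
  hence "trace_norm A = (\<Sum>x\<in>#mset (map (\<lambda>i. complex_of_real ((d i)\<^sup>2)) [0..<n]). sqrt (Re x))"
    by (simp add: trace_norm_def A)
  also have "\<dots> = (\<Sum>i\<leftarrow>[0..<n]. \<bar>d i\<bar>)"
    by (simp only: mset_map[symmetric] sum_mset_sum_list map_map o_def) simp
  also have "\<dots> = (\<Sum>i<n. \<bar>d i\<bar>)"
    by (simp add: sum_list_distinct_conv_sum_set atLeast0LessThan)
  finally show ?thesis .
qed

section \<open>Orthonormal families and Bessel's inequality\<close>

definition orthonormal_on :: "nat \<Rightarrow> 'x set \<Rightarrow> ('x \<Rightarrow> nat \<Rightarrow> complex) \<Rightarrow> bool" where
  "orthonormal_on D S w \<longleftrightarrow> (\<forall>x\<in>S. \<forall>y\<in>S. (\<Sum>i<D. cnj (w x i) * w y i) = of_bool (x = y))"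

text \<open>The vector \<open>p\<close> is the orthogonal projection of \<open>q\<close> onto the
  span of the family, and the gap between the two sides is the squared norm of
  \<open>q - p\<close>.\<close>

lemma bessel:
  assumes S: "finite S" and w: "orthonormal_on D S w"
  shows "(\<Sum>x\<in>S. (cmod (\<Sum>i<D. cnj (w x i) * q i))\<^sup>2) \<le> (\<Sum>i<D. (cmod (q i))\<^sup>2)"
proof -
  define c where "c x = (\<Sum>i<D. cnj (w x i) * q i)" for x
  define p where "p i = (\<Sum>x\<in>S. c x * w x i)" for i
  have qp: "(\<Sum>i<D. q i * cnj (p i)) = (\<Sum>x\<in>S. c x * cnj (c x))"
  proof -
    have "(\<Sum>i<D. q i * cnj (p i)) = (\<Sum>i<D. \<Sum>x\<in>S. cnj (c x) * (cnj (w x i) * q i))"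
      by (simp add: p_def sum_distrib_left algebra_simps)
    also have "\<dots> = (\<Sum>x\<in>S. \<Sum>i<D. cnj (c x) * (cnj (w x i) * q i))" by (rule sum.swap)
    also have "\<dots> = (\<Sum>x\<in>S. c x * cnj (c x))"
      unfolding sum_distrib_left[symmetric] c_def[symmetric] by (simp add: mult.commute)
    finally show ?thesis .
  qed
  have "(\<Sum>i<D. p i * cnj (p i)) = (\<Sum>i<D. \<Sum>x\<in>S. \<Sum>y\<in>S. c x * cnj (c y) * (cnj (w y i) * w x i))"
    by (simp add: p_def sum_product algebra_simps)
  also have "\<dots> = (\<Sum>x\<in>S. \<Sum>y\<in>S. \<Sum>i<D. c x * cnj (c y) * (cnj (w y i) * w x i))"
    by (subst sum.swap, subst (2) sum.swap) rule
  also have "\<dots> = (\<Sum>x\<in>S. \<Sum>y\<in>S. c x * cnj (c y) * of_bool (y = x))"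
    using w by (simp add: orthonormal_on_def flip: sum_distrib_left)
  also have "\<dots> = (\<Sum>x\<in>S. c x * cnj (c x))" using S by (simp add: of_bool_def if_distrib cong: if_cong)
  finally have pp: "(\<Sum>i<D. p i * cnj (p i)) = (\<Sum>x\<in>S. c x * cnj (c x))" .
  have pq: "(\<Sum>i<D. p i * cnj (q i)) = (\<Sum>x\<in>S. c x * cnj (c x))"
    using arg_cong[OF qp, of cnj] by (simp add: mult.commute)
  have "complex_of_real (\<Sum>i<D. (cmod (q i - p i))\<^sup>2) = (\<Sum>i<D. (q i - p i) * cnj (q i - p i))"
    by (simp only: of_real_sum complex_norm_square)
  also have "\<dots> = (\<Sum>i<D. q i * cnj (q i)) - (\<Sum>i<D. q i * cnj (p i)) - (\<Sum>i<D. p i * cnj (q i)) + (\<Sum>i<D. p i * cnj (p i))"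
    by (simp add: algebra_simps sum.distrib sum_subtractf)
  also have "\<dots> = (\<Sum>i<D. q i * cnj (q i)) - (\<Sum>x\<in>S. c x * cnj (c x))"
    unfolding qp pp pq by simp
  also have "\<dots> = complex_of_real ((\<Sum>i<D. (cmod (q i))\<^sup>2) - (\<Sum>x\<in>S. (cmod (c x))\<^sup>2))"
    by (simp only: of_real_diff of_real_sum complex_norm_square)
  finally have "(\<Sum>i<D. (cmod (q i))\<^sup>2) - (\<Sum>x\<in>S. (cmod (c x))\<^sup>2) = (\<Sum>i<D. (cmod (q i - p i))\<^sup>2)"
    by (simp only: of_real_eq_iff)
  moreover have "0 \<le> (\<Sum>i<D. (cmod (q i - p i))\<^sup>2)" by (simp add: sum_nonneg)
  ultimately show ?thesis by (simp add: c_def)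
qed

section \<open>Designs and two-copy overlaps\<close>

definition qform :: "nat \<Rightarrow> (nat \<Rightarrow> complex) \<Rightarrow> complex mat \<Rightarrow> complex" where
  "qform D w X = (\<Sum>i<D. \<Sum>j<D. cnj (w i) * X $$ (i, j) * w j)"

text \<open>The left side is the modulus of the trace of \<open>X\<close> against the projector onto
  the span of the family. In an eigenbasis of \<open>X\<close> each eigenvalue is weighted by the
  squared length of a projected unit vector, which is at most 1 by Bessel.\<close>

lemma sum_qform_le_trace_norm:
  assumes X: "X \<in> carrier_mat D D" "mat_adjoint X = X"
    and S: "finite S" "orthonormal_on D S w"
  shows "cmod (\<Sum>x\<in>S. qform D (w x) X) \<le> trace_norm X"
proof -
  obtain Q d where Q: "Q \<in> unitary_group D" and XQ: "X * Q = Q * diag_real D d"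
    using hermitian_unitarily_diagonalizable[OF X] by blast
  note Qd = unitary_groupD[OF Q]
  have entry: "X $$ (i, j) = (\<Sum>m<D. of_real (d m) * (Q $$ (i, m) * cnj (Q $$ (j, m))))"
    if ij: "i < D" "j < D" for i j
  proof -
    have "X = X * (Q * mat_adjoint Q)" using X Qd(2) by simp
    also have "\<dots> = X * Q * mat_adjoint Q" by (rule assoc_mult_mat[symmetric, OF X(1) Qd(1,4)])
    also have "\<dots> = Q * diag_real D d * mat_adjoint Q" unfolding XQ ..
    finally have "X $$ (i, j) = (Q * diag_real D d * mat_adjoint Q) $$ (i, j)" by simp
    also have "\<dots> = (\<Sum>m<D. (Q * diag_real D d) $$ (i, m) * mat_adjoint Q $$ (m, j))"
      by (rule mat_mult_index[OF mult_carrier_mat[OF Qd(1) diag_real_carrier] Qd(4) ij])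
    also have "\<dots> = (\<Sum>m<D. of_real (d m) * (Q $$ (i, m) * cnj (Q $$ (j, m))))"
    proof (rule sum.cong[OF refl])
      fix m assume "m \<in> {..<D}"
      hence m: "m < D" by simp
      have "(Q * diag_real D d) $$ (i, m) = (\<Sum>l<D. Q $$ (i, l) * diag_real D d $$ (l, m))"
        by (rule mat_mult_index[OF Qd(1) diag_real_carrier ij(1) m])
      also have "\<dots> = Q $$ (i, m) * of_real (d m)"
        using m by (simp add: diag_real_def if_distrib cong: if_cong)
      finally show "(Q * diag_real D d) $$ (i, m) * mat_adjoint Q $$ (m, j) =
          of_real (d m) * (Q $$ (i, m) * cnj (Q $$ (j, m)))"
        using m ij Qd by (simp del: index_mult_mat)
    qed
    finally show ?thesis .
  qed
  define a where "a x m = (\<Sum>i<D. cnj (w x i) * Q $$ (i, m))" for x m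
  have qf: "qform D (w x) X = (\<Sum>m<D. of_real (d m) * of_real ((cmod (a x m))\<^sup>2))" for x
  proof -
    have "qform D (w x) X = (\<Sum>i<D. \<Sum>j<D. \<Sum>m<D. of_real (d m) *
        ((cnj (w x i) * Q $$ (i, m)) * cnj (cnj (w x j) * Q $$ (j, m))))"
      unfolding qform_def
      by (intro sum.cong refl) (simp add: entry sum_distrib_left sum_distrib_right algebra_simps)
    also have "\<dots> = (\<Sum>m<D. \<Sum>i<D. \<Sum>j<D. of_real (d m) *
        ((cnj (w x i) * Q $$ (i, m)) * cnj (cnj (w x j) * Q $$ (j, m))))"
      by (subst (2) sum.swap, subst sum.swap) rule
    also have "\<dots> = (\<Sum>m<D. of_real (d m) * (a x m * cnj (a x m)))"
    proof (rule sum.cong[OF refl])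
      fix m
      have "a x m * cnj (a x m) = (\<Sum>i<D. \<Sum>j<D. (cnj (w x i) * Q $$ (i, m)) * cnj (cnj (w x j) * Q $$ (j, m)))"
        unfolding a_def cnj_sum by (rule sum_product)
      thus "(\<Sum>i<D. \<Sum>j<D. of_real (d m) * ((cnj (w x i) * Q $$ (i, m)) * cnj (cnj (w x j) * Q $$ (j, m)))) =
          of_real (d m) * (a x m * cnj (a x m))"
        by (simp only: sum_distrib_left)
    qed
    also have "\<dots> = (\<Sum>m<D. of_real (d m) * of_real ((cmod (a x m))\<^sup>2))"
      by (simp only: complex_norm_square)
    finally show ?thesis .
  qed
  have "(\<Sum>x\<in>S. qform D (w x) X) = (\<Sum>m<D. of_real (d m) * of_real (\<Sum>x\<in>S. (cmod (a x m))\<^sup>2))"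
    unfolding qf by (subst sum.swap) (simp add: sum_distrib_left)
  hence "cmod (\<Sum>x\<in>S. qform D (w x) X) \<le> (\<Sum>m<D. cmod (of_real (d m) * of_real (\<Sum>x\<in>S. (cmod (a x m))\<^sup>2)))"
    by (simp only: norm_sum)
  also have "\<dots> \<le> (\<Sum>m<D. \<bar>d m\<bar>)"
  proof (rule sum_mono)
    fix m assume "m \<in> {..<D}"
    hence m: "m < D" by simp
    have "(\<Sum>x\<in>S. (cmod (a x m))\<^sup>2) \<le> (\<Sum>i<D. (cmod (Q $$ (i, m)))\<^sup>2)"
      unfolding a_def by (rule bessel[OF S])
    also have "\<dots> = 1"
    proof -
      have "complex_of_real (\<Sum>i<D. (cmod (Q $$ (i, m)))\<^sup>2) = (\<Sum>i<D. cnj (Q $$ (i, m)) * Q $$ (i, m))"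
        by (simp only: of_real_sum complex_norm_square mult.commute)
      also have "\<dots> = 1" using unitary_columns[OF Q m m] by simp
      finally show ?thesis by (simp only: of_real_eq_1_iff)
    qed
    finally have le: "(\<Sum>x\<in>S. (cmod (a x m))\<^sup>2) \<le> 1" .
    have "cmod (of_real (d m) * of_real (\<Sum>x\<in>S. (cmod (a x m))\<^sup>2)) = \<bar>d m\<bar> * (\<Sum>x\<in>S. (cmod (a x m))\<^sup>2)"
      unfolding norm_mult norm_of_real by (simp add: sum_nonneg)
    also have "\<dots> \<le> \<bar>d m\<bar>" using le by (rule mult_left_le) simp
    finally show "cmod (of_real (d m) * of_real (\<Sum>x\<in>S. (cmod (a x m))\<^sup>2)) \<le> \<bar>d m\<bar>" .
  qed
  also have "\<dots> = trace_norm X" using trace_norm_hermitian[OF X Q XQ] by simp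
  finally show ?thesis .
qed

definition rank_one :: "nat \<Rightarrow> (nat \<Rightarrow> complex) \<Rightarrow> complex mat" where
  "rank_one D v = Matrix.mat D D (\<lambda>(i, j). v i * cnj (v j))"

lemma rank_one_carrier [simp]: "rank_one D v \<in> carrier_mat D D"
  by (simp add: rank_one_def)

text \<open>The eigenvalue relation shows that \<open>d m\<close> is the squared overlap of
  \<open>v\<close> with the m-th eigenvector. So all eigenvalues are nonnegative, and Bessel bounds
  their sum. This makes a unit vector an admissible input in the supremum that defines
  \<open>diamond_norm\<close>.\<close>

lemma trace_norm_rank_one:
  assumes v: "(\<Sum>i<D. (cmod (v i))\<^sup>2) = 1"
  shows "trace_norm (rank_one D v) \<le> 1"
proof -
  let ?X = "rank_one D v"
  have herm: "mat_adjoint ?X = ?X"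
    by (rule eq_matI) (auto simp: rank_one_def)
  obtain Q d where Q: "Q \<in> unitary_group D" and XQ: "?X * Q = Q * diag_real D d"
    using hermitian_unitarily_diagonalizable[OF rank_one_carrier herm] by blast
  note Qd = unitary_groupD[OF Q]
  have d: "d m = (cmod (\<Sum>i<D. cnj (Q $$ (i, m)) * v i))\<^sup>2" if m: "m < D" for m
  proof -
    have e: "(\<Sum>j<D. ?X $$ (i, j) * Q $$ (j, m)) = Q $$ (i, m) * of_real (d m)" if i: "i < D" for i
    proof -
      have "(\<Sum>j<D. ?X $$ (i, j) * Q $$ (j, m)) = (?X * Q) $$ (i, m)"
        by (rule mat_mult_index[symmetric, OF rank_one_carrier Qd(1) i m])
      also have "\<dots> = (\<Sum>l<D. Q $$ (i, l) * diag_real D d $$ (l, m))"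
        unfolding XQ by (rule mat_mult_index[OF Qd(1) diag_real_carrier i m])
      also have "\<dots> = Q $$ (i, m) * of_real (d m)"
        using m by (simp add: diag_real_def if_distrib cong: if_cong)
      finally show ?thesis .
    qed
    let ?a = "\<Sum>i<D. cnj (Q $$ (i, m)) * v i"
    have "complex_of_real ((cmod ?a)\<^sup>2) = ?a * cnj ?a" by (rule complex_norm_square)
    also have "\<dots> = (\<Sum>i<D. \<Sum>j<D. cnj (Q $$ (i, m)) * v i * cnj (cnj (Q $$ (j, m)) * v j))"
      unfolding cnj_sum by (rule sum_product)
    also have "\<dots> = (\<Sum>i<D. cnj (Q $$ (i, m)) * (\<Sum>j<D. ?X $$ (i, j) * Q $$ (j, m)))"
      unfolding sum_distrib_left
      by (intro sum.cong refl) (simp add: rank_one_def algebra_simps)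
    also have "\<dots> = of_real (d m) * (\<Sum>i<D. cnj (Q $$ (i, m)) * Q $$ (i, m))"
      unfolding sum_distrib_left[of "of_real (d m)"]
    proof (rule sum.cong[OF refl])
      fix i assume "i \<in> {..<D}"
      thus "cnj (Q $$ (i, m)) * (\<Sum>j<D. ?X $$ (i, j) * Q $$ (j, m)) = of_real (d m) * (cnj (Q $$ (i, m)) * Q $$ (i, m))"
        by (subst e) simp_all
    qed
    also have "\<dots> = of_real (d m)" using unitary_columns[OF Q m m] by simp
    finally show ?thesis by (simp only: of_real_eq_iff)
  qed
  have "trace_norm ?X = (\<Sum>m<D. \<bar>d m\<bar>)"
    by (rule trace_norm_hermitian[OF rank_one_carrier herm Q XQ])
  also have "\<dots> = (\<Sum>m<D. (cmod (\<Sum>i<D. cnj (Q $$ (i, m)) * v i))\<^sup>2)"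
    by (intro sum.cong refl) (simp add: d)
  also have "\<dots> \<le> (\<Sum>i<D. (cmod (v i))\<^sup>2)"
    by (rule bessel) (auto simp: orthonormal_on_def unitary_columns[OF Q])
  finally show ?thesis using v by simp
qed

text \<open>A common interface for the Haar measure, whose space is the group itself, and for the
  design, whose space is all matrices and which lies in the group only almost surely.\<close>

definition random_unitary :: "nat \<Rightarrow> complex mat measure \<Rightarrow> bool" where
  "random_unitary N M \<longleftrightarrow> prob_space M \<and> space M \<subseteq> carrier_mat N N \<and>
    (\<forall>i<N. \<forall>j<N. (\<lambda>U. U $$ (i, j)) \<in> borel_measurable M) \<and> (AE U in M. U \<in> unitary_group N)"

lemma mat_entry_measurable [measurable]:
  assumes "i < N" "j < N"
  shows "(\<lambda>U. U $$ (i, j)) \<in> borel_measurable (mat_borel N)"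
proof (rule measurableI)
  fix B :: "complex set" assume B: "B \<in> sets borel"
  have sp: "space (mat_borel N) = carrier_mat N N"
    unfolding mat_borel_def by (rule space_measure_of) auto
  have st: "sets (mat_borel N) = sigma_sets (carrier_mat N N)
     {{A \<in> carrier_mat N N. A $$ (i, j) \<in> B} | i j B. i < N \<and> j < N \<and> B \<in> sets borel}"
    unfolding mat_borel_def by (rule sets_measure_of) auto
  have "(\<lambda>U. U $$ (i, j)) -` B \<inter> space (mat_borel N) = {A \<in> carrier_mat N N. A $$ (i, j) \<in> B}"
    unfolding sp by auto
  also have "\<dots> \<in> sets (mat_borel N)"
    unfolding st by (rule sigma_sets.Basic) (use assms B in blast)
  finally show "(\<lambda>U. U $$ (i, j)) -` B \<inter> space (mat_borel N) \<in> sets (mat_borel N)" .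
qed simp

lemma space_mat_borel [simp]: "space (mat_borel N) = carrier_mat N N"
  unfolding mat_borel_def by (rule space_measure_of) auto

lemma random_unitary_haar:
  assumes "haar_measure N G \<mu>" "G \<subseteq> unitary_group N"
  shows "random_unitary N \<mu>"
proof -
  have sp: "space \<mu> = G" and st: "sets \<mu> = sets (restrict_space (mat_borel N) G)" and "prob_space \<mu>"
    using assms by (auto simp: haar_measure_def)
  have "(\<lambda>U. U $$ (i, j)) \<in> borel_measurable \<mu>" if "i < N" "j < N" for i j
    using measurable_restrict_space1[OF mat_entry_measurable[OF that], of G] measurable_cong_sets[OF st refl]
    by blast
  moreover have "G \<subseteq> carrier_mat N N" using assms(2) unitary_groupD(1) by blast
  moreover have "AE U in \<mu>. U \<in> unitary_group N"
    using assms(2) sp by (intro AE_I2) auto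
  ultimately show ?thesis using \<open>prob_space \<mu>\<close> sp by (auto simp: random_unitary_def)
qed

lemma random_unitary_design:
  assumes "prob_space \<nu>" "sets \<nu> = sets (mat_borel N)" "AE U in \<nu>. U \<in> G" "G \<subseteq> unitary_group N"
  shows "random_unitary N \<nu>"
proof -
  have "space \<nu> = carrier_mat N N" using sets_eq_imp_space_eq[OF assms(2)] by simp
  moreover have "(\<lambda>U. U $$ (i, j)) \<in> borel_measurable \<nu>" if "i < N" "j < N" for i j
    using mat_entry_measurable[OF that] measurable_cong_sets[OF assms(2) refl] by blast
  moreover have "AE U in \<nu>. U \<in> unitary_group N"
    using assms(3) by eventually_elim (use assms(4) in blast)
  ultimately show ?thesis using assms(1) by (auto simp: random_unitary_def)
qed

section \<open>Measurability and boundedness of the entries of tensor powers\<close>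

lemma kron_pow_Suc_index:
  assumes "U \<in> carrier_mat N N" "i < N * N ^ k" "j < N * N ^ k"
  shows "kron_pow (Suc k) U $$ (i, j) = U $$ (i div N ^ k, j div N ^ k) * kron_pow k U $$ (i mod N ^ k, j mod N ^ k)"
  using assms by (simp add: kron_def)

lemma div_mod_less:
  fixes i :: nat
  assumes "i < N * K"
  shows "i div K < N" "i mod K < K"
  using assms by (auto simp: less_mult_imp_div_less intro!: mod_less_divisor Nat.gr0I)

lemma kron_pow_measurable:
  assumes "random_unitary N M" "i < N ^ k" "j < N ^ k"
  shows "(\<lambda>U. kron_pow k U $$ (i, j)) \<in> borel_measurable M"
  using assms(2,3)
proof (induction k arbitrary: i j)
  case (Suc k)
  have "(\<lambda>U. U $$ (i div N ^ k, j div N ^ k) * kron_pow k U $$ (i mod N ^ k, j mod N ^ k)) \<in> borel_measurable M"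
    using Suc assms(1) div_mod_less[of i N "N ^ k"] div_mod_less[of j N "N ^ k"]
    by (intro borel_measurable_times Suc.IH) (auto simp: random_unitary_def)
  thus ?case
    by (rule measurable_cong[THEN iffD1, rotated])
      (use Suc.prems assms(1) in \<open>simp add: kron_pow_Suc_index[of _ N] random_unitary_def subset_iff del: kron_pow.simps\<close>)
qed simp

lemma unitary_entry_bound:
  assumes "U \<in> unitary_group N" "i < N" "j < N"
  shows "cmod (U $$ (i, j)) \<le> 1"
proof -
  have "complex_of_real (\<Sum>k<N. (cmod (U $$ (k, j)))\<^sup>2) = (\<Sum>k<N. cnj (U $$ (k, j)) * U $$ (k, j))"
    by (simp only: of_real_sum complex_norm_square mult.commute)
  also have "\<dots> = 1" using unitary_columns[OF assms(1,3,3)] by simp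
  finally have "(\<Sum>k<N. (cmod (U $$ (k, j)))\<^sup>2) = 1" by (simp only: of_real_eq_1_iff)
  hence "(cmod (U $$ (i, j)))\<^sup>2 \<le> 1"
    using member_le_sum[of i "{..<N}" "\<lambda>k. (cmod (U $$ (k, j)))\<^sup>2"] assms(2) by simp
  thus ?thesis by (simp add: power_le_one_iff)
qed

lemma kron_pow_entry_bound:
  assumes "U \<in> unitary_group N" "i < N ^ k" "j < N ^ k"
  shows "cmod (kron_pow k U $$ (i, j)) \<le> 1"
  using assms(2,3)
proof (induction k arbitrary: i j)
  case (Suc k)
  have ij: "i < N * N ^ k" "j < N * N ^ k" using Suc.prems by simp_all
  show ?case
    unfolding kron_pow_Suc_index[OF unitary_groupD(1)[OF assms(1)] ij] norm_mult
    using Suc.IH[of "i mod N ^ k" "j mod N ^ k"] unitary_entry_bound[OF assms(1)] div_mod_less[OF ij(1)] div_mod_less[OF ij(2)]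
    by (intro mult_le_one) auto
qed simp

section \<open>Transition amplitudes and twirls of pure states\<close>

definition moved :: "nat \<Rightarrow> nat \<Rightarrow> (nat \<Rightarrow> complex) \<Rightarrow> complex mat \<Rightarrow> nat \<Rightarrow> complex" where
  "moved N k v U i = (\<Sum>l<N ^ k. kron_pow k U $$ (i, l) * v l)"

text \<open>The amplitude of \<open>w\<close> in the image of \<open>v\<close> under the k-fold
  tensor power of \<open>U\<close>. For unit vectors its squared modulus is the probability of the
  outcome \<open>w\<close>.\<close>

definition overlap :: "nat \<Rightarrow> nat \<Rightarrow> (nat \<Rightarrow> complex) \<Rightarrow> (nat \<Rightarrow> complex) \<Rightarrow> complex mat \<Rightarrow> complex" where
  "overlap N k w v U = (\<Sum>i<N ^ k. cnj (w i) * moved N k v U i)"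

lemma moved_measurable:
  "random_unitary N M \<Longrightarrow> i < N ^ k \<Longrightarrow> (\<lambda>U. moved N k v U i) \<in> borel_measurable M"
  unfolding moved_def by (auto intro!: borel_measurable_sum borel_measurable_times kron_pow_measurable)

lemma moved_bound:
  assumes "U \<in> unitary_group N" "i < N ^ k"
  shows "cmod (moved N k v U i) \<le> (\<Sum>l<N ^ k. cmod (v l))"
  unfolding moved_def
  by (rule order_trans[OF norm_sum], rule sum_mono)
    (use assms kron_pow_entry_bound in \<open>auto simp: norm_mult intro!: mult_left_le_one_le\<close>)

text \<open>Entries of tensor powers of a unitary have modulus at most 1, so these products are
  bounded almost everywhere, and bounded measurable functions are integrable on a probability space.
  Integrability is what later allows the integral to be exchanged with finite sums.\<close>

lemma moved_integrable:
  assumes "random_unitary N M" "i < N ^ k" "j < N ^ k"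
  shows "integrable M (\<lambda>U. moved N k v U i * cnj (moved N k v U j))"
proof -
  interpret prob_space M using assms by (simp add: random_unitary_def)
  let ?B = "\<Sum>l<N ^ k. cmod (v l)"
  have ae: "AE U in M. U \<in> unitary_group N" using assms by (simp add: random_unitary_def)
  have "AE U in M. cmod (moved N k v U i * cnj (moved N k v U j)) \<le> ?B * ?B"
    using ae by eventually_elim
      (use assms moved_bound in \<open>auto simp: norm_mult intro!: mult_mono sum_nonneg\<close>)
  moreover have "(\<lambda>U. moved N k v U i * cnj (moved N k v U j)) \<in> borel_measurable M"
    by (intro borel_measurable_times moved_measurable assms
        measurable_compose[OF moved_measurable, OF assms(1,3) borel_measurable_continuous_onI]
        continuous_intros)
  ultimately show ?thesis by (intro integrable_const_bound)
qed

text \<open>Conjugating the outer product of \<open>v\<close> with itself gives the outer product of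
  the moved vector with itself.\<close>

lemma twirl_rank_one:
  assumes M: "random_unitary N M" and ij: "i < N ^ k" "j < N ^ k"
  shows "twirl N k M (rank_one (N ^ k) v) $$ (i, j) = (\<integral>U. moved N k v U i * cnj (moved N k v U j) \<partial>M)"
proof -
  have "(kron_pow k U * rank_one (N ^ k) v * kron_pow k (mat_adjoint U)) $$ (i, j) =
      moved N k v U i * cnj (moved N k v U j)" if "U \<in> space M" for U
  proof -
    have U: "U \<in> carrier_mat N N" using that M by (auto simp: random_unitary_def)
    let ?K = "kron_pow k U"
    have K: "?K \<in> carrier_mat (N ^ k) (N ^ k)" using U by simp
    have K': "mat_adjoint ?K \<in> carrier_mat (N ^ k) (N ^ k)" using K by simp
    have KR: "?K * rank_one (N ^ k) v \<in> carrier_mat (N ^ k) (N ^ k)"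
      by (rule mult_carrier_mat[OF K rank_one_carrier])
    have "(?K * rank_one (N ^ k) v * kron_pow k (mat_adjoint U)) $$ (i, j) =
        (\<Sum>m<N ^ k. (?K * rank_one (N ^ k) v) $$ (i, m) * mat_adjoint ?K $$ (m, j))"
      unfolding mat_adjoint_kron_pow[symmetric] by (rule mat_mult_index[OF KR K' ij])
    also have "\<dots> = (\<Sum>m<N ^ k. moved N k v U i * cnj (?K $$ (j, m) * v m))"
    proof (rule sum.cong[OF refl])
      fix m assume "m \<in> {..<N ^ k}"
      hence m: "m < N ^ k" by simp
      have "(?K * rank_one (N ^ k) v) $$ (i, m) = (\<Sum>l<N ^ k. ?K $$ (i, l) * rank_one (N ^ k) v $$ (l, m))"
        by (rule mat_mult_index[OF K rank_one_carrier ij(1) m])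
      also have "\<dots> = moved N k v U i * cnj (v m)"
        unfolding moved_def sum_distrib_right
        by (intro sum.cong refl) (use m in \<open>simp add: rank_one_def\<close>)
      finally have e: "(?K * rank_one (N ^ k) v) $$ (i, m) = moved N k v U i * cnj (v m)" .
      have a: "mat_adjoint ?K $$ (m, j) = cnj (?K $$ (j, m))"
        by (rule mat_adjoint_index) (use m ij U in auto)
      show "(?K * rank_one (N ^ k) v) $$ (i, m) * mat_adjoint ?K $$ (m, j) =
          moved N k v U i * cnj (?K $$ (j, m) * v m)"
        unfolding e a by simp
    qed
    also have "\<dots> = moved N k v U i * cnj (moved N k v U j)"
      unfolding moved_def[of N k v U j] cnj_sum sum_distrib_left ..
    finally show ?thesis .
  qed
  thus ?thesis using ij by (simp add: twirl_def cong: Bochner_Integration.integral_cong)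
qed

lemma overlap_square:
  "complex_of_real ((cmod (overlap N k w v U))\<^sup>2) =
    (\<Sum>i<N ^ k. \<Sum>j<N ^ k. cnj (w i) * w j * (moved N k v U i * cnj (moved N k v U j)))"
  unfolding complex_norm_square overlap_def cnj_sum sum_product
  by (intro sum.cong refl) simp

lemma overlap_square_integrable:
  assumes M: "random_unitary N M"
  shows "integrable M (\<lambda>U. (cmod (overlap N k w v U))\<^sup>2)"
proof -
  have "integrable M (\<lambda>U. complex_of_real ((cmod (overlap N k w v U))\<^sup>2))"
    unfolding overlap_square
    by (intro Bochner_Integration.integrable_sum integrable_mult_right moved_integrable[OF M]) auto
  thus ?thesis by (simp only: complex_of_real_integrable_eq)
qed

text \<open>This converts quadratic forms of twirled pure states into mean transition probabilities,
  the only quantities in which the two twirls are compared.\<close>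

lemma qform_twirl_rank_one:
  assumes M: "random_unitary N M"
  shows "qform (N ^ k) w (twirl N k M (rank_one (N ^ k) v)) = of_real (\<integral>U. (cmod (overlap N k w v U))\<^sup>2 \<partial>M)"
proof -
  have "of_real (\<integral>U. (cmod (overlap N k w v U))\<^sup>2 \<partial>M) = (\<integral>U. complex_of_real ((cmod (overlap N k w v U))\<^sup>2) \<partial>M)"
    by (rule integral_complex_of_real[symmetric])
  also have "\<dots> = (\<Sum>i<N ^ k. \<Sum>j<N ^ k. cnj (w i) * w j * (\<integral>U. moved N k v U i * cnj (moved N k v U j) \<partial>M))"
    unfolding overlap_square
    by (subst Bochner_Integration.integral_sum Bochner_Integration.integral_mult_right;
        (intro Bochner_Integration.integrable_sum integrable_mult_right moved_integrable[OF M] sum.cong refl)?; simp?)+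
  also have "\<dots> = qform (N ^ k) w (twirl N k M (rank_one (N ^ k) v))"
    unfolding qform_def by (intro sum.cong refl) (simp add: twirl_rank_one[OF M])
  finally show ?thesis ..
qed

text \<open>Operational content of the diamond norm: the total probability of a set of orthonormal
  outcomes changes by at most \<epsilon> between the Haar measure and the design. The Haar measure
  is handed out together with the bound because the design predicate asserts only its
  existence.\<close>

lemma design_overlap_bound:
  assumes des: "approx_unitary_design N G k \<epsilon> \<nu>" and G: "G \<subseteq> unitary_group N"
    and S: "finite S" "orthonormal_on (N ^ k) S w" and v: "(\<Sum>i<N ^ k. (cmod (v i))\<^sup>2) = 1"
  obtains \<mu> where "haar_measure N G \<mu>" "random_unitary N \<mu>" "random_unitary N \<nu>"
    "\<bar>(\<Sum>x\<in>S. \<integral>U. (cmod (overlap N k (w x) v U))\<^sup>2 \<partial>\<mu>) - (\<Sum>x\<in>S. \<integral>U. (cmod (overlap N k (w x) v U))\<^sup>2 \<partial>\<nu>)\<bar> \<le> \<epsilon>"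
proof -
  obtain \<mu> where \<mu>: "haar_measure N G \<mu>"
    and dn: "diamond_norm (N ^ k) (\<lambda>A. twirl N k \<mu> A - twirl N k \<nu> A) \<le> ereal \<epsilon>"
    using des by (auto simp: approx_unitary_design_def)
  have r\<mu>: "random_unitary N \<mu>" by (rule random_unitary_haar[OF \<mu> G])
  have r\<nu>: "random_unitary N \<nu>"
    using des by (intro random_unitary_design[OF _ _ _ G]) (auto simp: approx_unitary_design_def)
  define D where "D = N ^ k"
  define R where "R = rank_one D v"
  define X where "X = twirl N k \<mu> R - twirl N k \<nu> R"
  have T: "twirl N k M R \<in> carrier_mat D D" for M by (simp add: twirl_def D_def)
  have X: "X \<in> carrier_mat D D" unfolding X_def by (rule minus_carrier_mat[OF T])
  have R: "R \<in> carrier_mat D D" by (simp add: R_def)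
  have Te: "twirl N k M R $$ (i, j) = cnj (twirl N k M R $$ (j, i))"
    if "random_unitary N M" "i < D" "j < D" for M i j
    using that unfolding D_def R_def by (simp add: twirl_rank_one mult.commute flip: Bochner_Integration.integral_cnj)
  have Xi: "X $$ (i, j) = twirl N k \<mu> R $$ (i, j) - twirl N k \<nu> R $$ (i, j)" if "i < D" "j < D" for i j
    unfolding X_def using T[of \<mu>] T[of \<nu>] that by (intro index_minus_mat) auto
  have Xh: "mat_adjoint X = X"
  proof (rule eq_matI)
    fix i j assume "i < dim_row X" "j < dim_col X"
    hence ij: "i < D" "j < D" using X by auto
    have "mat_adjoint X $$ (i, j) = cnj (X $$ (j, i))"
      by (rule mat_adjoint_index) (use X ij in auto)
    also have "\<dots> = X $$ (i, j)"
      unfolding Xi[OF ij] Xi[OF ij(2,1)] Te[OF r\<mu> ij] Te[OF r\<nu> ij] by simp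
    finally show "mat_adjoint X $$ (i, j) = X $$ (i, j)" .
  qed (use X in auto)
  have Req: "Matrix.mat D D (($$) Y) = Y" if "Y \<in> carrier_mat D D" for Y
    using that by (intro eq_matI) auto
  \<comment> \<open>A one-dimensional ancilla is chosen. Then the single block of \<open>R\<close>
    is \<open>R\<close> itself and \<open>tensor_id\<close> is the map without ancilla.\<close>
  have "tensor_id D 1 (\<lambda>A. twirl N k \<mu> A - twirl N k \<nu> A) R = X"
    by (rule eq_matI) (use X in \<open>auto simp: tensor_id_def Req[OF R] Req[OF X] simp flip: X_def\<close>)
  moreover have "ereal (trace_norm (tensor_id D 1 (\<lambda>A. twirl N k \<mu> A - twirl N k \<nu> A) R))
      \<le> diamond_norm D (\<lambda>A. twirl N k \<mu> A - twirl N k \<nu> A)"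
    unfolding diamond_norm_def
    by (rule SUP_upper2[of 1], simp, rule SUP_upper2[of R])
      (use R v trace_norm_rank_one[of v D] in \<open>auto simp: R_def D_def\<close>)
  ultimately have "ereal (trace_norm X) \<le> diamond_norm D (\<lambda>A. twirl N k \<mu> A - twirl N k \<nu> A)"
    by (simp only:)
  also have "\<dots> \<le> ereal \<epsilon>" using dn by (simp only: D_def)
  finally have tn: "trace_norm X \<le> \<epsilon>" by simp
  have qd: "qform D u X = qform D u (twirl N k \<mu> R) - qform D u (twirl N k \<nu> R)" for u
  proof -
    have "qform D u X = (\<Sum>i<D. \<Sum>j<D. cnj (u i) * twirl N k \<mu> R $$ (i, j) * u j - cnj (u i) * twirl N k \<nu> R $$ (i, j) * u j)"
      unfolding qform_def by (intro sum.cong refl) (simp add: Xi algebra_simps)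
    thus ?thesis by (simp add: qform_def sum_subtractf)
  qed
  have "(\<Sum>x\<in>S. qform D (w x) X) = of_real ((\<Sum>x\<in>S. \<integral>U. (cmod (overlap N k (w x) v U))\<^sup>2 \<partial>\<mu>) -
      (\<Sum>x\<in>S. \<integral>U. (cmod (overlap N k (w x) v U))\<^sup>2 \<partial>\<nu>))"
    unfolding qd unfolding R_def D_def qform_twirl_rank_one[OF r\<mu>] qform_twirl_rank_one[OF r\<nu>]
    by (simp only: sum_subtractf of_real_sum of_real_diff)
  hence "\<bar>(\<Sum>x\<in>S. \<integral>U. (cmod (overlap N k (w x) v U))\<^sup>2 \<partial>\<mu>) - (\<Sum>x\<in>S. \<integral>U. (cmod (overlap N k (w x) v U))\<^sup>2 \<partial>\<nu>)\<bar> =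
      cmod (\<Sum>x\<in>S. qform D (w x) X)"
    by (simp only: norm_of_real)
  also have "\<dots> \<le> trace_norm X"
    by (rule sum_qform_le_trace_norm[OF X Xh]) (use S in \<open>auto simp: D_def\<close>)
  also have "\<dots> \<le> \<epsilon>" by (rule tn)
  finally show ?thesis using that \<mu> r\<mu> r\<nu> by blast
qed

section \<open>Pauli operators\<close>

lemma xor_less_power2:
  fixes a b :: nat
  assumes "a < 2 ^ n" "b < 2 ^ n"
  shows "a XOR b < 2 ^ n"
proof -
  have "take_bit n (a XOR b) = a XOR b"
    using assms by (simp add: take_bit_xor take_bit_nat_eq_self)
  thus ?thesis by (simp only: take_bit_nat_eq_self_iff)
qed

lemma bit_less_power2: "(a :: nat) < 2 ^ n \<Longrightarrow> bit a p \<Longrightarrow> p < n"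
  by (metis bit_take_bit_iff take_bit_nat_eq_self_iff)

lemma eq_if_bits_eq:
  fixes a b :: nat
  assumes "a < 2 ^ n" "b < 2 ^ n" "\<And>p. p < n \<Longrightarrow> bit a p = bit b p"
  shows "a = b"
  by (rule bit_eqI) (use assms bit_less_power2 in blast)

lemma xor_cancel [simp]:
  "(a XOR b) XOR b = (a :: nat)" "a XOR (a XOR b) = b" "b XOR (a XOR b) = a" "(b XOR a) XOR b = a"
  by (auto intro!: bit_eqI simp: bit_xor_iff)

lemma eq_xor_iff: "(i :: nat) = j XOR a \<longleftrightarrow> a = i XOR j" "i = a XOR j \<longleftrightarrow> a = i XOR j"
  by (metis xor.commute xor_cancel(2))+

lemma xor_eq_0_iff [simp]: "a XOR b = 0 \<longleftrightarrow> a = (b :: nat)"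
  by (metis xor.right_neutral xor_cancel(2) xor_self_eq)

lemma sum_xor:
  fixes a :: nat
  assumes "a < 2 ^ n"
  shows "(\<Sum>j<2 ^ n. f (j XOR a)) = (\<Sum>j<2 ^ n. f j)"
  by (rule sum.reindex_bij_witness[of _ "\<lambda>j. j XOR a" "\<lambda>j. j XOR a"])
    (use assms xor_less_power2 in auto)

text \<open>The sign (-1)^(a.b), where a.b counts the common bits below \<open>n\<close>: these are
  the characters of the group of bit masks.\<close>

definition chi :: "nat \<Rightarrow> nat \<Rightarrow> nat \<Rightarrow> complex" where
  "chi n a b = (\<Prod>p<n. if bit a p \<and> bit b p then - 1 else 1)"

lemma chi_commute: "chi n a b = chi n b a"
  by (simp add: chi_def conj_commute)

lemma chi_0 [simp]: "chi n 0 b = 1" "chi n a 0 = 1"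
  by (simp_all add: chi_def)

lemma chi_xor_left: "chi n (a XOR c) b = chi n a b * chi n c b"
  unfolding chi_def prod.distrib[symmetric] by (rule prod.cong) (auto simp: bit_xor_iff)

lemma chi_xor_right: "chi n a (b XOR c) = chi n a b * chi n a c"
  by (simp add: chi_commute[of n a] chi_xor_left)

lemma chi_cases: "chi n a b = 1 \<or> chi n a b = - 1"
proof -
  have "chi n a b * chi n a b = 1"
    unfolding chi_def prod.distrib[symmetric] by (rule prod.neutral) auto
  thus ?thesis by (simp add: square_eq_1_iff)
qed

lemma chi_square [simp]: "chi n a b * chi n a b = 1" "chi n a b * (chi n a b * x) = x"
  using chi_cases[of n a b] by auto

lemma cnj_chi [simp]: "cnj (chi n a b) = chi n a b"
  using chi_cases[of n a b] by auto

lemma cmod_chi [simp]: "cmod (chi n a b) = 1"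
  using chi_cases[of n a b] by auto

lemma chi_power2:
  assumes "p < n"
  shows "chi n a (2 ^ p) = (if bit a p then - 1 else 1)"
proof -
  have "chi n a (2 ^ p) = (\<Prod>q<n. if q = p then (if bit a p then - 1 else 1) else 1)"
    unfolding chi_def by (rule prod.cong) (auto simp: bit_exp_iff)
  thus ?thesis using assms by simp
qed

text \<open>For nonzero \<open>a\<close>, flipping in \<open>b\<close> a bit that is set in
  \<open>a\<close> negates every summand.\<close>

lemma sum_chi:
  assumes "a < 2 ^ n"
  shows "(\<Sum>b<2 ^ n. chi n a b) = 2 ^ n * of_bool (a = 0)"
proof (cases "a = 0")
  case False
  then obtain p where p: "p < n" "bit a p"
    using eq_if_bits_eq[OF assms, of 0] by auto
  have "(\<Sum>b<2 ^ n. chi n a b) = (\<Sum>b<2 ^ n. chi n a (b XOR 2 ^ p))"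
    by (rule sum_xor[symmetric]) (use p in simp)
  also have "\<dots> = - (\<Sum>b<2 ^ n. chi n a b)"
    using p by (simp add: chi_xor_right chi_power2 sum_negf)
  finally show ?thesis using False by simp
qed simp

lemma sum_chi_chi:
  assumes "j < 2 ^ n" "k < 2 ^ n"
  shows "(\<Sum>b<2 ^ n. chi n b j * chi n b k) = 2 ^ n * of_bool (j = k)"
proof -
  have "(\<Sum>b<2 ^ n. chi n b j * chi n b k) = (\<Sum>b<2 ^ n. chi n (j XOR k) b)"
    by (intro sum.cong refl) (metis chi_commute chi_xor_left)
  also have "\<dots> = 2 ^ n * of_bool (j XOR k = 0)"
    by (rule sum_chi) (use assms xor_less_power2 in auto)
  finally show ?thesis by simp
qed

text \<open>The Pauli operators up to phases: \<open>X\<^sup>a Z\<^sup>b\<close> for bit masks \<open>a\<close> and \<open>b\<close>.\<close>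

definition pauli :: "nat \<Rightarrow> nat \<Rightarrow> nat \<Rightarrow> complex mat" where
  "pauli n a b = Matrix.mat (2 ^ n) (2 ^ n) (\<lambda>(i, j). if i = j XOR a then chi n b j else 0)"

lemma pauli_carrier [simp]: "pauli n a b \<in> carrier_mat (2 ^ n) (2 ^ n)"
  by (simp add: pauli_def)

lemma pauli_dim [simp]: "dim_row (pauli n a b) = 2 ^ n" "dim_col (pauli n a b) = 2 ^ n"
  by (simp_all add: pauli_def)

lemma pauli_index [simp]:
  "i < 2 ^ n \<Longrightarrow> j < 2 ^ n \<Longrightarrow> pauli n a b $$ (i, j) = (if i = j XOR a then chi n b j else 0)"
  by (simp add: pauli_def)

lemma pauli_mult_left_index:
  assumes "A \<in> carrier_mat (2 ^ n) m" "i < 2 ^ n" "j < m" "a < 2 ^ n"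
  shows "(pauli n a b * A) $$ (i, j) = chi n b (i XOR a) * A $$ (i XOR a, j)"
proof -
  have "(pauli n a b * A) $$ (i, j) = (\<Sum>k<2 ^ n. pauli n a b $$ (i, k) * A $$ (k, j))"
    using assms by (intro mat_mult_index) auto
  also have "\<dots> = (\<Sum>k<2 ^ n. if k = i XOR a then chi n b k * A $$ (k, j) else 0)"
    by (intro sum.cong refl) (use assms in \<open>auto simp: eq_xor_iff xor.commute\<close>)
  finally show ?thesis using assms xor_less_power2[of i n a] by simp
qed

lemma pauli_mult_right_index:
  assumes "A \<in> carrier_mat m (2 ^ n)" "i < m" "j < 2 ^ n" "a < 2 ^ n"
  shows "(A * pauli n a b) $$ (i, j) = A $$ (i, j XOR a) * chi n b j"
proof -
  have "(A * pauli n a b) $$ (i, j) = (\<Sum>k<2 ^ n. A $$ (i, k) * pauli n a b $$ (k, j))"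
    using assms by (intro mat_mult_index) auto
  also have "\<dots> = (\<Sum>k<2 ^ n. if k = j XOR a then A $$ (i, k) * chi n b j else 0)"
    by (intro sum.cong refl) (use assms in auto)
  finally show ?thesis using assms xor_less_power2[of j n a] by simp
qed

lemma pauli_mult:
  assumes "a < 2 ^ n" "c < 2 ^ n"
  shows "pauli n a b * pauli n c d = chi n b c \<cdot>\<^sub>m pauli n (a XOR c) (b XOR d)"
proof (rule eq_matI)
  fix i j
  assume "i < dim_row (chi n b c \<cdot>\<^sub>m pauli n (a XOR c) (b XOR d))"
    "j < dim_col (chi n b c \<cdot>\<^sub>m pauli n (a XOR c) (b XOR d))"
  hence ij: "i < 2 ^ n" "j < 2 ^ n" by simp_all
  have "i = (j XOR c) XOR a \<longleftrightarrow> i = j XOR (a XOR c)" by (simp add: ac_simps)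
  thus "(pauli n a b * pauli n c d) $$ (i, j) = (chi n b c \<cdot>\<^sub>m pauli n (a XOR c) (b XOR d)) $$ (i, j)"
    using ij assms xor_less_power2[of j n c]
    by (simp add: pauli_mult_right_index[OF pauli_carrier] chi_xor_left chi_xor_right del: index_mult_mat(1))
qed simp_all

lemma pauli_square: "a < 2 ^ n \<Longrightarrow> pauli n a b * pauli n a b = chi n a b \<cdot>\<^sub>m 1\<^sub>m (2 ^ n)"
  unfolding pauli_mult by (rule eq_matI) (auto simp: chi_commute)

lemma transpose_pauli:
  assumes "a < 2 ^ n"
  shows "transpose_mat (pauli n a b) = chi n a b \<cdot>\<^sub>m pauli n a b"
proof (rule eq_matI)
  fix i j assume "i < dim_row (chi n a b \<cdot>\<^sub>m pauli n a b)" "j < dim_col (chi n a b \<cdot>\<^sub>m pauli n a b)"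
  hence ij: "i < 2 ^ n" "j < 2 ^ n" by simp_all
  have "j = i XOR a \<longleftrightarrow> i = j XOR a" by (metis xor_cancel(1))
  thus "transpose_mat (pauli n a b) $$ (i, j) = (chi n a b \<cdot>\<^sub>m pauli n a b) $$ (i, j)"
    using ij by (auto simp: chi_xor_right chi_commute)
qed simp_all

lemma mat_adjoint_pauli:
  assumes "a < 2 ^ n"
  shows "mat_adjoint (pauli n a b) = chi n a b \<cdot>\<^sub>m pauli n a b"
proof -
  have "mat_adjoint (pauli n a b) = transpose_mat (pauli n a b)"
    by (rule eq_matI) auto
  thus ?thesis using transpose_pauli[OF assms] by simp
qed

text \<open>The normalised Hilbert-Schmidt product tr(P^dagger A) / 2^n with P =
  \<open>pauli n a b\<close>.\<close>

definition pauli_coeff :: "nat \<Rightarrow> nat \<Rightarrow> nat \<Rightarrow> complex mat \<Rightarrow> complex" where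
  "pauli_coeff n a b A = (\<Sum>j<2 ^ n. chi n b j * A $$ (j XOR a, j)) / 2 ^ n"

text \<open>The mask \<open>a\<close> selects the entries with \<open>i XOR j = a\<close>; on them
  the sum over \<open>b\<close> is Walsh inversion.\<close>

lemma pauli_expansion:
  assumes A: "A \<in> carrier_mat (2 ^ n) (2 ^ n)" and ij: "i < 2 ^ n" "j < 2 ^ n"
  shows "A $$ (i, j) = (\<Sum>a<2 ^ n. \<Sum>b<2 ^ n. pauli_coeff n a b A * pauli n a b $$ (i, j))"
proof -
  have "(\<Sum>b<2 ^ n. pauli_coeff n a b A * pauli n a b $$ (i, j)) = (if a = i XOR j then A $$ (i, j) else 0)"
    if "a < 2 ^ n" for a
  proof (cases "a = i XOR j")
    case True
    have "(\<Sum>b<2 ^ n. pauli_coeff n a b A * pauli n a b $$ (i, j)) =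
        (\<Sum>b<2 ^ n. \<Sum>k<2 ^ n. (A $$ (k XOR a, k) / 2 ^ n) * (chi n b k * chi n b j))"
      using True ij by (simp add: pauli_coeff_def sum_distrib_right sum_distrib_left sum_divide_distrib algebra_simps)
    also have "\<dots> = (\<Sum>k<2 ^ n. (A $$ (k XOR a, k) / 2 ^ n) * (\<Sum>b<2 ^ n. chi n b k * chi n b j))"
      unfolding sum_distrib_left by (rule sum.swap)
    also have "\<dots> = (\<Sum>k<2 ^ n. (if k = j then A $$ (k XOR a, k) else 0))"
      by (intro sum.cong refl) (use ij in \<open>simp add: sum_chi_chi\<close>)
    also have "\<dots> = A $$ (i, j)" using ij True by simp
    finally show ?thesis using True by simp
  qed (use ij in \<open>simp add: eq_xor_iff\<close>)
  thus ?thesis using ij xor_less_power2[of i n j] by simp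
qed

text \<open>Parseval for the Walsh transform in \<open>b\<close>, applied separately to each shifted
  diagonal \<open>a\<close>. For a unitary matrix the squared coefficients thus form a probability
  distribution on Pauli strings.\<close>

lemma pauli_parseval:
  assumes A: "A \<in> carrier_mat (2 ^ n) (2 ^ n)"
  shows "(\<Sum>a<2 ^ n. \<Sum>b<2 ^ n. (cmod (pauli_coeff n a b A))\<^sup>2) =
    (\<Sum>j<2 ^ n. \<Sum>i<2 ^ n. (cmod (A $$ (i, j)))\<^sup>2) / 2 ^ n"
proof -
  have 1: "(\<Sum>b<2 ^ n. (cmod (pauli_coeff n a b A))\<^sup>2) = (\<Sum>j<2 ^ n. (cmod (A $$ (j XOR a, j)))\<^sup>2) / 2 ^ n"
    for a
  proof -
    define x where "x j = A $$ (j XOR a, j)" for j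
    have "complex_of_real (\<Sum>b<2 ^ n. (cmod (pauli_coeff n a b A))\<^sup>2) =
        (\<Sum>b<2 ^ n. pauli_coeff n a b A * cnj (pauli_coeff n a b A))"
      by (simp only: of_real_sum complex_norm_square)
    also have "\<dots> = (\<Sum>b<2 ^ n. \<Sum>j<2 ^ n. \<Sum>k<2 ^ n. x j * cnj (x k) / (2 ^ n * 2 ^ n) * (chi n b j * chi n b k))"
      by (simp add: pauli_coeff_def x_def[symmetric] sum_product sum_divide_distrib algebra_simps)
    also have "\<dots> = (\<Sum>j<2 ^ n. \<Sum>k<2 ^ n. \<Sum>b<2 ^ n. x j * cnj (x k) / (2 ^ n * 2 ^ n) * (chi n b j * chi n b k))"
      by (subst sum.swap, subst (2) sum.swap) rule
    also have "\<dots> = (\<Sum>j<2 ^ n. \<Sum>k<2 ^ n. if k = j then x j * cnj (x j) / 2 ^ n else 0)"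
      unfolding sum_distrib_left[symmetric]
      by (intro sum.cong refl) (simp add: sum_chi_chi)
    also have "\<dots> = (\<Sum>j<2 ^ n. x j * cnj (x j)) / 2 ^ n"
      by (simp add: sum_divide_distrib)
    also have "\<dots> = complex_of_real ((\<Sum>j<2 ^ n. (cmod (x j))\<^sup>2) / 2 ^ n)"
      by (simp only: of_real_divide of_real_sum complex_norm_square) simp
    finally show ?thesis unfolding x_def by (simp only: of_real_eq_iff)
  qed
  have "(\<Sum>a<2 ^ n. \<Sum>b<2 ^ n. (cmod (pauli_coeff n a b A))\<^sup>2) =
      (\<Sum>a<2 ^ n. \<Sum>j<2 ^ n. (cmod (A $$ (j XOR a, j)))\<^sup>2) / 2 ^ n"
    by (simp add: 1 sum_divide_distrib)
  also have "(\<Sum>a<2 ^ n. \<Sum>j<2 ^ n. (cmod (A $$ (j XOR a, j)))\<^sup>2) =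
      (\<Sum>j<2 ^ n. \<Sum>a<2 ^ n. (cmod (A $$ (a XOR j, j)))\<^sup>2)"
    by (subst sum.swap) (simp add: xor.commute)
  also have "\<dots> = (\<Sum>j<2 ^ n. \<Sum>i<2 ^ n. (cmod (A $$ (i, j)))\<^sup>2)"
    by (intro sum.cong refl sum_xor) simp
  finally show ?thesis .
qed

lemma pauli_parseval_unitary:
  assumes U: "U \<in> unitary_group (2 ^ n)"
  shows "(\<Sum>a<2 ^ n. \<Sum>b<2 ^ n. (cmod (pauli_coeff n a b U))\<^sup>2) = 1"
proof -
  have "(\<Sum>i<2 ^ n. (cmod (U $$ (i, j)))\<^sup>2) = 1" if "j < 2 ^ n" for j
  proof -
    have "complex_of_real (\<Sum>i<2 ^ n. (cmod (U $$ (i, j)))\<^sup>2) = (\<Sum>i<2 ^ n. cnj (U $$ (i, j)) * U $$ (i, j))"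
      by (simp only: of_real_sum complex_norm_square mult.commute)
    also have "\<dots> = 1" using unitary_columns[OF U that that] by simp
    finally show ?thesis by (simp only: of_real_eq_1_iff)
  qed
  thus ?thesis using unitary_groupD(1)[OF U] by (simp add: pauli_parseval)
qed

text \<open>Multiplication by a Pauli operator permutes the coefficients up to signs. The signs for
  left and right multiplication differ by \<open>chi n d a * chi n b c\<close>, which is -1 exactly
  when the strings (a, b) and (c, d) anticommute.\<close>

lemma pauli_coeff_pauli_mult:
  assumes "A \<in> carrier_mat (2 ^ n) (2 ^ n)" "a < 2 ^ n" "c < 2 ^ n"
  shows "pauli_coeff n a b (pauli n c d * A) =
    chi n d a * chi n d c * pauli_coeff n (a XOR c) (b XOR d) A"
proof -
  have "chi n b j * (pauli n c d * A) $$ (j XOR a, j) =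
      chi n d a * chi n d c * (chi n (b XOR d) j * A $$ (j XOR (a XOR c), j))" if "j < 2 ^ n" for j
    using assms that xor_less_power2[of j n a]
    by (simp add: pauli_mult_left_index[OF assms(1)] chi_xor_left chi_xor_right xor.assoc del: index_mult_mat(1))
  thus ?thesis by (simp add: pauli_coeff_def sum_distrib_left del: index_mult_mat)
qed

lemma pauli_coeff_mult_pauli:
  assumes "A \<in> carrier_mat (2 ^ n) (2 ^ n)" "a < 2 ^ n" "c < 2 ^ n"
  shows "pauli_coeff n a b (A * pauli n c d) =
    chi n b c * chi n d c * pauli_coeff n (a XOR c) (b XOR d) A"
proof -
  have "(\<Sum>j<2 ^ n. chi n b j * (A * pauli n c d) $$ (j XOR a, j)) =
      (\<Sum>j<2 ^ n. chi n b ((j XOR c) XOR c) * A $$ ((j XOR c) XOR (a XOR c), j XOR c) * chi n d ((j XOR c) XOR c))"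
    by (intro sum.cong refl)
      (use assms xor_less_power2 in \<open>simp add: pauli_mult_right_index[OF assms(1)] ac_simps del: index_mult_mat\<close>)
  also have "\<dots> = (\<Sum>j<2 ^ n. chi n b (j XOR c) * A $$ (j XOR (a XOR c), j) * chi n d (j XOR c))"
    by (rule sum_xor[OF assms(3)])
  also have "\<dots> = chi n b c * chi n d c * (\<Sum>j<2 ^ n. chi n (b XOR d) j * A $$ (j XOR (a XOR c), j))"
    by (simp add: sum_distrib_left chi_xor_left chi_xor_right algebra_simps)
  finally show ?thesis by (simp add: pauli_coeff_def)
qed

lemma pauli_coeff_add:
  assumes "A \<in> carrier_mat (2 ^ n) (2 ^ n)" "B \<in> carrier_mat (2 ^ n) (2 ^ n)" "a < 2 ^ n"
  shows "pauli_coeff n a b (A + B) = pauli_coeff n a b A + pauli_coeff n a b B"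
proof -
  have "chi n b j * (A + B) $$ (j XOR a, j) = chi n b j * A $$ (j XOR a, j) + chi n b j * B $$ (j XOR a, j)"
    if "j < 2 ^ n" for j
    using assms that xor_less_power2[of j n a] by (simp add: algebra_simps)
  thus ?thesis by (simp add: pauli_coeff_def sum.distrib add_divide_distrib)
qed

lemma pauli_coeff_smult:
  assumes "A \<in> carrier_mat (2 ^ n) (2 ^ n)" "a < 2 ^ n"
  shows "pauli_coeff n a b (c \<cdot>\<^sub>m A) = c * pauli_coeff n a b A"
proof -
  have "chi n b j * (c \<cdot>\<^sub>m A) $$ (j XOR a, j) = c * (chi n b j * A $$ (j XOR a, j))"
    if "j < 2 ^ n" for j
    using assms that xor_less_power2[of j n a] by (simp add: algebra_simps)
  hence "(\<Sum>j<2 ^ n. chi n b j * (c \<cdot>\<^sub>m A) $$ (j XOR a, j)) = (\<Sum>j<2 ^ n. c * (chi n b j * A $$ (j XOR a, j)))"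
    by (intro sum.cong refl) blast
  thus ?thesis by (simp only: pauli_coeff_def sum_distrib_left times_divide_eq_right)
qed

section \<open>The symplectic form as a Pauli operator\<close>

lemma bit_div_power2: "(i :: nat) < 2 ^ Suc n \<Longrightarrow> i div 2 ^ n = of_bool (bit i n)"
proof -
  assume "i < 2 ^ Suc n"
  hence "i div 2 ^ n < 2" by (intro less_mult_imp_div_less) simp
  hence "i div 2 ^ n = 0 \<or> i div 2 ^ n = 1" by auto
  thus ?thesis by (auto simp: bit_iff_odd)
qed

text \<open>Bit \<open>p\<close> of an index belongs to the p-th factor counted from the right. As
  all factors are equal, this order is harmless.\<close>

lemma kron_pow_2x2_index:
  assumes A: "A \<in> carrier_mat 2 2" and "i < 2 ^ n" "j < 2 ^ n"
  shows "kron_pow n A $$ (i, j) = (\<Prod>p<n. A $$ (of_bool (bit i p), of_bool (bit j p)))"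
  using assms(2,3)
proof (induction n arbitrary: i j)
  case (Suc n)
  have K: "dim_row (kron_pow n A) = 2 ^ n" "dim_col (kron_pow n A) = 2 ^ n" using A by auto
  have "kron_pow (Suc n) A $$ (i, j) =
      A $$ (i div 2 ^ n, j div 2 ^ n) * kron_pow n A $$ (i mod 2 ^ n, j mod 2 ^ n)"
    using Suc.prems A K by (simp add: kron_def)
  also have "kron_pow n A $$ (i mod 2 ^ n, j mod 2 ^ n) = (\<Prod>p<n. A $$ (of_bool (bit i p), of_bool (bit j p)))"
    by (subst Suc.IH) (simp_all flip: take_bit_eq_mod add: bit_take_bit_iff)
  finally show ?case unfolding bit_div_power2[OF Suc.prems(1)] bit_div_power2[OF Suc.prems(2)]
    by (simp add: mult.commute)
qed simp

text \<open>On one qubit i Y = - X Z, so the tensor power carries the sign (-1)^n, which is -1 for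
  odd \<open>n\<close>. The mask \<open>2 ^ n - 1\<close> has all \<open>n\<close> bits set.\<close>

lemma symplectic_form_eq_pauli:
  assumes "odd n"
  shows "symplectic_form n = - pauli n (2 ^ n - 1) (2 ^ n - 1)"
proof (rule eq_matI)
  have Y: "pauli_Y \<in> carrier_mat 2 2" by (rule carrier_matI) (simp_all add: pauli_Y_def mat_of_rows_list_def)
  have Yi: "pauli_Y $$ (of_bool x, of_bool y) = (if x = y then 0 else if y then - \<i> else \<i>)" for x y
    by (cases x; cases y) (simp_all add: pauli_Y_def mat_of_rows_list_def)
  fix i j
  assume "i < dim_row (- pauli n (2 ^ n - 1) (2 ^ n - 1))" "j < dim_col (- pauli n (2 ^ n - 1) (2 ^ n - 1))"
  hence ij: "i < 2 ^ n" "j < 2 ^ n" by simp_all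
  have m: "bit (2 ^ n - 1 :: nat) p \<longleftrightarrow> p < n" for p
    unfolding mask_eq_exp_minus_1[symmetric] by (simp add: bit_mask_iff)
  have m': "bit (2 ^ n - Suc 0 :: nat) p \<longleftrightarrow> p < n" for p
    using m by simp
  have eq: "i = j XOR (2 ^ n - 1) \<longleftrightarrow> (\<forall>p<n. bit i p \<noteq> bit j p)"
  proof
    assume "\<forall>p<n. bit i p \<noteq> bit j p"
    thus "i = j XOR (2 ^ n - 1)"
      using ij by (intro eq_if_bits_eq[of _ n] xor_less_power2) (auto simp: bit_xor_iff m')
  qed (auto simp: bit_xor_iff m')
  have S: "symplectic_form n $$ (i, j) = (\<Prod>p<n. if bit i p = bit j p then 0 else if bit j p then 1 else - 1)"
  proof -
    have "symplectic_form n $$ (i, j) = \<i> ^ n * (\<Prod>p<n. pauli_Y $$ (of_bool (bit i p), of_bool (bit j p)))"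
      using ij Y by (simp add: symplectic_form_def kron_pow_2x2_index)
    also have "\<i> ^ n = (\<Prod>p<n. \<i>)" by simp
    finally show ?thesis unfolding prod.distrib[symmetric] Yi
      by (simp only:) (rule prod.cong, auto)
  qed
  show "symplectic_form n $$ (i, j) = (- pauli n (2 ^ n - 1) (2 ^ n - 1)) $$ (i, j)"
  proof (cases "i = j XOR (2 ^ n - 1)")
    case True
    have "symplectic_form n $$ (i, j) = (\<Prod>p<n. (- 1) * (if bit (2 ^ n - 1 :: nat) p \<and> bit j p then - 1 else 1))"
      unfolding S by (rule prod.cong) (use True eq m' in auto)
    also have "\<dots> = - chi n (2 ^ n - 1) j"
      using assms by (simp only: prod.distrib chi_def) simp
    finally show ?thesis using ij True by simp
  next
    case False
    then obtain p where "p < n" "bit i p = bit j p" using eq by auto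
    hence "symplectic_form n $$ (i, j) = 0" unfolding S by auto
    thus ?thesis using False ij by simp
  qed
qed (simp_all add: symplectic_form_def pauli_Y_def mat_of_rows_list_def numeral_2_eq_2)

section \<open>Operators in the lightcone of a circuit\<close>

text \<open>Locality is encoded as commutation with every Pauli string that is trivial on
  \<open>S\<close>, instead of as a factorisation with an identity outside \<open>S\<close>. This
  needs no reordering of tensor factors and makes closure under products and adjoints
  direct.\<close>

definition local_on :: "nat \<Rightarrow> nat set \<Rightarrow> complex mat \<Rightarrow> bool" where
  "local_on n S A \<longleftrightarrow> A \<in> carrier_mat (2 ^ n) (2 ^ n) \<and>
    (\<forall>a<2 ^ n. \<forall>b<2 ^ n. (\<forall>p\<in>S. \<not> bit a p \<and> \<not> bit b p) \<longrightarrow> pauli n a b * A = A * pauli n a b)"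

lemma local_on_carrier: "local_on n S A \<Longrightarrow> A \<in> carrier_mat (2 ^ n) (2 ^ n)"
  by (simp add: local_on_def)

lemma local_onD:
  "\<lbrakk>local_on n S A; a < 2 ^ n; b < 2 ^ n; \<And>p. p \<in> S \<Longrightarrow> \<not> bit a p \<and> \<not> bit b p\<rbrakk> \<Longrightarrow>
    pauli n a b * A = A * pauli n a b"
  unfolding local_on_def by blast

lemma local_on_mono: "local_on n S A \<Longrightarrow> S \<subseteq> T \<Longrightarrow> local_on n T A"
  by (simp add: local_on_def subset_iff)

lemma local_on_mult:
  assumes "local_on n S A" "local_on n S B"
  shows "local_on n S (A * B)"
  unfolding local_on_def
proof (intro conjI allI impI)
  note A = local_on_carrier[OF assms(1)] and B = local_on_carrier[OF assms(2)]
  show "A * B \<in> carrier_mat (2 ^ n) (2 ^ n)" by (rule mult_carrier_mat[OF A B])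
  fix a b :: nat
  assume ab: "a < 2 ^ n" "b < 2 ^ n" "\<forall>p\<in>S. \<not> bit a p \<and> \<not> bit b p"
  let ?P = "pauli n a b"
  have PA: "?P * A = A * ?P" and PB: "?P * B = B * ?P"
    using assms ab by (simp_all add: local_on_def)
  have "?P * (A * B) = ?P * A * B" by (rule assoc_mult_mat[symmetric, OF pauli_carrier A B])
  also have "\<dots> = A * (?P * B)" unfolding PA by (rule assoc_mult_mat[OF A pauli_carrier B])
  also have "\<dots> = A * B * ?P" unfolding PB by (rule assoc_mult_mat[symmetric, OF A B pauli_carrier])
  finally show "?P * (A * B) = A * B * ?P" .
qed

text \<open>Adjoints are taken in the commutation relation. A Pauli operator equals its adjoint up
  to the sign \<open>chi n a b\<close>, which appears on both sides.\<close>

lemma local_on_adjoint: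
  assumes "local_on n S A"
  shows "local_on n S (mat_adjoint A)"
  unfolding local_on_def
proof (intro conjI allI impI)
  note A = local_on_carrier[OF assms(1)]
  show A': "mat_adjoint A \<in> carrier_mat (2 ^ n) (2 ^ n)" using A by simp
  fix a b :: nat
  assume ab: "a < 2 ^ n" "b < 2 ^ n" "\<forall>p\<in>S. \<not> bit a p \<and> \<not> bit b p"
  let ?P = "pauli n a b" and ?c = "chi n a b"
  have PA: "?P * A = A * ?P" using assms ab by (simp add: local_on_def)
  have "?c \<cdot>\<^sub>m (mat_adjoint A * ?P) = mat_adjoint A * mat_adjoint ?P"
    unfolding mat_adjoint_pauli[OF ab(1)] by (rule mult_smult_distrib[symmetric, OF A' pauli_carrier])
  also have "\<dots> = mat_adjoint (?P * A)" by (rule mat_adjoint_mult[symmetric, OF pauli_carrier A])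
  also have "\<dots> = mat_adjoint ?P * mat_adjoint A" unfolding PA by (rule mat_adjoint_mult[OF A pauli_carrier])
  also have "\<dots> = ?c \<cdot>\<^sub>m (?P * mat_adjoint A)"
    unfolding mat_adjoint_pauli[OF ab(1)] by (rule mult_smult_assoc_mat[OF pauli_carrier A'])
  finally have eq: "?c \<cdot>\<^sub>m (?c \<cdot>\<^sub>m (mat_adjoint A * ?P)) = ?c \<cdot>\<^sub>m (?c \<cdot>\<^sub>m (?P * mat_adjoint A))" by simp
  have "?c \<cdot>\<^sub>m (?c \<cdot>\<^sub>m X) = X" for X :: "complex mat"
    by (rule eq_matI) auto
  thus "?P * mat_adjoint A = mat_adjoint A * ?P" using eq by simp
qed

section \<open>Gates as local unitary operators on all qubits\<close>

lemma sub_index_less: "sub_index qs i < 2 ^ length qs"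
  using horner_sum_of_bool_2_less[of "map (bit i) qs"] by (simp add: sub_index_def)

lemma bit_sub_index: "bit (sub_index qs i) l \<longleftrightarrow> l < length qs \<and> bit i (qs ! l)"
  unfolding sub_index_def by (auto simp: bit_horner_sum_bit_iff)

definition agree_off :: "nat \<Rightarrow> nat set \<Rightarrow> nat \<Rightarrow> nat \<Rightarrow> bool" where
  "agree_off n S i j \<longleftrightarrow> (\<forall>q<n. q \<notin> S \<longrightarrow> bit i q = bit j q)"

lemma gate_unitary_index:
  "i < 2 ^ n \<Longrightarrow> j < 2 ^ n \<Longrightarrow> gate_unitary n G $$ (i, j) =
    (if agree_off n (supp G) i j then snd G $$ (sub_index (fst G) i, sub_index (fst G) j) else 0)"
  by (simp add: gate_unitary_def agree_off_def)

text \<open>A mask that avoids the support leaves \<open>sub_index\<close> unchanged, so shifting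
  the row or the column by \<open>a\<close> addresses the same entry of the gate. The phases agree
  because the two indices compared have the same bits off the support, and \<open>b\<close> is
  trivial on it.\<close>

lemma local_on_gate_unitary: "local_on n (supp G) (gate_unitary n G)"
  unfolding local_on_def
proof (intro conjI allI impI)
  show Gc: "gate_unitary n G \<in> carrier_mat (2 ^ n) (2 ^ n)" by (simp add: gate_unitary_def)
  fix a b :: nat
  assume ab: "a < 2 ^ n" "b < 2 ^ n" "\<forall>p\<in>supp G. \<not> bit a p \<and> \<not> bit b p"
  have sub: "sub_index (fst G) (i XOR a) = sub_index (fst G) i" for i
    unfolding sub_index_def using ab(3)
    by (intro arg_cong[of _ _ "horner_sum of_bool 2"] map_cong refl) (auto simp: bit_xor_iff supp_def)
  show "pauli n a b * gate_unitary n G = gate_unitary n G * pauli n a b"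
  proof (rule eq_matI)
    fix i j
    assume "i < dim_row (gate_unitary n G * pauli n a b)" "j < dim_col (gate_unitary n G * pauli n a b)"
    hence ij: "i < 2 ^ n" "j < 2 ^ n" using Gc by auto
    have L: "(pauli n a b * gate_unitary n G) $$ (i, j) = chi n b (i XOR a) * gate_unitary n G $$ (i XOR a, j)"
      by (rule pauli_mult_left_index[OF Gc ij ab(1)])
    have R: "(gate_unitary n G * pauli n a b) $$ (i, j) = gate_unitary n G $$ (i, j XOR a) * chi n b j"
      by (rule pauli_mult_right_index[OF Gc ij ab(1)])
    have xs: "i XOR a < 2 ^ n" "j XOR a < 2 ^ n" using ij ab xor_less_power2 by auto
    have c: "agree_off n (supp G) (i XOR a) j \<longleftrightarrow> agree_off n (supp G) i (j XOR a)"
      by (auto simp: bit_xor_iff agree_off_def)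
    show "(pauli n a b * gate_unitary n G) $$ (i, j) = (gate_unitary n G * pauli n a b) $$ (i, j)"
    proof (cases "agree_off n (supp G) (i XOR a) j")
      case True
      have "chi n b (i XOR a) = chi n b j"
        unfolding chi_def by (rule prod.cong) (use True ab(3) in \<open>auto simp: agree_off_def\<close>)
      thus ?thesis unfolding L R using True c ij xs by (simp add: gate_unitary_index sub)
    next
      case False
      thus ?thesis unfolding L R using c ij xs by (simp add: gate_unitary_index)
    qed
  qed (use Gc in auto)
qed

text \<open>Once the bits off \<open>qs\<close> are prescribed by \<open>j\<close>, the bits on
  \<open>qs\<close> are free. This turns a column sum of the full matrix into a column sum of the
  gate.\<close>

lemma sub_index_bij_betw:
  assumes qs: "distinct qs" "set qs \<subseteq> {..<n}" and j: "j < 2 ^ n"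
  shows "bij_betw (sub_index qs) {k. k < 2 ^ n \<and> agree_off n (set qs) k j} {..<2 ^ length qs}"
  unfolding bij_betw_def
proof
  let ?A = "{k. k < 2 ^ n \<and> agree_off n (set qs) k j}"
  show "inj_on (sub_index qs) ?A"
  proof (rule inj_onI)
    fix k k' assume k: "k \<in> ?A" and k': "k' \<in> ?A" and eq: "sub_index qs k = sub_index qs k'"
    have "bit k q = bit k' q" if "q < n" for q
    proof (cases "q \<in> set qs")
      case True
      then obtain l where "l < length qs" "q = qs ! l" by (metis in_set_conv_nth)
      thus ?thesis using arg_cong[OF eq, of "\<lambda>x. bit x l"] by (simp add: bit_sub_index)
    qed (use k k' that in \<open>auto simp: agree_off_def\<close>)
    thus "k = k'" using k k' by (intro eq_if_bits_eq[of k n k']) auto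
  qed
  show "sub_index qs ` ?A = {..<2 ^ length qs}"
  proof (intro equalityI subsetI)
    fix m :: nat assume "m \<in> {..<2 ^ length qs}"
    hence m: "m < 2 ^ length qs" by simp
    \<comment> \<open>The preimage of \<open>m\<close> takes its bits on \<open>qs\<close> from
      \<open>m\<close> and all others from \<open>j\<close>.\<close>
    define f where "f q = (if q \<in> set qs then \<exists>l<length qs. qs ! l = q \<and> bit m l else bit j q)" for q
    define k :: nat where "k = horner_sum of_bool 2 (map f [0..<n])"
    have bk: "bit k q \<longleftrightarrow> q < n \<and> f q" for q
      by (auto simp: k_def bit_horner_sum_bit_iff)
    have "k < 2 ^ n" using horner_sum_of_bool_2_less[of "map f [0..<n]"] by (simp add: k_def)
    hence kA: "k \<in> ?A" by (auto simp: bk f_def agree_off_def)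
    have "sub_index qs k = m"
    proof (rule eq_if_bits_eq[OF sub_index_less m])
      fix l assume l: "l < length qs"
      hence "qs ! l \<in> set qs" "qs ! l < n" using qs(2) nth_mem by auto
      thus "bit (sub_index qs k) l = bit m l"
        using l qs(1) by (auto simp: bit_sub_index bk f_def nth_eq_iff_index_eq)
    qed
    thus "m \<in> sub_index qs ` ?A" using kA by blast
  qed (use sub_index_less in auto)
qed

text \<open>Two columns whose labels differ off the support have no common nonzero row; for all
  other pairs orthonormality is inherited from the gate.\<close>

lemma gate_unitary_unitary:
  assumes G: "valid_gate n E r G"
  shows "gate_unitary n G \<in> unitary_group (2 ^ n)"
proof (rule unitary_groupI)
  obtain qs g where Gq: "G = (qs, g)" by (cases G)
  have qs: "distinct qs" "set qs \<subseteq> {..<n}" and g: "g \<in> unitary_group (2 ^ length qs)"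
    using G by (auto simp: valid_gate_def Gq supp_def)
  show "gate_unitary n G \<in> carrier_mat (2 ^ n) (2 ^ n)" by (simp add: gate_unitary_def)
  fix i j :: nat assume ij: "i < 2 ^ n" "j < 2 ^ n"
  have ge: "gate_unitary n G $$ (k, l) =
      (if agree_off n (set qs) k l then g $$ (sub_index qs k, sub_index qs l) else 0)"
    if "k < 2 ^ n" "l < 2 ^ n" for k l
    using gate_unitary_index[OF that, of G] by (simp add: Gq supp_def)
  have trans: "agree_off n (set qs) k i \<longleftrightarrow> agree_off n (set qs) k j" if "agree_off n (set qs) i j" for k
    using that by (auto simp: agree_off_def)
  show "(\<Sum>k<2 ^ n. cnj (gate_unitary n G $$ (k, i)) * gate_unitary n G $$ (k, j)) = of_bool (i = j)"
  proof (cases "agree_off n (set qs) i j")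
    case True
    let ?A = "{k. k < 2 ^ n \<and> agree_off n (set qs) k j}"
    have "(\<Sum>k<2 ^ n. cnj (gate_unitary n G $$ (k, i)) * gate_unitary n G $$ (k, j)) =
        (\<Sum>k\<in>?A. cnj (g $$ (sub_index qs k, sub_index qs i)) * g $$ (sub_index qs k, sub_index qs j))"
      by (rule sum.mono_neutral_cong_right) (use ij trans[OF True] in \<open>auto simp: ge\<close>)
    also have "\<dots> = (\<Sum>m<2 ^ length qs. cnj (g $$ (m, sub_index qs i)) * g $$ (m, sub_index qs j))"
      by (rule sum.reindex_bij_betw[OF sub_index_bij_betw[OF qs ij(2)]])
    also have "\<dots> = of_bool (sub_index qs i = sub_index qs j)"
      by (rule unitary_columns[OF g sub_index_less sub_index_less])
    also have "(sub_index qs i = sub_index qs j) = (i = j)"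
      using bij_betw_imp_inj_on[OF sub_index_bij_betw[OF qs ij(2)]] True ij
      by (auto dest: inj_onD simp: agree_off_def)
    finally show ?thesis .
  next
    case False
    have z: "cnj (gate_unitary n G $$ (k, i)) * gate_unitary n G $$ (k, j) = 0" if "k < 2 ^ n" for k
    proof -
      have "\<not> (agree_off n (set qs) k i \<and> agree_off n (set qs) k j)"
        using False by (auto simp: agree_off_def)
      thus ?thesis using ij that by (auto simp: ge)
    qed
    have "i \<noteq> j" using False by (auto simp: agree_off_def)
    moreover have "(\<Sum>k<2 ^ n. cnj (gate_unitary n G $$ (k, i)) * gate_unitary n G $$ (k, j)) = 0"
      by (intro sum.neutral ballI z) simp
    ultimately show ?thesis by simp
  qed
qed

text \<open>A one-qubit operator P at \<open>p\<close>, namely Z if the string contains X there and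
  X otherwise, commutes with \<open>A\<close> but anticommutes with the string. Comparing
  coefficients of P A and A P gives x = - x. They are read off at the label shifted by P, so that
  the multiplication brings it back to (a, b).\<close>

lemma pauli_coeff_eq_0_if_local:
  assumes A: "local_on n S A" and ab: "a < 2 ^ n" "b < 2 ^ n" and p: "p \<notin> S" "bit a p \<or> bit b p"
  shows "pauli_coeff n a b A = 0"
proof -
  note Ac = local_on_carrier[OF A]
  have pn: "p < n" using p(2) ab bit_less_power2 by blast
  have com: "pauli n c d * A = A * pauli n c d" if "c = 0 \<or> c = 2 ^ p" "d = 0 \<or> d = 2 ^ p" for c d
    by (rule local_onD[OF A]) (use that p(1) pn in \<open>auto simp: bit_exp_iff\<close>)
  have less: "a XOR 2 ^ p < 2 ^ n" "b XOR 2 ^ p < 2 ^ n" using ab pn by (auto intro!: xor_less_power2)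
  show ?thesis
  proof (cases "bit a p")
    case True
    have "pauli_coeff n a (b XOR 2 ^ p) (pauli n 0 (2 ^ p) * A) = - pauli_coeff n a b A"
      using pauli_coeff_pauli_mult[OF Ac ab(1), of 0 "b XOR 2 ^ p" "2 ^ p"] True pn
      by (simp add: chi_power2 chi_commute[of n "2 ^ p"])
    moreover have "pauli_coeff n a (b XOR 2 ^ p) (A * pauli n 0 (2 ^ p)) = pauli_coeff n a b A"
      using pauli_coeff_mult_pauli[OF Ac ab(1), of 0 "b XOR 2 ^ p" "2 ^ p"] by simp
    ultimately show ?thesis using com[of 0 "2 ^ p"] by simp
  next
    case False
    hence b: "bit b p" using p by simp
    have "pauli_coeff n (a XOR 2 ^ p) b (pauli n (2 ^ p) 0 * A) = pauli_coeff n a b A"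
      using pauli_coeff_pauli_mult[OF Ac less(1), of "2 ^ p" b 0] pn by simp
    moreover have "pauli_coeff n (a XOR 2 ^ p) b (A * pauli n (2 ^ p) 0) = - pauli_coeff n a b A"
      using pauli_coeff_mult_pauli[OF Ac less(1), of "2 ^ p" b 0] b pn by (simp add: chi_power2)
    ultimately show ?thesis using com[of "2 ^ p" 0] by simp
  qed
qed

text \<open>In the Pauli expansion of \<open>A\<close> the strings with nonzero coefficient are
  trivial off \<open>S\<close>, in particular on \<open>T\<close>, and such strings commute with
  \<open>B\<close> by the definition of locality.\<close>

lemma local_on_commute:
  assumes A: "local_on n S A" and B: "local_on n T B" and "S \<inter> T = {}"
  shows "A * B = B * A"
proof (rule eq_matI)
  note Ac = local_on_carrier[OF A] and Bc = local_on_carrier[OF B]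
  fix i j assume "i < dim_row (B * A)" "j < dim_col (B * A)"
  hence ij: "i < 2 ^ n" "j < 2 ^ n" using Ac Bc by auto
  have PB: "pauli_coeff n a b A * (pauli n a b * B) $$ (i, j) = pauli_coeff n a b A * (B * pauli n a b) $$ (i, j)"
    if ab: "a < 2 ^ n" "b < 2 ^ n" for a b
  proof (cases "\<forall>p\<in>T. \<not> bit a p \<and> \<not> bit b p")
    case True
    thus ?thesis using B ab by (simp add: local_on_def del: index_mult_mat)
  next
    case False
    then obtain p where "p \<in> T" "bit a p \<or> bit b p" by auto
    hence "pauli_coeff n a b A = 0" using pauli_coeff_eq_0_if_local[OF A ab, of p] assms(3) by auto
    thus ?thesis by simp
  qed
  have "(A * B) $$ (i, j) = (\<Sum>k<2 ^ n. A $$ (i, k) * B $$ (k, j))" by (rule mat_mult_index[OF Ac Bc ij])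
  also have "\<dots> = (\<Sum>k<2 ^ n. \<Sum>a<2 ^ n. \<Sum>b<2 ^ n. pauli_coeff n a b A * (pauli n a b $$ (i, k) * B $$ (k, j)))"
    by (intro sum.cong refl, subst pauli_expansion[OF Ac])
      (use ij in \<open>simp_all add: sum_distrib_right mult.assoc del: pauli_index\<close>)
  also have "\<dots> = (\<Sum>a<2 ^ n. \<Sum>b<2 ^ n. \<Sum>k<2 ^ n. pauli_coeff n a b A * (pauli n a b $$ (i, k) * B $$ (k, j)))"
    by (subst sum.swap, subst (2) sum.swap) rule
  also have "\<dots> = (\<Sum>a<2 ^ n. \<Sum>b<2 ^ n. pauli_coeff n a b A * (pauli n a b * B) $$ (i, j))"
    by (intro sum.cong refl, subst mat_mult_index[OF pauli_carrier Bc ij]) (simp add: sum_distrib_left del: pauli_index)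
  also have "\<dots> = (\<Sum>a<2 ^ n. \<Sum>b<2 ^ n. pauli_coeff n a b A * (B * pauli n a b) $$ (i, j))"
    by (intro sum.cong refl PB) auto
  also have "\<dots> = (\<Sum>a<2 ^ n. \<Sum>b<2 ^ n. \<Sum>k<2 ^ n. pauli_coeff n a b A * (B $$ (i, k) * pauli n a b $$ (k, j)))"
    by (intro sum.cong refl, subst mat_mult_index[OF Bc pauli_carrier ij]) (simp add: sum_distrib_left del: pauli_index)
  also have "\<dots> = (\<Sum>k<2 ^ n. \<Sum>a<2 ^ n. \<Sum>b<2 ^ n. pauli_coeff n a b A * (B $$ (i, k) * pauli n a b $$ (k, j)))"
    by (subst (2) sum.swap, subst sum.swap) rule
  also have "\<dots> = (\<Sum>k<2 ^ n. B $$ (i, k) * A $$ (k, j))"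
    by (intro sum.cong refl, subst pauli_expansion[OF Ac])
      (use ij in \<open>simp_all add: sum_distrib_left mult.left_commute del: pauli_index\<close>)
  also have "\<dots> = (B * A) $$ (i, j)" by (rule mat_mult_index[symmetric, OF Bc Ac ij])
  finally show "(A * B) $$ (i, j) = (B * A) $$ (i, j)" .
qed (use local_on_carrier[OF A] local_on_carrier[OF B] in auto)

text \<open>The direction U A U^dagger is chosen because the operator then follows the gates forward
  in time, in the order in which \<open>lightcone\<close> grows.\<close>

definition conj_by :: "complex mat \<Rightarrow> complex mat \<Rightarrow> complex mat" where
  "conj_by U A = U * A * mat_adjoint U"

lemma conj_by_mult:
  assumes "U \<in> carrier_mat N N" "V \<in> carrier_mat N N" "A \<in> carrier_mat N N"
  shows "conj_by (U * V) A = conj_by U (conj_by V A)"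
proof -
  note U' = mat_adjoint_carrier[OF assms(1)] and V' = mat_adjoint_carrier[OF assms(2)]
  have VA: "V * A \<in> carrier_mat N N" using assms by simp
  have "U * V * A * (mat_adjoint V * mat_adjoint U) = U * (V * A) * (mat_adjoint V * mat_adjoint U)"
    unfolding assoc_mult_mat[OF assms] ..
  also have "\<dots> = U * (V * A * mat_adjoint V) * mat_adjoint U"
    by (rule mat_mult_regroup[OF assms(1) VA V' U'])
  finally show ?thesis unfolding conj_by_def mat_adjoint_mult[OF assms(1,2)] .
qed

lemma conj_by_one: "A \<in> carrier_mat N N \<Longrightarrow> conj_by (1\<^sub>m N) A = A"
  by (simp add: conj_by_def)

text \<open>A gate disjoint from \<open>S\<close> commutes past the operator and cancels against its
  own adjoint; any other gate adds at most its support.\<close>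

lemma conj_by_local:
  assumes G: "valid_gate n E r G" and A: "local_on n S A"
  shows "local_on n (if supp G \<inter> S = {} then S else S \<union> supp G) (conj_by (gate_unitary n G) A)"
proof (cases "supp G \<inter> S = {}")
  case True
  let ?U = "gate_unitary n G"
  note U = unitary_groupD[OF gate_unitary_unitary[OF G]] and Ac = local_on_carrier[OF A]
  have "?U * A = A * ?U"
    by (rule local_on_commute[OF local_on_gate_unitary A True])
  hence "conj_by ?U A = A * (?U * mat_adjoint ?U)"
    unfolding conj_by_def using assoc_mult_mat[OF Ac U(1,4)] by simp
  also have "\<dots> = A" unfolding U(2) by (rule right_mult_one_mat[OF Ac])
  finally show ?thesis using True A by simp
next
  case False
  have "local_on n (S \<union> supp G) (conj_by (gate_unitary n G) A)"
    unfolding conj_by_def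
    by (intro local_on_mult local_on_adjoint local_on_mono[OF local_on_gate_unitary] local_on_mono[OF A]) auto
  thus ?thesis using False by simp
qed

lemma layer_unitary_carrier: "layer_unitary n L \<in> carrier_mat (2 ^ n) (2 ^ n)"
  by (induction L) (auto simp: layer_unitary_def gate_unitary_def intro!: mult_carrier_mat[of _ "2 ^ n" "2 ^ n"])

lemma circuit_unitary_carrier: "circuit_unitary n C \<in> carrier_mat (2 ^ n) (2 ^ n)"
  by (induction C) (auto intro!: mult_carrier_mat[of _ "2 ^ n" "2 ^ n"] layer_unitary_carrier)

text \<open>When the gates of a layer are added one by one, a gate could meet a support that another
  gate has just added. Disjointness within the layer excludes this: a gate meets the enlarged set
  only if it meets \<open>S\<close> itself.\<close>

lemma conj_by_layer_local:
  assumes "\<forall>G\<in>set L. valid_gate n E r G" "sorted_wrt (\<lambda>G H. supp G \<inter> supp H = {}) L" "local_on n S A"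
  shows "local_on n (S \<union> \<Union>{supp G | G. G \<in> set L \<and> supp G \<inter> S \<noteq> {}}) (conj_by (layer_unitary n L) A)"
  using assms(1,2)
proof (induction L)
  case Nil
  thus ?case using assms(3) conj_by_one[OF local_on_carrier[OF assms(3)]] by (simp add: layer_unitary_def)
next
  case (Cons G L)
  let ?S = "S \<union> \<Union>{supp G | G. G \<in> set L \<and> supp G \<inter> S \<noteq> {}}"
  have Gc: "gate_unitary n G \<in> carrier_mat (2 ^ n) (2 ^ n)" by (simp add: gate_unitary_def)
  have "layer_unitary n (G # L) = gate_unitary n G * layer_unitary n L" by (simp add: layer_unitary_def)
  hence eq: "conj_by (layer_unitary n (G # L)) A = conj_by (gate_unitary n G) (conj_by (layer_unitary n L) A)"
    using conj_by_mult[OF Gc layer_unitary_carrier local_on_carrier[OF assms(3)]] by simp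
  have "local_on n ?S (conj_by (layer_unitary n L) A)" using Cons by simp
  hence *: "local_on n (if supp G \<inter> ?S = {} then ?S else ?S \<union> supp G) (conj_by (layer_unitary n (G # L)) A)"
    unfolding eq using Cons.prems by (intro conj_by_local[of n E r]) auto
  have disj: "\<forall>H\<in>set L. supp G \<inter> supp H = {}" using Cons.prems(2) by simp
  let ?B = "S \<union> \<Union>{supp H | H. H \<in> set (G # L) \<and> supp H \<inter> S \<noteq> {}}"
  have B: "?S \<subseteq> ?B"
    by (intro Un_mono Union_mono order_refl Collect_mono) (metis list.set_intros(2))
  have "(if supp G \<inter> ?S = {} then ?S else ?S \<union> supp G) \<subseteq> ?B"
  proof (cases "supp G \<inter> S = {}")
    case True
    have e: "supp G \<inter> ?S = {}" unfolding Int_Un_distrib Int_Union using True disj by fastforce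
    show ?thesis unfolding if_P[OF e] by (rule B)
  next
    case False
    hence e: "supp G \<inter> ?S \<noteq> {}" by (simp add: Int_Un_distrib)
    have "supp G \<subseteq> ?B"
      by (intro le_supI2 Union_upper CollectI exI[of _ G]) (use False in simp)
    thus ?thesis unfolding if_not_P[OF e] using B by (rule Un_least[rotated])
  qed
  thus ?case by (rule local_on_mono[OF *])
qed

lemma conj_by_circuit_local:
  assumes "valid_circuit n E r C" "local_on n S A"
  shows "local_on n (lightcone S C) (conj_by (circuit_unitary n C) A)"
  using assms
proof (induction C arbitrary: S A)
  case Nil
  thus ?case using conj_by_one[OF local_on_carrier[OF Nil(2)]] by simp
next
  case (Cons L C)
  have eq: "conj_by (circuit_unitary n (L # C)) A = conj_by (circuit_unitary n C) (conj_by (layer_unitary n L) A)"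
    using conj_by_mult[OF circuit_unitary_carrier layer_unitary_carrier local_on_carrier[OF Cons.prems(2)]] by simp
  show ?case unfolding eq lightcone.simps
    by (intro Cons.IH conj_by_layer_local[of L n E r]) (use Cons.prems in \<open>auto simp: valid_circuit_def\<close>)
qed

lemma local_on_pauli_Z:
  assumes "q < n"
  shows "local_on n {q} (pauli n 0 (2 ^ q))"
  unfolding local_on_def
  using assms by (auto simp: pauli_mult chi_power2 chi_commute[of n "2 ^ q"] xor.commute)

section \<open>Pauli weights under Clifford invariance\<close>

text \<open>A one-qubit factor at \<open>p\<close> is a pair \<open>(site u p, site u' p)\<close>;
  the two booleans encode the factors 1, X, Z and X Z.\<close>

definition site :: "bool \<Rightarrow> nat \<Rightarrow> nat" where
  "site u p = (if u then 2 ^ p else 0)"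

lemma bit_site [simp]: "bit (site u p) q \<longleftrightarrow> u \<and> p = q"
  by (auto simp: site_def bit_exp_iff)

lemma site_less [simp]: "p < n \<Longrightarrow> site u p < 2 ^ n"
  by (simp add: site_def)

lemma chi_site: "p < n \<Longrightarrow> chi n (site u p) b = (if u \<and> bit b p then - 1 else 1)"
  by (simp add: site_def chi_commute[of n "2 ^ p"] chi_power2)

text \<open>A string \<open>(c, d)\<close> has an odd number of non-identity factors iff this sign is \<open>- 1\<close>.\<close>

definition weight_sign :: "nat \<Rightarrow> nat \<Rightarrow> nat \<Rightarrow> complex" where
  "weight_sign n c d = chi n c (2 ^ n - 1) * chi n d (2 ^ n - 1) * chi n c d"

lemma bit_mask_nat: "bit (2 ^ n - Suc 0 :: nat) p \<longleftrightarrow> p < n"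
  using bit_mask_iff[where 'a = nat, of n p] unfolding mask_eq_exp_minus_1 by simp

text \<open>The last condition says that the strings \<open>(a, b)\<close> and \<open>(c, d)\<close> anticommute.\<close>

definition clifford_invariant :: "nat \<Rightarrow> (nat \<Rightarrow> nat \<Rightarrow> real) \<Rightarrow> bool" where
  "clifford_invariant n h \<longleftrightarrow> (\<forall>a b c d. a < 2 ^ n \<and> b < 2 ^ n \<and> c < 2 ^ n \<and> d < 2 ^ n \<and>
     weight_sign n c d = - 1 \<and> chi n d a = - chi n b c \<longrightarrow> h (a XOR c) (b XOR d) = h a b)"

lemma clifford_invariantD:
  "\<lbrakk>clifford_invariant n h; a < 2 ^ n; b < 2 ^ n; c < 2 ^ n; d < 2 ^ n; weight_sign n c d = - 1;
    chi n d a = - chi n b c\<rbrakk> \<Longrightarrow> h (a XOR c) (b XOR d) = h a b"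
  by (auto simp: clifford_invariant_def)

text \<open>Let E = (e1, e2), F = (f1, f2), G = (g1, g2). The shift by E at both \<open>l\<close>
  and \<open>j\<close> has even weight, so it is split into two strings of weight three: F at
  \<open>l\<close> and \<open>j\<close>, then F E at \<open>l\<close> and \<open>j\<close>, each
  with the same factor G at \<open>m\<close>. The two strings commute, because their signs at
  \<open>l\<close> and \<open>j\<close> are equal and cancel, so the second step can be tested
  against the original string. The conditions \<open>anti1\<close> and \<open>anti2\<close> are the
  two tests; qubit \<open>j\<close> contributes nothing to them, as the string is trivial
  there.\<close>

lemma two_step_invariance:
  fixes h :: "nat \<Rightarrow> nat \<Rightarrow> real"
  assumes inv: "clifford_invariant n h"
    and ab: "a < 2 ^ n" "b < 2 ^ n"
    and sites: "l < n" "j < n" "m < n" "l \<noteq> j" "m \<noteq> l" "m \<noteq> j"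
    and f: "f1 \<or> f2" "f1 \<noteq> e1 \<or> f2 \<noteq> e2" and g: "g1 \<or> g2"
    and triv: "\<not> bit a j" "\<not> bit b j"
    and anti1: "((f2 \<and> bit a l) \<noteq> (f1 \<and> bit b l)) \<noteq> ((g2 \<and> bit a m) \<noteq> (g1 \<and> bit b m))"
    and anti2: "(((f2 \<noteq> e2) \<and> bit a l) \<noteq> ((f1 \<noteq> e1) \<and> bit b l)) \<noteq> ((g2 \<and> bit a m) \<noteq> (g1 \<and> bit b m))"
  shows "h (a XOR (site e1 l XOR site e1 j)) (b XOR (site e2 l XOR site e2 j)) = h a b"
proof -
  let ?T = "\<lambda>u v. site u l XOR (site u j XOR site v m)"
  have less: "?T u v < 2 ^ n" for u v
    using sites by (intro xor_less_power2) auto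
  have sign: "weight_sign n (?T u v) (?T u' v') = - 1" if "u \<or> u'" "v \<or> v'" for u v u' v'
    using that sites by (auto simp: weight_sign_def chi_xor_left chi_site bit_mask_nat bit_xor_iff)
  have 1: "h (a XOR ?T f1 g1) (b XOR ?T f2 g2) = h a b"
  proof (rule clifford_invariantD[OF inv ab less less sign])
    show "chi n (?T f2 g2) a = - chi n b (?T f1 g1)"
      unfolding chi_commute[of n b] using anti1 triv sites
      by (simp add: chi_xor_left chi_site) argo
  qed (use f g in auto)
  let ?a = "a XOR ?T f1 g1" and ?b = "b XOR ?T f2 g2"
  have less': "?a < 2 ^ n" "?b < 2 ^ n" using ab sites by (auto intro!: xor_less_power2)
  have 2: "h (?a XOR ?T (f1 \<noteq> e1) g1) (?b XOR ?T (f2 \<noteq> e2) g2) = h ?a ?b"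
  proof (rule clifford_invariantD[OF inv less' less less sign])
    show "chi n (?T (f2 \<noteq> e2) g2) ?a = - chi n ?b (?T (f1 \<noteq> e1) g1)"
      unfolding chi_commute[of n ?b] using anti2 triv sites
      by (simp add: chi_xor_left chi_site bit_xor_iff) argo
  qed (use f g in auto)
  have "?a XOR ?T (f1 \<noteq> e1) g1 = a XOR (site e1 l XOR site e1 j)"
    by (rule bit_eqI) (use sites in \<open>auto simp: bit_xor_iff\<close>)
  moreover have "?b XOR ?T (f2 \<noteq> e2) g2 = b XOR (site e2 l XOR site e2 j)"
    by (rule bit_eqI) (use sites in \<open>auto simp: bit_xor_iff\<close>)
  ultimately show ?thesis using 1 2 by simp
qed

text \<open>If the string is nontrivial at \<open>l\<close>, its factor there is moved to
  \<open>j\<close>: E is this factor and F another non-identity one, so F and F E both anticommute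
  with it, and G has to commute with the factor at \<open>m\<close>. If the string is trivial at
  \<open>l\<close>, then F and F E commute with it there, so \<open>m\<close> is taken where the
  string is nontrivial and G is chosen to anticommute with that factor.\<close>

lemma move_to_site:
  fixes h :: "nat \<Rightarrow> nat \<Rightarrow> real"
  assumes inv: "clifford_invariant n h"
    and ab: "a < 2 ^ n" "b < 2 ^ n"
    and n: "3 \<le> n" and sites: "l < n" "j < n" "l \<noteq> j" and triv: "\<not> bit a j" "\<not> bit b j"
    and nz: "a \<noteq> 0 \<or> b \<noteq> 0"
  obtains e1 e2 where "e1 \<or> e2"
    "h (a XOR (site e1 l XOR site e1 j)) (b XOR (site e2 l XOR site e2 j)) = h a b"
proof (cases "bit a l \<or> bit b l")
  case True
  obtain m where m: "m < n" "m \<noteq> l" "m \<noteq> j"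
  proof -
    have "card {l, j} < card {..<n}" using n by (simp add: card_insert_if)
    then obtain m where "m \<in> {..<n} - {l, j}" by (metis Diff_eq_empty_iff card_mono finite.emptyI finite.insertI not_le ex_in_conv)
    thus ?thesis using that by auto
  qed
  define e1 e2 where "e1 = bit a l" and "e2 = bit b l"
  obtain f1 f2 where f: "f1 \<or> f2" "f1 \<noteq> e1 \<or> f2 \<noteq> e2" by metis
  \<comment> \<open>G is the string's own factor at \<open>m\<close>, or X if that factor is
    trivial. Either way it is not the identity and commutes with the factor.\<close>
  define g1 g2 where "g1 = (bit a m \<or> \<not> bit b m)" and "g2 = bit b m"
  have "h (a XOR (site e1 l XOR site e1 j)) (b XOR (site e2 l XOR site e2 j)) = h a b"
    by (rule two_step_invariance[OF inv ab sites(1,2) m(1) sites(3) m(2,3) f _ triv,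
          where ?g1.0 = g1 and ?g2.0 = g2])
      (use True f in \<open>auto simp: e1_def e2_def g1_def g2_def\<close>)
  thus ?thesis using that True by (auto simp: e1_def e2_def)
next
  case False
  obtain m where m: "m < n" "bit a m \<or> bit b m"
    using nz eq_if_bits_eq[OF ab(1), of 0] eq_if_bits_eq[OF ab(2), of 0] by auto
  hence m': "m \<noteq> l" "m \<noteq> j" using False triv by auto
  \<comment> \<open>Here E = X and F = Z; G is X if the factor at \<open>m\<close> contains Z and is
    Z otherwise, so it anticommutes with that factor.\<close>
  have "h (a XOR (site True l XOR site True j)) (b XOR (site False l XOR site False j)) = h a b"
    by (rule two_step_invariance[OF inv ab sites(1,2) m(1) sites(3) m',
          where ?f1.0 = False and ?f2.0 = True and ?g1.0 = "bit b m" and ?g2.0 = "\<not> bit b m"])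
      (use False m triv in auto)
  thus ?thesis using that by blast
qed

text \<open>Apart from the identity, which has no mass, the strings trivial at \<open>j\<close>
  inject with equal value of \<open>h\<close> into those nontrivial at \<open>j\<close>. So their
  mass is at most that of the complement.\<close>

lemma trivial_site_weight_le_half:
  fixes h :: "nat \<Rightarrow> nat \<Rightarrow> real"
  assumes inv: "clifford_invariant n h"
    and nonneg: "\<And>a b. 0 \<le> h a b" and zero: "h 0 0 = 0"
    and total: "(\<Sum>(a, b)\<in>{..<2 ^ n} \<times> {..<2 ^ n}. h a b) = 1"
    and n: "3 \<le> n" and j: "j < n"
  shows "(\<Sum>(a, b)\<in>{(a :: nat, b :: nat). a < 2 ^ n \<and> b < 2 ^ n \<and> \<not> bit a j \<and> \<not> bit b j}. h a b) \<le> 1 / 2"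
proof -
  define W where "W = {..<2 ^ n :: nat} \<times> {..<2 ^ n :: nat}"
  define T where "T = {(a, b) \<in> W. \<not> bit a j \<and> \<not> bit b j}"
  have fin: "finite W" by (simp add: W_def)
  have finT: "finite T" by (rule finite_subset[OF _ fin]) (auto simp: T_def)
  obtain l where l: "l < n" "l \<noteq> j" using n that[of 0] that[of 1] by (cases "j = 0") auto
  define sh where "sh R E = (fst R XOR (site (fst E) l XOR site (fst E) j), snd R XOR (site (snd E) l XOR site (snd E) j))"
    for R :: "nat \<times> nat" and E :: "bool \<times> bool"
  have "\<exists>E. (fst E \<or> snd E) \<and> h (fst (sh R E)) (snd (sh R E)) = h (fst R) (snd R)"
    if RT: "R \<in> T - {(0, 0)}" for R
  proof -
    obtain a b where R: "R = (a, b)" by (cases R)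
    obtain e1 e2 where "e1 \<or> e2" "h (a XOR (site e1 l XOR site e1 j)) (b XOR (site e2 l XOR site e2 j)) = h a b"
      by (rule move_to_site[OF inv _ _ n l(1) j l(2), of a b]) (use RT R in \<open>auto simp: T_def W_def\<close>)
    thus ?thesis by (intro exI[of _ "(e1, e2)"]) (simp add: sh_def R)
  qed
  then obtain e where e: "fst (e R) \<or> snd (e R)" "h (fst (sh R (e R))) (snd (sh R (e R))) = h (fst R) (snd R)"
    if "R \<in> T - {(0, 0)}" for R by metis
  define \<phi> where "\<phi> R = sh R (e R)" for R
  have bits: "bit (fst (\<phi> R)) j = fst (e R)" "bit (snd (\<phi> R)) j = snd (e R)" if "R \<in> T" for R
    using that l by (auto simp: \<phi>_def sh_def T_def bit_xor_iff)
  have inj: "inj_on \<phi> (T - {(0, 0)})"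
  proof (rule inj_onI)
    fix R R' assume R: "R \<in> T - {(0, 0)}" "R' \<in> T - {(0, 0)}" and eq: "\<phi> R = \<phi> R'"
    \<comment> \<open>As \<open>R\<close> is trivial at \<open>j\<close>, its image displays at
      \<open>j\<close> which shift was applied. Once the shift is known it can be undone, since XOR
      is an involution.\<close>
    have E: "e R = e R'" using bits[of R] bits[of R'] R eq by (auto simp: prod_eq_iff)
    have "sh (sh R E) E = R" for R E
      by (rule prod_eqI) (simp_all only: sh_def fst_conv snd_conv xor_cancel)
    hence "sh (\<phi> R) (e R) = R" "sh (\<phi> R') (e R') = R'" unfolding \<phi>_def by blast+
    thus "R = R'" unfolding E[symmetric] eq[symmetric] by (rule trans[OF sym])
  qed
  have sub: "\<phi> ` (T - {(0, 0)}) \<subseteq> W - T"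
  proof
    fix x assume "x \<in> \<phi> ` (T - {(0, 0)})"
    then obtain R where R: "R \<in> T - {(0, 0)}" "x = \<phi> R" by auto
    have "\<phi> R \<in> W" using R l j by (auto simp: \<phi>_def sh_def T_def W_def intro!: xor_less_power2)
    moreover have "\<phi> R \<notin> T" using bits[of R] e(1)[OF R(1)] R by (auto simp: T_def)
    ultimately show "x \<in> W - T" using R by simp
  qed
  have "(\<Sum>R\<in>T. h (fst R) (snd R)) = (\<Sum>R\<in>T - {(0, 0)}. h (fst R) (snd R))"
    by (rule sum.mono_neutral_right) (use finT zero in auto)
  also have "\<dots> = (\<Sum>R\<in>T - {(0, 0)}. h (fst (\<phi> R)) (snd (\<phi> R)))"
    by (intro sum.cong refl) (use e(2) in \<open>simp add: \<phi>_def\<close>)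
  also have "\<dots> = (\<Sum>R\<in>\<phi> ` (T - {(0, 0)}). h (fst R) (snd R))"
    by (simp add: sum.reindex[OF inj])
  also have "\<dots> \<le> (\<Sum>R\<in>W - T. h (fst R) (snd R))"
    by (rule sum_mono2[OF _ sub]) (use fin nonneg in auto)
  also have "\<dots> = (\<Sum>R\<in>W. h (fst R) (snd R)) - (\<Sum>R\<in>T. h (fst R) (snd R))"
    by (rule sum_diff[OF fin]) (auto simp: T_def)
  also have "(\<Sum>R\<in>W. h (fst R) (snd R)) = 1" using total by (simp add: W_def case_prod_beta)
  finally have "(\<Sum>R\<in>T. h (fst R) (snd R)) \<le> 1 / 2" by simp
  moreover have "T = {(a :: nat, b :: nat). a < 2 ^ n \<and> b < 2 ^ n \<and> \<not> bit a j \<and> \<not> bit b j}"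
    by (auto simp: T_def W_def)
  ultimately show ?thesis by (simp add: case_prod_beta)
qed

definition low_weight :: "nat \<Rightarrow> (nat \<times> nat) set" where
  "low_weight n = {(a :: nat, b :: nat). a < 2 ^ n \<and> b < 2 ^ n \<and> real (card {p. p < n \<and> (bit a p \<or> bit b p)}) < real n / 4}"

lemma finite_low_weight [simp]: "finite (low_weight n)"
proof (rule finite_subset)
  show "low_weight n \<subseteq> {..<2 ^ n} \<times> {..<2 ^ n}" by (auto simp: low_weight_def)
qed simp

text \<open>Markov's inequality for the number of trivial qubits: it is at least 3n/4 on a
  low-weight string and has mean at most n/2, hence the factor 4/(3n) and the bound 2/3.\<close>

lemma low_weight_sum_le:
  fixes h :: "nat \<Rightarrow> nat \<Rightarrow> real"
  assumes inv: "clifford_invariant n h"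
    and nonneg: "\<And>a b. 0 \<le> h a b" and zero: "h 0 0 = 0"
    and total: "(\<Sum>(a, b)\<in>{..<2 ^ n} \<times> {..<2 ^ n}. h a b) = 1"
    and n: "3 \<le> n"
  shows "(\<Sum>(a, b)\<in>low_weight n. h a b) \<le> 2 / 3"
proof -
  define W where "W = {..<2 ^ n :: nat} \<times> {..<2 ^ n :: nat}"
  define t :: "nat \<Rightarrow> nat \<times> nat \<Rightarrow> bool" where "t p R \<longleftrightarrow> \<not> bit (fst R) p \<and> \<not> bit (snd R) p" for p R
  have fin: "finite W" by (simp add: W_def)
  have "h (fst R) (snd R) \<le> (4 / (3 * real n)) * (\<Sum>p<n. of_bool (t p R) * h (fst R) (snd R))"
    if R: "R \<in> low_weight n" for R
  proof -
    have "{..<n} = {p. p < n \<and> (bit (fst R) p \<or> bit (snd R) p)} \<union> {p. p < n \<and> t p R}"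
      by (auto simp: t_def)
    moreover have "card ({p. p < n \<and> (bit (fst R) p \<or> bit (snd R) p)} \<union> {p. p < n \<and> t p R}) =
        card {p. p < n \<and> (bit (fst R) p \<or> bit (snd R) p)} + card {p. p < n \<and> t p R}"
      by (rule card_Un_disjoint) (auto simp: t_def)
    ultimately have "n = card {p. p < n \<and> (bit (fst R) p \<or> bit (snd R) p)} + card {p. p < n \<and> t p R}"
      by (metis card_lessThan)
    hence c: "3 * real n / 4 \<le> real (card {p. p < n \<and> t p R})"
      using R by (auto simp: low_weight_def)
    have e: "(\<Sum>p<n. of_bool (t p R) * h (fst R) (snd R)) = real (card {p. p < n \<and> t p R}) * h (fst R) (snd R)"
    proof -
      have "{..<n} \<inter> {p. t p R} = {p. p < n \<and> t p R}" by auto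
      thus ?thesis by (simp flip: sum_distrib_right)
    qed
    have "3 * real n / 4 * h (fst R) (snd R) \<le> real (card {p. p < n \<and> t p R}) * h (fst R) (snd R)"
      using c nonneg by (rule mult_right_mono)
    thus ?thesis unfolding e using n by (simp add: field_simps)
  qed
  hence "(\<Sum>R\<in>low_weight n. h (fst R) (snd R)) \<le>
      (\<Sum>R\<in>low_weight n. (4 / (3 * real n)) * (\<Sum>p<n. of_bool (t p R) * h (fst R) (snd R)))"
    by (rule sum_mono)
  also have "\<dots> \<le> (\<Sum>R\<in>W. (4 / (3 * real n)) * (\<Sum>p<n. of_bool (t p R) * h (fst R) (snd R)))"
    by (rule sum_mono2[OF fin]) (use nonneg in \<open>auto simp: low_weight_def W_def intro!: sum_nonneg\<close>)
  also have "\<dots> = (4 / (3 * real n)) * (\<Sum>p<n. \<Sum>R\<in>W. of_bool (t p R) * h (fst R) (snd R))"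
    unfolding sum_distrib_left[symmetric] by (subst sum.swap) rule
  also have "\<dots> \<le> (4 / (3 * real n)) * (\<Sum>p<n. 1 / 2)"
  proof (intro mult_left_mono sum_mono)
    fix p assume "p \<in> {..<n}"
    hence p: "p < n" by simp
    have "(\<Sum>R\<in>W. of_bool (t p R) * h (fst R) (snd R)) =
        (\<Sum>(a, b)\<in>{(a :: nat, b :: nat). a < 2 ^ n \<and> b < 2 ^ n \<and> \<not> bit a p \<and> \<not> bit b p}. h a b)"
      by (rule sum.mono_neutral_cong_right[OF fin]) (auto simp: W_def t_def)
    also have "\<dots> \<le> 1 / 2"
      by (rule trivial_site_weight_le_half[OF inv nonneg zero total n p])
    finally show "(\<Sum>R\<in>W. of_bool (t p R) * h (fst R) (snd R)) \<le> 1 / 2" .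
  qed simp
  also have "\<dots> = 2 / 3" using n by simp
  finally show ?thesis by (simp add: case_prod_beta)
qed

section \<open>Clifford rotations in the symplectic group\<close>

lemma expand_sandwich:
  fixes A B C :: "complex mat"
  assumes "A \<in> carrier_mat N N" "B \<in> carrier_mat N N" "C \<in> carrier_mat N N"
  shows "(1\<^sub>m N + A) * B * (1\<^sub>m N + C) = B + A * B + (B * C + A * B * C)"
proof -
  have AB: "A * B \<in> carrier_mat N N" using assms by simp
  have one: "(1\<^sub>m N :: complex mat) \<in> carrier_mat N N" by simp
  have "(1\<^sub>m N + A) * B = B + A * B"
    unfolding add_mult_distrib_mat[OF one assms(1,2)] left_mult_one_mat[OF assms(2)] ..
  moreover have "(B + A * B) * (1\<^sub>m N + C) = (B + A * B) * 1\<^sub>m N + (B + A * B) * C"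
    by (rule mult_add_distrib_mat) (use assms AB in auto)
  moreover have "(B + A * B) * 1\<^sub>m N = B + A * B"
    by (rule right_mult_one_mat) (use assms AB in auto)
  moreover have "(B + A * B) * C = B * C + A * B * C"
    by (rule add_mult_distrib_mat[OF assms(2) AB assms(3)])
  ultimately show ?thesis by simp
qed

lemma uminus_uminus_matrix: "- (- A) = (A :: complex mat)"
  by (rule eq_matI) auto

text \<open>With \<open>A * B = - (B * C)\<close> the mixed terms of the expansion cancel, and with
  \<open>C * C = - 1\<close> the last term equals \<open>B\<close>. The instance B = 1, C = - A
  gives unitarity of a rotation, the instance B = J, C = A^T its symplecticity.\<close>

lemma sandwich_eq_double:
  fixes A B C :: "complex mat"
  assumes A: "A \<in> carrier_mat N N" and B: "B \<in> carrier_mat N N" and C: "C \<in> carrier_mat N N"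
    and AB: "A * B = - (B * C)" and CC: "C * C = - 1\<^sub>m N"
  shows "(1\<^sub>m N + A) * B * (1\<^sub>m N + C) = 2 \<cdot>\<^sub>m B"
proof -
  note dims = carrier_matD[OF A] carrier_matD[OF B] carrier_matD[OF C]
  have BC: "B * C \<in> carrier_mat N N" by (rule mult_carrier_mat[OF B C])
  have "A * B * C = - (B * C * C)" unfolding AB
    by (rule uminus_mult_left_mat) (simp only: index_mult_mat dims)
  also have "B * C * C = B * (C * C)" by (rule assoc_mult_mat[OF B C C])
  also have "\<dots> = - (B * 1\<^sub>m N)" unfolding CC
    by (rule uminus_mult_right_mat) (simp only: dims index_one_mat)
  finally have ABC: "A * B * C = B"
    unfolding uminus_uminus_matrix right_mult_one_mat[OF B] .
  have "B + - X + (X + B) = 2 \<cdot>\<^sub>m B" if "X \<in> carrier_mat N N" for X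
    by (rule eq_matI) (use carrier_matD[OF that] dims in simp_all)
  from this[OF BC] show ?thesis unfolding expand_sandwich[OF A B C] unfolding ABC unfolding AB .
qed

text \<open>The Clifford rotation \<open>exp (\<pi>/4 t P)\<close>, where the phase \<open>t\<close> makes \<open>t P\<close> anti-Hermitian.\<close>

definition rot_phase :: "nat \<Rightarrow> nat \<Rightarrow> nat \<Rightarrow> complex" where
  "rot_phase n c d = (if chi n c d = 1 then \<i> else 1)"

definition rot :: "nat \<Rightarrow> nat \<Rightarrow> nat \<Rightarrow> complex mat" where
  "rot n c d = of_real (1 / sqrt 2) \<cdot>\<^sub>m (1\<^sub>m (2 ^ n) + rot_phase n c d \<cdot>\<^sub>m pauli n c d)"

lemma rot_phase_props:
  "rot_phase n c d * rot_phase n c d * chi n c d = - 1"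
  "cnj (rot_phase n c d) * chi n c d = - rot_phase n c d"
  "cmod (rot_phase n c d) = 1"
  using chi_cases[of n c d] by (auto simp: rot_phase_def)

lemma rot_carrier [simp]: "rot n c d \<in> carrier_mat (2 ^ n) (2 ^ n)"
  by (simp add: rot_def)

lemma smult_smult_matrix: "a \<cdot>\<^sub>m (b \<cdot>\<^sub>m A) = (a * b) \<cdot>\<^sub>m (A :: complex mat)"
  by (rule eq_matI) auto

lemma half_sandwich:
  fixes X Y B :: "complex mat"
  assumes "X \<in> carrier_mat N N" "Y \<in> carrier_mat N N" "B \<in> carrier_mat N N"
  shows "(of_real (1 / sqrt 2) \<cdot>\<^sub>m X) * B * (of_real (1 / sqrt 2) \<cdot>\<^sub>m Y) = (1 / 2) \<cdot>\<^sub>m (X * B * Y)"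
proof -
  let ?s = "complex_of_real (1 / sqrt 2)"
  have XB: "X * B \<in> carrier_mat N N" using assms by simp
  have s: "?s * ?s = 1 / 2" by (simp flip: of_real_mult)
  have "(?s \<cdot>\<^sub>m X) * B = ?s \<cdot>\<^sub>m (X * B)" by (rule mult_smult_assoc_mat[OF assms(1,3)])
  moreover have "(?s \<cdot>\<^sub>m (X * B)) * (?s \<cdot>\<^sub>m Y) = ?s \<cdot>\<^sub>m (X * B * (?s \<cdot>\<^sub>m Y))"
    by (rule mult_smult_assoc_mat[OF XB smult_carrier_mat[OF assms(2)]])
  moreover have "X * B * (?s \<cdot>\<^sub>m Y) = ?s \<cdot>\<^sub>m (X * B * Y)" by (rule mult_smult_distrib[OF XB assms(2)])
  moreover have "?s \<cdot>\<^sub>m (?s \<cdot>\<^sub>m (X * B * Y)) = (1 / 2) \<cdot>\<^sub>m (X * B * Y)"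
    unfolding smult_smult_matrix s ..
  ultimately show ?thesis by simp
qed

lemma half_double: "(1 / 2) \<cdot>\<^sub>m (2 \<cdot>\<^sub>m (B :: complex mat)) = B"
  by (rule eq_matI) auto

context
  fixes n c d :: nat
  assumes cd: "c < 2 ^ n" "d < 2 ^ n"
begin

abbreviation (input) "rot_gen \<equiv> rot_phase n c d \<cdot>\<^sub>m pauli n c d"

lemma rot_gen_carrier: "rot_gen \<in> carrier_mat (2 ^ n) (2 ^ n)"
  by simp

lemma rot_gen_square: "rot_gen * rot_gen = - 1\<^sub>m (2 ^ n)"
proof -
  let ?t = "rot_phase n c d"
  have "rot_gen * rot_gen = ?t \<cdot>\<^sub>m (pauli n c d * rot_gen)" by (rule mult_smult_assoc_mat[OF pauli_carrier rot_gen_carrier])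
  also have "pauli n c d * rot_gen = ?t \<cdot>\<^sub>m (pauli n c d * pauli n c d)"
    by (rule mult_smult_distrib[OF pauli_carrier pauli_carrier])
  also have "\<dots> = ?t \<cdot>\<^sub>m (chi n c d \<cdot>\<^sub>m 1\<^sub>m (2 ^ n))" unfolding pauli_square[OF cd(1)] ..
  finally have eq: "rot_gen * rot_gen = ?t \<cdot>\<^sub>m (?t \<cdot>\<^sub>m (chi n c d \<cdot>\<^sub>m 1\<^sub>m (2 ^ n)))" .
  show ?thesis unfolding eq
    by (rule eq_matI) (use rot_phase_props(1)[of n c d] in \<open>auto simp: mult.assoc\<close>)
qed

lemma rot_gen_adjoint: "mat_adjoint rot_gen = - rot_gen"
proof (rule eq_matI)
  fix i j assume "i < dim_row (- rot_gen)" "j < dim_col (- rot_gen)"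
  hence ij: "i < 2 ^ n" "j < 2 ^ n" by simp_all
  have "mat_adjoint rot_gen $$ (i, j) = cnj (rot_phase n c d) * mat_adjoint (pauli n c d) $$ (i, j)"
    using ij by (simp del: pauli_index)
  also have "\<dots> = cnj (rot_phase n c d) * chi n c d * pauli n c d $$ (i, j)"
    unfolding mat_adjoint_pauli[OF cd(1)] using ij by (simp del: pauli_index)
  finally show "mat_adjoint rot_gen $$ (i, j) = (- rot_gen) $$ (i, j)"
    unfolding rot_phase_props(2) using ij by (simp del: pauli_index)
qed simp_all

lemma rot_adjoint: "mat_adjoint (rot n c d) = of_real (1 / sqrt 2) \<cdot>\<^sub>m (1\<^sub>m (2 ^ n) + - rot_gen)"
proof (rule eq_matI)
  fix i j assume "i < dim_row (complex_of_real (1 / sqrt 2) \<cdot>\<^sub>m (1\<^sub>m (2 ^ n) + - rot_gen))"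
    "j < dim_col (complex_of_real (1 / sqrt 2) \<cdot>\<^sub>m (1\<^sub>m (2 ^ n) + - rot_gen))"
  hence ij: "i < 2 ^ n" "j < 2 ^ n" by simp_all
  have "cnj (rot_gen $$ (j, i)) = (- rot_gen) $$ (i, j)"
    unfolding rot_gen_adjoint[symmetric] using ij by (subst mat_adjoint_index) simp_all
  thus "mat_adjoint (rot n c d) $$ (i, j) = (of_real (1 / sqrt 2) \<cdot>\<^sub>m (1\<^sub>m (2 ^ n) + - rot_gen)) $$ (i, j)"
    using ij by (auto simp: rot_def simp del: pauli_index)
qed (simp_all add: rot_def)

lemma rot_unitary: "rot n c d \<in> unitary_group (2 ^ n)"
proof -
  have mQ: "- rot_gen \<in> carrier_mat (2 ^ n) (2 ^ n)" by simp
  have one: "(1\<^sub>m (2 ^ n) :: complex mat) \<in> carrier_mat (2 ^ n) (2 ^ n)" by simp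
  have "(1\<^sub>m (2 ^ n) + rot_gen) * 1\<^sub>m (2 ^ n) * (1\<^sub>m (2 ^ n) + - rot_gen) = 2 \<cdot>\<^sub>m 1\<^sub>m (2 ^ n)"
  proof (rule sandwich_eq_double[OF rot_gen_carrier one mQ])
    show "rot_gen * 1\<^sub>m (2 ^ n) = - (1\<^sub>m (2 ^ n) * - rot_gen)"
      unfolding right_mult_one_mat[OF rot_gen_carrier] left_mult_one_mat[OF mQ] by (rule eq_matI) auto
    have "- rot_gen * - rot_gen = - (rot_gen * - rot_gen)" by (rule uminus_mult_left_mat) simp
    also have "rot_gen * - rot_gen = - (rot_gen * rot_gen)" by (rule uminus_mult_right_mat) simp
    finally show "- rot_gen * - rot_gen = - 1\<^sub>m (2 ^ n)" unfolding rot_gen_square uminus_uminus_matrix .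
  qed
  hence "rot n c d * 1\<^sub>m (2 ^ n) * mat_adjoint (rot n c d) = 1\<^sub>m (2 ^ n)"
    unfolding rot_adjoint unfolding rot_def by (subst half_sandwich[of _ "2 ^ n"]) (simp_all add: half_double)
  hence 1: "rot n c d * mat_adjoint (rot n c d) = 1\<^sub>m (2 ^ n)"
    unfolding right_mult_one_mat[OF rot_carrier] .
  moreover have "mat_adjoint (rot n c d) * rot n c d = 1\<^sub>m (2 ^ n)"
    by (rule mat_mult_left_right_inverse[OF _ _ 1]) simp_all
  ultimately show ?thesis by (simp add: unitary_group_def)
qed

text \<open>Commuting the generator Q past J and transposing it produces exactly the signs collected
  in \<open>weight_sign\<close>. Odd weight therefore yields Q J = - J Q^T, to which the sandwich
  identity applies.\<close>

lemma rot_in_USp: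
  assumes n: "odd n" and w: "weight_sign n c d = - 1"
  shows "rot n c d \<in> USp n"
proof -
  define m where "m = (2 ^ n - 1 :: nat)"
  let ?J = "symplectic_form n"
  let ?t = "rot_phase n c d"
  define R where "R = ?t \<cdot>\<^sub>m transpose_mat (pauli n c d)"
  have m: "m < 2 ^ n" by (simp add: m_def)
  have J: "?J = - pauli n m m" unfolding m_def by (rule symplectic_form_eq_pauli[OF n])
  have Jc: "?J \<in> carrier_mat (2 ^ n) (2 ^ n)" unfolding J by simp
  have Rc: "R \<in> carrier_mat (2 ^ n) (2 ^ n)" by (simp add: R_def)
  have R_eq: "R = chi n c d \<cdot>\<^sub>m rot_gen"
    unfolding R_def transpose_pauli[OF cd(1)] by (rule eq_matI) (auto simp: mult.commute mult.left_commute)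
  have PJ: "pauli n c d * ?J = - (chi n d m \<cdot>\<^sub>m pauli n (c XOR m) (d XOR m))"
    unfolding J pauli_mult[OF cd(1) m, symmetric] by (rule uminus_mult_right_mat) simp
  have JP: "?J * pauli n c d = - (chi n m c \<cdot>\<^sub>m pauli n (m XOR c) (m XOR d))"
    unfolding J pauli_mult[OF m cd(1), symmetric] by (rule uminus_mult_left_mat) simp
  have QJ: "rot_gen * ?J = ?t \<cdot>\<^sub>m (pauli n c d * ?J)" by (rule mult_smult_assoc_mat[OF pauli_carrier Jc])
  have "?J * R = chi n c d \<cdot>\<^sub>m (?J * rot_gen)" unfolding R_eq by (rule mult_smult_distrib[OF Jc rot_gen_carrier])
  also have "?J * rot_gen = ?t \<cdot>\<^sub>m (?J * pauli n c d)" by (rule mult_smult_distrib[OF Jc pauli_carrier])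
  finally have JR: "?J * R = chi n c d \<cdot>\<^sub>m (?t \<cdot>\<^sub>m (?J * pauli n c d))" .
  \<comment> \<open>The odd-weight hypothesis, solved for the sign that the relation between Q J and
    J Q^T needs.\<close>
  have sgn: "chi n d m = - (chi n c d * chi n m c)"
  proof -
    have "chi n c m * chi n d m * chi n c d = - 1" using w by (simp only: weight_sign_def m_def)
    thus ?thesis using chi_cases[of n c m] chi_cases[of n d m] chi_cases[of n c d]
      by (auto simp: chi_commute[of n m c])
  qed
  have QJ_JR: "rot_gen * ?J = - (?J * R)"
    unfolding QJ JR PJ JP sgn
    by (rule eq_matI) (auto simp: xor.commute simp del: pauli_index)
  have "R * R = chi n c d \<cdot>\<^sub>m (rot_gen * (chi n c d \<cdot>\<^sub>m rot_gen))"
    unfolding R_eq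
    by (rule mult_smult_assoc_mat[OF rot_gen_carrier smult_carrier_mat[OF rot_gen_carrier]])
  also have "rot_gen * (chi n c d \<cdot>\<^sub>m rot_gen) = chi n c d \<cdot>\<^sub>m (rot_gen * rot_gen)"
    by (rule mult_smult_distrib[OF rot_gen_carrier rot_gen_carrier])
  also have "chi n c d \<cdot>\<^sub>m (chi n c d \<cdot>\<^sub>m (rot_gen * rot_gen)) = - 1\<^sub>m (2 ^ n)"
    unfolding rot_gen_square by (rule eq_matI) auto
  finally have RR: "R * R = - 1\<^sub>m (2 ^ n)" .
  have tr: "transpose_mat (rot n c d) = of_real (1 / sqrt 2) \<cdot>\<^sub>m (1\<^sub>m (2 ^ n) + R)"
    by (rule eq_matI) (auto simp: rot_def R_def simp del: pauli_index)
  have "rot n c d * ?J * transpose_mat (rot n c d) = ?J"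
    unfolding tr unfolding rot_def
    by (subst half_sandwich[OF _ _ Jc])
      (use sandwich_eq_double[OF rot_gen_carrier Jc Rc QJ_JR RR] Rc in \<open>simp_all add: half_double\<close>)
  thus ?thesis using rot_unitary by (simp add: USp_def)
qed

text \<open>With Q the generator, the conjugate of \<open>O'\<close> is half of
  \<open>O' + Q O' - O' Q - Q O' Q\<close>. At a string that anticommutes with Q the first and last
  terms cancel, because Q Q = - 1, and the mixed terms add up. So the rotation moves the coefficient
  to the shifted label, up to a phase.\<close>

lemma pauli_coeff_conj_rot:
  assumes O: "O' \<in> carrier_mat (2 ^ n) (2 ^ n)" and ab: "a < 2 ^ n" "b < 2 ^ n"
    and anti: "chi n d a = - chi n b c"
  shows "cmod (pauli_coeff n a b (conj_by (rot n c d) O')) = cmod (pauli_coeff n (a XOR c) (b XOR d) O')"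
proof -
  let ?P = "pauli n c d" and ?t = "rot_phase n c d" and ?x = "pauli_coeff n (a XOR c) (b XOR d) O'"
  have mQ: "- rot_gen = (- ?t) \<cdot>\<^sub>m ?P" by (rule eq_matI) auto
  have mQc: "- rot_gen \<in> carrier_mat (2 ^ n) (2 ^ n)" by simp
  have PO: "?P * O' \<in> carrier_mat (2 ^ n) (2 ^ n)" and OP: "O' * ?P \<in> carrier_mat (2 ^ n) (2 ^ n)"
    using O by (auto intro!: mult_carrier_mat[of _ "2 ^ n" "2 ^ n"])
  have POP: "?P * O' * ?P \<in> carrier_mat (2 ^ n) (2 ^ n)"
    by (rule mult_carrier_mat[OF PO pauli_carrier])
  have QO: "rot_gen * O' = ?t \<cdot>\<^sub>m (?P * O')" by (rule mult_smult_assoc_mat[OF pauli_carrier O])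
  have OQ: "O' * - rot_gen = (- ?t) \<cdot>\<^sub>m (O' * ?P)" unfolding mQ by (rule mult_smult_distrib[OF O pauli_carrier])
  have "rot_gen * O' * - rot_gen = ?t \<cdot>\<^sub>m ((?P * O') * ((- ?t) \<cdot>\<^sub>m ?P))"
    unfolding QO mQ by (rule mult_smult_assoc_mat[OF PO smult_carrier_mat[OF pauli_carrier]])
  also have "(?P * O') * ((- ?t) \<cdot>\<^sub>m ?P) = (- ?t) \<cdot>\<^sub>m (?P * O' * ?P)"
    by (rule mult_smult_distrib[OF PO pauli_carrier])
  finally have QOQ: "rot_gen * O' * - rot_gen = ?t \<cdot>\<^sub>m ((- ?t) \<cdot>\<^sub>m (?P * O' * ?P))" .
  have xs: "a XOR c < 2 ^ n" using ab cd by (simp add: xor_less_power2)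
  have "conj_by (rot n c d) O' = (1 / 2) \<cdot>\<^sub>m ((1\<^sub>m (2 ^ n) + rot_gen) * O' * (1\<^sub>m (2 ^ n) + - rot_gen))"
    unfolding conj_by_def rot_adjoint unfolding rot_def by (rule half_sandwich) (use O in auto)
  also have "(1\<^sub>m (2 ^ n) + rot_gen) * O' * (1\<^sub>m (2 ^ n) + - rot_gen) =
      O' + ?t \<cdot>\<^sub>m (?P * O') + ((- ?t) \<cdot>\<^sub>m (O' * ?P) + ?t \<cdot>\<^sub>m ((- ?t) \<cdot>\<^sub>m (?P * O' * ?P)))"
    unfolding expand_sandwich[OF rot_gen_carrier O mQc] unfolding QOQ unfolding QO OQ ..
  finally have eq: "conj_by (rot n c d) O' = (1 / 2) \<cdot>\<^sub>m
      (O' + ?t \<cdot>\<^sub>m (?P * O') + ((- ?t) \<cdot>\<^sub>m (O' * ?P) + ?t \<cdot>\<^sub>m ((- ?t) \<cdot>\<^sub>m (?P * O' * ?P))))" .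
  have 1: "pauli_coeff n a b (?P * O') = - chi n b c * chi n c d * ?x"
    by (subst pauli_coeff_pauli_mult[OF O ab(1) cd(1)]) (simp add: anti chi_commute[of n d c])
  have 2: "pauli_coeff n a b (O' * ?P) = chi n b c * chi n c d * ?x"
    by (subst pauli_coeff_mult_pauli[OF O ab(1) cd(1)]) (simp add: chi_commute[of n d c])
  have 3: "pauli_coeff n a b (?P * O' * ?P) = - chi n c d * pauli_coeff n a b O'"
  proof -
    have "?P * O' * ?P = ?P * (O' * ?P)" by (rule assoc_mult_mat[OF pauli_carrier O pauli_carrier])
    hence "pauli_coeff n a b (?P * O' * ?P) = chi n d a * chi n d c * (chi n (b XOR d) c * chi n d c * pauli_coeff n a b O')"
      using pauli_coeff_pauli_mult[OF OP ab(1) cd(1)] pauli_coeff_mult_pauli[OF O xs cd(1)] by simp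
    thus ?thesis by (simp add: anti chi_xor_left chi_commute[of n d c] mult.left_commute)
  qed
  have "pauli_coeff n a b (conj_by (rot n c d) O') = (1 / 2) * (pauli_coeff n a b O' + ?t * pauli_coeff n a b (?P * O') +
      (- ?t * pauli_coeff n a b (O' * ?P) + ?t * (- ?t * pauli_coeff n a b (?P * O' * ?P))))"
    unfolding eq using O PO OP POP ab
    by (simp add: pauli_coeff_smult pauli_coeff_add)
  also have "\<dots> = (1 / 2) * ((1 + ?t * ?t * chi n c d) * pauli_coeff n a b O' - 2 * (?t * chi n b c * chi n c d * ?x))"
    unfolding 1 2 3 by (simp add: algebra_simps)
  also have "\<dots> = - (?t * chi n b c * chi n c d * ?x)" unfolding rot_phase_props(1) by simp
  finally show ?thesis by (simp add: norm_mult rot_phase_props(3))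
qed

end

section \<open>Products in the symplectic group\<close>

lemma USp_subset_unitary: "USp n \<subseteq> unitary_group (2 ^ n)"
  by (auto simp: USp_def)

lemma symplectic_form_carrier [simp]: "symplectic_form n \<in> carrier_mat (2 ^ n) (2 ^ n)"
proof -
  have "pauli_Y \<in> carrier_mat 2 2" by (rule carrier_matI) (simp_all add: pauli_Y_def mat_of_rows_list_def)
  thus ?thesis unfolding symplectic_form_def by (intro smult_carrier_mat kron_pow_carrier)
qed

lemma USp_mult:
  assumes "U \<in> USp n" "V \<in> USp n"
  shows "U * V \<in> USp n"
proof -
  let ?J = "symplectic_form n"
  have U: "U \<in> carrier_mat (2 ^ n) (2 ^ n)" "U * ?J * transpose_mat U = ?J"
    and V: "V \<in> carrier_mat (2 ^ n) (2 ^ n)" "V * ?J * transpose_mat V = ?J"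
    using assms by (auto simp: USp_def unitary_group_def)
  have t: "transpose_mat U \<in> carrier_mat (2 ^ n) (2 ^ n)" "transpose_mat V \<in> carrier_mat (2 ^ n) (2 ^ n)"
    using U V by simp_all
  have VJ: "V * ?J \<in> carrier_mat (2 ^ n) (2 ^ n)" using V by simp
  have "U * V * ?J * transpose_mat (U * V) = U * (V * ?J) * (transpose_mat V * transpose_mat U)"
    unfolding transpose_mult[OF U(1) V(1)] assoc_mult_mat[OF U(1) V(1) symplectic_form_carrier] ..
  also have "\<dots> = U * (V * ?J * transpose_mat V) * transpose_mat U"
    by (rule mat_mult_regroup[OF U(1) VJ t(2,1)])
  also have "\<dots> = ?J" unfolding V(2) U(2) ..
  finally show ?thesis using assms unitary_group_mult by (auto simp: USp_def)
qed

section \<open>Growth of lightcones\<close>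

lemma lightcone_subset: "S \<subseteq> lightcone S C"
proof (induction C arbitrary: S)
  case (Cons L C)
  show ?case using Cons[of "S \<union> \<Union>{supp G | G. G \<in> set L \<and> supp G \<inter> S \<noteq> {}}"] by auto
qed simp

lemma valid_circuit_Cons:
  "valid_circuit n E r (L # C) \<longleftrightarrow> (\<forall>G\<in>set L. valid_gate n E r G) \<and>
    sorted_wrt (\<lambda>G H. supp G \<inter> supp H = {}) L \<and> valid_circuit n E r C"
  by (auto simp: valid_circuit_def)

lemma lightcone_bounded:
  assumes "valid_circuit n E r C" "S \<subseteq> {..<n}"
  shows "lightcone S C \<subseteq> {..<n}"
  using assms
proof (induction C arbitrary: S)
  case (Cons L C)
  have "S \<union> \<Union>{supp G | G. G \<in> set L \<and> supp G \<inter> S \<noteq> {}} \<subseteq> {..<n}"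
    using Cons.prems by (auto simp: valid_circuit_Cons valid_gate_def)
  thus ?case using Cons by (auto simp: valid_circuit_Cons)
qed simp

lemma ensemble_depth_ge:
  assumes "C \<in> space M" "x \<le> real (length C)"
  shows "ereal x \<le> ereal_of_enat (ensemble_depth M)"
proof -
  have "enat (length C) \<le> ensemble_depth M"
    unfolding ensemble_depth_def by (rule SUP_upper) (rule assms(1))
  hence "ereal_of_enat (enat (length C)) \<le> ereal_of_enat (ensemble_depth M)"
    by (simp only: ereal_of_enat_le_iff)
  moreover have "ereal x \<le> ereal_of_enat (enat (length C))" using assms(2) by simp
  ultimately show ?thesis by (rule order_trans[rotated])
qed

text \<open>The gates of a layer are disjoint, so each qubit lies in at most one of them and pulls
  in at most \<open>r\<close> qubits.\<close>

lemma card_layer_step: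
  assumes "\<forall>G\<in>set L. valid_gate n E r G" "sorted_wrt (\<lambda>G H. supp G \<inter> supp H = {}) L" "finite S"
  shows "card (S \<union> \<Union>{supp G | G. G \<in> set L \<and> supp G \<inter> S \<noteq> {}}) \<le> (r + 1) * card S"
proof -
  define U where "U x = insert x (\<Union>{supp G | G. G \<in> set L \<and> x \<in> supp G})" for x
  have U: "finite (U x) \<and> card (U x) \<le> r + 1" for x
  proof (cases "\<exists>G\<in>set L. x \<in> supp G")
    case True
    then obtain i where i: "i < length L" "x \<in> supp (L ! i)" by (auto simp: in_set_conv_nth)
    have uniq: "G = L ! i" if G: "G \<in> set L" "x \<in> supp G" for G
    proof -
      obtain j where j: "j < length L" "L ! j = G" using G(1) unfolding in_set_conv_nth by blast
      have disj: "supp (L ! k) \<inter> supp (L ! l) = {}" if "k < l" "l < length L" for k l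
        using assms(2) that unfolding sorted_wrt_iff_nth_less by blast
      have "\<not> i < j" "\<not> j < i"
        using disj[of i j] disj[of j i] i j G(2) by blast+
      hence "i = j" by linarith
      thus ?thesis using j by blast
    qed
    have "{supp G | G. G \<in> set L \<and> x \<in> supp G} = {supp (L ! i)}"
      using uniq i(2) nth_mem[OF i(1)] by blast
    hence "U x = insert x (supp (L ! i))" by (simp add: U_def)
    moreover have "finite (supp (L ! i))" by (simp add: supp_def)
    moreover have "card (supp (L ! i)) \<le> r" using assms(1) i(1) by (simp add: valid_gate_def)
    ultimately show ?thesis by (simp add: card_insert_if)
  next
    case False
    hence "U x = {x}" by (auto simp: U_def)
    thus ?thesis by simp
  qed
  have "S \<union> \<Union>{supp G | G. G \<in> set L \<and> supp G \<inter> S \<noteq> {}} \<subseteq> (\<Union>x\<in>S. U x)"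
    by (auto simp: U_def)
  hence "card (S \<union> \<Union>{supp G | G. G \<in> set L \<and> supp G \<inter> S \<noteq> {}}) \<le> card (\<Union>x\<in>S. U x)"
    using assms(3) U by (intro card_mono) auto
  also have "\<dots> \<le> (\<Sum>x\<in>S. card (U x))" by (rule card_UN_le[OF assms(3)])
  also have "\<dots> \<le> (\<Sum>x\<in>S. r + 1)" by (intro sum_mono) (use U in blast)
  finally show ?thesis by (simp add: mult.commute)
qed

lemma card_lightcone_exponential:
  assumes "valid_circuit n E r C" "finite S"
  shows "card (lightcone S C) \<le> (r + 1) ^ length C * card S"
  using assms
proof (induction C arbitrary: S)
  case (Cons L C)
  let ?S = "S \<union> \<Union>{supp G | G. G \<in> set L \<and> supp G \<inter> S \<noteq> {}}"
  have "finite {supp G | G. G \<in> set L \<and> supp G \<inter> S \<noteq> {}}"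
    by (rule finite_subset[of _ "supp ` set L"]) auto
  hence fin: "finite ?S" using Cons.prems by (auto simp: supp_def)
  have "card (lightcone S (L # C)) \<le> (r + 1) ^ length C * card ?S"
    using Cons.IH[OF _ fin] Cons.prems by (simp add: valid_circuit_Cons)
  also have "\<dots> \<le> (r + 1) ^ length C * ((r + 1) * card S)"
    by (intro mult_left_mono card_layer_step[of L n E r S]) (use Cons.prems in \<open>auto simp: valid_circuit_Cons\<close>)
  finally show ?case by (simp add: algebra_simps)
qed simp

text \<open>The vertices at cyclic distance at most \<open>t\<close> from position \<open>a\<close>.
  Integer offsets reduced modulo \<open>n\<close> treat both directions and the wrap-around
  uniformly.\<close>

definition arc :: "nat \<Rightarrow> (nat \<Rightarrow> nat) \<Rightarrow> nat \<Rightarrow> nat \<Rightarrow> nat set" where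
  "arc n \<pi> a t = {\<pi> (nat ((int a + \<delta>) mod int n)) | \<delta>. \<bar>\<delta>\<bar> \<le> int t}"

lemma arc_step:
  assumes \<pi>: "bij_betw \<pi> {..<n} {..<n}" and E: "E \<subseteq> {{\<pi> i, \<pi> (Suc i mod n)} | i. i < n}"
    and u: "u \<in> arc n \<pi> a t" and uv: "{u, v} \<in> E"
  shows "v \<in> arc n \<pi> a (Suc t)"
proof -
  obtain i where i: "i < n" and eq: "{u, v} = {\<pi> i, \<pi> (Suc i mod n)}" using uv E by blast
  have n: "int n > 0" using i by simp
  obtain \<delta> where \<delta>: "\<bar>\<delta>\<bar> \<le> int t" "u = \<pi> (nat ((int a + \<delta>) mod int n))" using u by (auto simp: arc_def)
  let ?p = "nat ((int a + \<delta>) mod int n)"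
  have p: "?p < n" "int ?p = (int a + \<delta>) mod int n" using n by (auto simp: nat_less_iff)
  have inj: "inj_on \<pi> {..<n}" using \<pi> by (rule bij_betw_imp_inj_on)
  from eq consider "u = \<pi> i" "v = \<pi> (Suc i mod n)" | "u = \<pi> (Suc i mod n)" "v = \<pi> i"
    by (auto simp: doubleton_eq_iff)
  thus ?thesis
  proof cases
    case 1
    hence "?p = i" using inj p(1) i \<delta>(2) by (auto dest: inj_onD)
    hence "int (Suc i mod n) = (int a + (\<delta> + 1)) mod int n"
      using p(2) by (simp add: zmod_int) (metis add.assoc add.commute mod_add_left_eq)
    hence "Suc i mod n = nat ((int a + (\<delta> + 1)) mod int n)" by linarith
    thus ?thesis using 1 \<delta>(1) unfolding arc_def by (intro CollectI exI[of _ "\<delta> + 1"]) auto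
  next
    case 2
    hence "?p = Suc i mod n" using inj p(1) i \<delta>(2) by (auto dest: inj_onD)
    hence "(int i + 1) mod int n = (int a + \<delta>) mod int n"
      using p(2) by (simp add: zmod_int add.commute)
    hence "(int i + 1 - 1) mod int n = (int a + \<delta> - 1) mod int n"
      by (rule mod_diff_cong) simp
    hence "int i = (int a + (\<delta> - 1)) mod int n" using i by (simp add: add_diff_eq)
    hence "i = nat ((int a + (\<delta> - 1)) mod int n)" by linarith
    thus ?thesis using 2 \<delta>(1) unfolding arc_def by (intro CollectI exI[of _ "\<delta> - 1"]) auto
  qed
qed

text \<open>Two points of a connected set with at most \<open>r\<close> vertices are joined by a
  walk whose length is at most the number of ordered adjacent pairs, hence at most r^2. This crude
  bound enters only the constant.\<close>

lemma arc_connected: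
  assumes \<pi>: "bij_betw \<pi> {..<n} {..<n}" and E: "E \<subseteq> {{\<pi> i, \<pi> (Suc i mod n)} | i. i < n}"
    and S: "connected_in E S" "finite S" "card S \<le> r" and u: "u \<in> arc n \<pi> a t" "u \<in> S" and v: "v \<in> S"
  shows "v \<in> arc n \<pi> a (t + r * r)"
proof -
  let ?R = "{(u, v). u \<in> S \<and> v \<in> S \<and> {u, v} \<in> E}"
  have R: "?R \<subseteq> S \<times> S" by auto
  have fin: "finite ?R" by (rule finite_subset[OF R]) (use S in simp)
  have "card ?R \<le> card S * card S"
    using card_mono[OF _ R] S(2) by (simp add: card_cartesian_product)
  also have "\<dots> \<le> r * r" using S(3) by (intro mult_mono) auto
  finally have cR: "card ?R \<le> r * r" .
  have "(u, v) \<in> ?R\<^sup>*" using S(1) u(2) v by (auto simp: connected_in_def)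
  then obtain m where m: "m \<le> card ?R" "(u, v) \<in> ?R ^^ m"
    unfolding rtrancl_finite_eq_relpow[OF fin] by auto
  have "w \<in> arc n \<pi> a (t + m)" if "(u, w) \<in> ?R ^^ m" for w m
    using that
  proof (induction m arbitrary: w)
    case (Suc m)
    then obtain z where "(u, z) \<in> ?R ^^ m" "(z, w) \<in> ?R" by auto
    thus ?case using arc_step[OF \<pi> E Suc.IH[of z], of w] by simp
  qed (use u in simp)
  from this[OF m(2)] obtain \<delta> where "\<bar>\<delta>\<bar> \<le> int (t + m)" "v = \<pi> (nat ((int a + \<delta>) mod int n))"
    by (auto simp: arc_def)
  moreover have "int (t + m) \<le> int (t + r * r)" using m(1) cR by linarith
  ultimately show ?thesis unfolding arc_def by (intro CollectI exI[of _ \<delta>]) linarith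
qed

lemma arc_mono: "t \<le> t' \<Longrightarrow> arc n \<pi> a t \<subseteq> arc n \<pi> a t'"
  unfolding arc_def by force

lemma lightcone_arc:
  assumes \<pi>: "bij_betw \<pi> {..<n} {..<n}" and E: "E \<subseteq> {{\<pi> i, \<pi> (Suc i mod n)} | i. i < n}"
    and "valid_circuit n E r C" "S \<subseteq> arc n \<pi> a t"
  shows "lightcone S C \<subseteq> arc n \<pi> a (t + length C * (r * r))"
  using assms(3,4)
proof (induction C arbitrary: S t)
  case (Cons L C)
  have "S \<union> \<Union>{supp G | G. G \<in> set L \<and> supp G \<inter> S \<noteq> {}} \<subseteq> arc n \<pi> a (t + r * r)"
  proof
    fix v assume "v \<in> S \<union> \<Union>{supp G | G. G \<in> set L \<and> supp G \<inter> S \<noteq> {}}"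
    then consider "v \<in> S" | G where "G \<in> set L" "supp G \<inter> S \<noteq> {}" "v \<in> supp G" by blast
    thus "v \<in> arc n \<pi> a (t + r * r)"
    proof cases
      case 1
      thus ?thesis using Cons.prems(2) arc_mono[of t "t + r * r" n \<pi> a] by auto
    next
      case 2
      then obtain u where "u \<in> supp G" "u \<in> S" by blast
      thus ?thesis
        using 2 Cons.prems by (intro arc_connected[OF \<pi> E, of "supp G" r u a t v])
          (auto simp: valid_circuit_Cons valid_gate_def supp_def)
    qed
  qed
  hence "lightcone S (L # C) \<subseteq> arc n \<pi> a ((t + r * r) + length C * (r * r))"
    using Cons.IH[of _ "t + r * r"] Cons.prems by (simp add: valid_circuit_Cons)
  thus ?case by (simp add: algebra_simps)
qed simp

lemma arc_eq_image: "arc n \<pi> a t = (\<lambda>\<delta>. \<pi> (nat ((int a + \<delta>) mod int n))) ` {- int t..int t}"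
proof -
  have "{\<delta>. \<bar>\<delta>\<bar> \<le> int t} = {- int t..int t}" by auto
  thus ?thesis unfolding arc_def by blast
qed

lemma card_arc: "card (arc n \<pi> a t) \<le> 2 * t + 1"
proof -
  have "card (arc n \<pi> a t) \<le> card {- int t..int t}"
    unfolding arc_eq_image by (rule card_image_le) simp
  thus ?thesis by simp
qed

lemma finite_arc: "finite (arc n \<pi> a t)"
  by (simp add: arc_eq_image)

text \<open>A path edge is a cycle edge that does not wrap around, so one argument on the cycle
  covers both graphs. The lightcone stays in an arc whose radius grows by r^2 per layer.\<close>

lemma card_lightcone_one_dimensional:
  assumes E: "one_dimensional n E" and C: "valid_circuit n E r C" and q: "q < n"
  shows "card (lightcone {q} C) \<le> 2 * (length C * (r * r)) + 1"
proof -
  obtain \<pi> where \<pi>: "bij_betw \<pi> {..<n} {..<n}" and E': "E = {{\<pi> i, \<pi> (Suc i)} | i. Suc i < n} \<or>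
      3 \<le> n \<and> E = {{\<pi> i, \<pi> (Suc i mod n)} | i. i < n}"
    using E by (auto simp: one_dimensional_def)
  have "E \<subseteq> {{\<pi> i, \<pi> (Suc i mod n)} | i. i < n}"
    using E'
  proof
    assume "E = {{\<pi> i, \<pi> (Suc i)} | i. Suc i < n}"
    moreover have "\<exists>j. {\<pi> i, \<pi> (Suc i)} = {\<pi> j, \<pi> (Suc j mod n)} \<and> j < n" if "Suc i < n" for i
      using that by (intro exI[of _ i]) simp
    ultimately show ?thesis by auto
  qed auto
  moreover obtain a where a: "a < n" "\<pi> a = q" using \<pi> q by (metis bij_betw_imp_surj_on imageE lessThan_iff)
  moreover have "{q} \<subseteq> arc n \<pi> a 0" using a by (auto simp: arc_def)
  ultimately have "lightcone {q} C \<subseteq> arc n \<pi> a (0 + length C * (r * r))"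
    using lightcone_arc[OF \<pi> _ C] by blast
  hence "card (lightcone {q} C) \<le> card (arc n \<pi> a (length C * (r * r)))"
    by (intro card_mono finite_arc) simp
  thus ?thesis using card_arc[of n \<pi> a] order_trans by blast
qed

section \<open>The lightcone of a symplectic design\<close>

lemma kron_pow_Suc_Suc_index:
  assumes U: "U \<in> carrier_mat N N" and ij: "i < N * N * N ^ k" "j < N * N * N ^ k"
  shows "kron_pow (Suc (Suc k)) U $$ (i, j) =
    U $$ (i div N ^ k div N, j div N ^ k div N) * U $$ (i div N ^ k mod N, j div N ^ k mod N) *
    kron_pow k U $$ (i mod N ^ k, j mod N ^ k)"
proof -
  let ?K = "N ^ k"
  have split: "x div (N * ?K) = x div ?K div N" "x mod (N * ?K) div ?K = x div ?K mod N"
    "x mod (N * ?K) mod ?K = x mod ?K" "x mod (N * ?K) < N * ?K"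
    if "x < N * N * ?K" for x
  proof -
    have pos: "?K > 0" "N > 0" using that by (auto intro!: Nat.gr0I)
    show "x div (N * ?K) = x div ?K div N" by (simp add: mult.commute[of N] div_mult2_eq)
    have e: "x mod (N * ?K) = ?K * (x div ?K mod N) + x mod ?K"
      by (simp add: mult.commute[of N] mod_mult2_eq)
    show "x mod (N * ?K) div ?K = x div ?K mod N" unfolding e using pos by simp
    show "x mod (N * ?K) mod ?K = x mod ?K" unfolding e by simp
    show "x mod (N * ?K) < N * ?K" using pos by simp
  qed
  have "kron_pow (Suc (Suc k)) U $$ (i, j) =
      U $$ (i div (N * ?K), j div (N * ?K)) * kron_pow (Suc k) U $$ (i mod (N * ?K), j mod (N * ?K))"
    using kron_pow_Suc_index[OF U, of i "Suc k" j] ij by (simp only: power_Suc mult.assoc)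
  also have "kron_pow (Suc k) U $$ (i mod (N * ?K), j mod (N * ?K)) =
      U $$ (i div ?K mod N, j div ?K mod N) * kron_pow k U $$ (i mod ?K, j mod ?K)"
    using kron_pow_Suc_index[OF U split(4)[OF ij(1)] split(4)[OF ij(2)]] split(2,3) ij by simp
  finally show ?thesis using split(1) ij by (simp add: mult.assoc)
qed

lemma sum_three_registers:
  fixes f :: "nat \<Rightarrow> nat \<Rightarrow> nat \<Rightarrow> 'a :: comm_monoid_add"
  shows "(\<Sum>i<N * N * K. f (i div K div N) (i div K mod N) (i mod K)) = (\<Sum>x<N. \<Sum>y<N. \<Sum>r<K. f x y r)"
proof -
  have "(\<Sum>i<N * N * K. f (i div K div N) (i div K mod N) (i mod K)) =
      (\<Sum>z<N * N. \<Sum>r<K. f (z div N) (z mod N) r)"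
    unfolding sum_divmod by (intro sum.cong refl) auto
  also have "\<dots> = (\<Sum>x<N. \<Sum>y<N. \<Sum>r<K. f x y r)"
    unfolding sum_divmod[of "\<lambda>z. \<Sum>r<K. f (z div N) (z mod N) r"] by (intro sum.cong refl) auto
  finally show ?thesis .
qed

text \<open>The normalised vectorisation of \<open>P J\<close> for a Pauli operator \<open>P\<close> on the first two copies,
  tensored with the \<open>r\<close>-th basis vector on the other \<open>k\<close> copies.\<close>

definition pauli_vec :: "nat \<Rightarrow> nat \<Rightarrow> nat \<Rightarrow> nat \<Rightarrow> nat \<Rightarrow> nat \<Rightarrow> complex" where
  "pauli_vec n k a b r i = (pauli n a b * symplectic_form n) $$
     (i div (2 ^ n) ^ k div 2 ^ n, i div (2 ^ n) ^ k mod 2 ^ n) / of_real (sqrt (2 ^ n)) *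
     of_bool (i mod (2 ^ n) ^ k = r)"

lemma power_Suc_Suc_assoc: "(N :: nat) ^ Suc (Suc k) = N * N * N ^ k"
  by (simp add: mult.assoc)

lemma mult_symplectic_form_index:
  assumes n: "odd n" and Z: "Z \<in> carrier_mat (2 ^ n) (2 ^ n)" and ij: "i < 2 ^ n" "j < 2 ^ n"
  shows "(Z * symplectic_form n) $$ (i, j) = - (Z $$ (i, j XOR (2 ^ n - 1)) * chi n (2 ^ n - 1) j)"
proof -
  define m :: nat where "m = 2 ^ n - 1"
  have m: "m < 2 ^ n" by (simp add: m_def)
  have "Z * symplectic_form n = - (Z * pauli n m m)"
    unfolding symplectic_form_eq_pauli[OF n] m_def
    by (rule uminus_mult_right_mat) (use carrier_matD[OF Z] in simp)
  moreover have "(- (Z * pauli n m m)) $$ (i, j) = - ((Z * pauli n m m) $$ (i, j))"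
    by (rule index_uminus_mat) (use carrier_matD[OF Z] ij in simp_all)
  moreover have "(Z * pauli n m m) $$ (i, j) = Z $$ (i, j XOR m) * chi n m j"
    by (rule pauli_mult_right_index[OF Z ij m])
  ultimately show ?thesis by (simp only: m_def)
qed

text \<open>Right multiplication by J permutes columns up to sign, so J drops out of the inner
  product and tr(P^dagger Z) / 2^n remains. The function \<kappa> is the amplitude on the remaining
  copies: an indicator yields orthonormality, a column of the tensor power yields the
  overlap.\<close>

lemma pauli_vec_pairing:
  assumes n: "odd n" and Z: "Z \<in> carrier_mat (2 ^ n) (2 ^ n)" and a: "a < 2 ^ n" and r: "r < (2 ^ n) ^ k"
  shows "(\<Sum>i<(2 ^ n) ^ Suc (Suc k). cnj (pauli_vec n k a b r i) *
      ((Z * symplectic_form n) $$ (i div (2 ^ n) ^ k div 2 ^ n, i div (2 ^ n) ^ k mod 2 ^ n) / of_real (sqrt (2 ^ n)) *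
       \<kappa> (i mod (2 ^ n) ^ k))) = pauli_coeff n a b Z * \<kappa> r"
proof -
  let ?N = "2 ^ n :: nat" and ?J = "symplectic_form n" and ?s = "complex_of_real (sqrt (2 ^ n))"
  let ?K = "?N ^ k"
  define m :: nat where "m = 2 ^ n - 1"
  have m: "m < 2 ^ n" by (simp add: m_def)
  have s: "?s * ?s = 2 ^ n" by (simp flip: of_real_mult)
  define g where "g x y = cnj ((pauli n a b * ?J) $$ (x, y)) * (Z * ?J) $$ (x, y)" for x y
  have g: "g x y = cnj (pauli n a b $$ (x, y XOR m)) * Z $$ (x, y XOR m)" if "x < ?N" "y < ?N" for x y
    unfolding g_def mult_symplectic_form_index[OF n Z that] mult_symplectic_form_index[OF n pauli_carrier that] m_def[symmetric]
    by (simp add: mult.left_commute mult.commute del: pauli_index)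
  have "(\<Sum>i<?N ^ Suc (Suc k). cnj (pauli_vec n k a b r i) *
      ((Z * ?J) $$ (i div ?K div ?N, i div ?K mod ?N) / ?s * \<kappa> (i mod ?K))) =
      (\<Sum>i<?N * ?N * ?K. g (i div ?K div ?N) (i div ?K mod ?N) / 2 ^ n * (of_bool (i mod ?K = r) * \<kappa> (i mod ?K)))"
    unfolding power_Suc_Suc_assoc
    by (intro sum.cong refl) (simp add: pauli_vec_def g_def s[symmetric] del: index_mult_mat)
  also have "\<dots> = (\<Sum>x<?N. \<Sum>y<?N. \<Sum>r'<?K. g x y / 2 ^ n * (of_bool (r' = r) * \<kappa> r'))"
    by (rule sum_three_registers)
  also have "\<dots> = (\<Sum>x<?N. \<Sum>y<?N. g x y / 2 ^ n * \<kappa> r)"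
  proof (intro sum.cong refl)
    fix x y
    have "(\<Sum>r'<?K. g x y / 2 ^ n * (of_bool (r' = r) * \<kappa> r')) = (\<Sum>r'<?K. if r' = r then g x y / 2 ^ n * \<kappa> r' else 0)"
      by (intro sum.cong refl) auto
    thus "(\<Sum>r'<?K. g x y / 2 ^ n * (of_bool (r' = r) * \<kappa> r')) = g x y / 2 ^ n * \<kappa> r" using r by simp
  qed
  also have "\<dots> = (\<Sum>x<?N. \<Sum>y<?N. g x y) / 2 ^ n * \<kappa> r"
    by (simp add: sum_distrib_right sum_divide_distrib)
  also have "(\<Sum>x<?N. \<Sum>y<?N. g x y) = (\<Sum>x<?N. \<Sum>y<?N. cnj (pauli n a b $$ (x, y XOR m)) * Z $$ (x, y XOR m))"
    by (intro sum.cong refl g) auto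
  also have "\<dots> = (\<Sum>x<?N. \<Sum>y<?N. cnj (pauli n a b $$ (x, y)) * Z $$ (x, y))"
    by (intro sum.cong refl sum_xor[OF m])
  also have "\<dots> = (\<Sum>y<?N. \<Sum>x<?N. cnj (pauli n a b $$ (x, y)) * Z $$ (x, y))"
    by (rule sum.swap)
  also have "\<dots> = (\<Sum>y<?N. chi n b y * Z $$ (y XOR a, y))"
  proof (intro sum.cong refl)
    fix y assume "y \<in> {..<?N}"
    hence y: "y < ?N" by simp
    have "(\<Sum>x<?N. cnj (pauli n a b $$ (x, y)) * Z $$ (x, y)) =
        (\<Sum>x<?N. if x = y XOR a then chi n b y * Z $$ (x, y) else 0)"
      by (intro sum.cong refl) (use y in auto)
    thus "(\<Sum>x<?N. cnj (pauli n a b $$ (x, y)) * Z $$ (x, y)) = chi n b y * Z $$ (y XOR a, y)"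
      using xor_less_power2[OF y a] by simp
  qed
  finally show ?thesis by (simp add: pauli_coeff_def)
qed

lemma pauli_coeff_pauli:
  assumes "a < 2 ^ n" "b < 2 ^ n" "c < 2 ^ n" "d < 2 ^ n"
  shows "pauli_coeff n a b (pauli n c d) = of_bool ((a, b) = (c, d))"
proof (cases "a = c")
  case True
  have "(\<Sum>j<2 ^ n. chi n b j * pauli n c d $$ (j XOR a, j)) = (\<Sum>j<2 ^ n. chi n (b XOR d) j)"
    by (intro sum.cong refl) (use assms True xor_less_power2 in \<open>simp add: chi_xor_left\<close>)
  also have "\<dots> = 2 ^ n * of_bool (b = d)"
    using sum_chi[OF xor_less_power2[OF assms(2,4)]] by simp
  finally show ?thesis using True by (simp add: pauli_coeff_def)
next
  case False
  have "chi n b j * pauli n c d $$ (j XOR a, j) = 0" if "j < 2 ^ n" for j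
  proof -
    have "j XOR a \<noteq> j XOR c" using False by (metis xor_cancel(2))
    thus ?thesis using that assms xor_less_power2[OF that assms(1)] by simp
  qed
  hence "(\<Sum>j<2 ^ n. chi n b j * pauli n c d $$ (j XOR a, j)) = 0"
    by (intro sum.neutral) blast
  thus ?thesis using False by (simp add: pauli_coeff_def)
qed

lemma orthonormal_pauli_vec:
  assumes n: "odd n" and S: "S \<subseteq> {((a, b), r). a < 2 ^ n \<and> b < 2 ^ n \<and> r < (2 ^ n) ^ k}"
  shows "orthonormal_on ((2 ^ n) ^ Suc (Suc k)) S (\<lambda>((a, b), r). pauli_vec n k a b r)"
  unfolding orthonormal_on_def
proof (intro ballI)
  fix x y assume x: "x \<in> S" and y: "y \<in> S"
  obtain a b r c d s where xy: "x = ((a, b), r)" "y = ((c, d), s)" by (metis surj_pair)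
  have lt: "a < 2 ^ n" "b < 2 ^ n" "r < (2 ^ n) ^ k" "c < 2 ^ n" "d < 2 ^ n" "s < (2 ^ n) ^ k"
    using S x y xy by auto
  have "(\<Sum>i<(2 ^ n) ^ Suc (Suc k). cnj (pauli_vec n k a b r i) * pauli_vec n k c d s i) =
      pauli_coeff n a b (pauli n c d) * of_bool (r = s)"
    unfolding pauli_vec_def[of n k c d s]
    by (rule pauli_vec_pairing[OF n pauli_carrier lt(1,3), where \<kappa> = "\<lambda>t. of_bool (t = s)"])
  also have "\<dots> = of_bool (x = y)"
    unfolding pauli_coeff_pauli[OF lt(1,2,4,5)] by (auto simp: xy)
  finally show "(\<Sum>i<(2 ^ n) ^ Suc (Suc k). cnj ((\<lambda>((a, b), r). pauli_vec n k a b r) x i) *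
      (\<lambda>((a, b), r). pauli_vec n k a b r) y i) = of_bool (x = y)"
    by (simp only: xy prod.case)
qed

text \<open>A symplectic unitary satisfies \<open>J U\<^sup>T = U\<^sup>\<dagger> J\<close>, so \<open>U \<otimes> U\<close> acts on the vectorisation of
  \<open>P J\<close> by conjugating \<open>P\<close>.\<close>

lemma USp_sandwich:
  assumes U: "U \<in> USp n" and P: "P \<in> carrier_mat (2 ^ n) (2 ^ n)"
  shows "U * (P * symplectic_form n) * transpose_mat U = conj_by U P * symplectic_form n"
proof -
  let ?J = "symplectic_form n"
  note J = symplectic_form_carrier[of n]
  have Uu: "U \<in> unitary_group (2 ^ n)" and e: "U * ?J * transpose_mat U = ?J"
    using U by (auto simp: USp_def)
  note Ud = unitary_groupD[OF Uu]
  have T: "transpose_mat U \<in> carrier_mat (2 ^ n) (2 ^ n)" using Ud(1) by simp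
  have JT: "?J * transpose_mat U \<in> carrier_mat (2 ^ n) (2 ^ n)" by (rule mult_carrier_mat[OF J T])
  have UP: "U * P \<in> carrier_mat (2 ^ n) (2 ^ n)" by (rule mult_carrier_mat[OF Ud(1) P])
  have "mat_adjoint U * ?J = mat_adjoint U * (U * (?J * transpose_mat U))"
    using e unfolding assoc_mult_mat[OF Ud(1) J T] by simp
  also have "\<dots> = mat_adjoint U * U * (?J * transpose_mat U)"
    by (rule assoc_mult_mat[symmetric, OF Ud(4,1) JT])
  also have "\<dots> = ?J * transpose_mat U" unfolding Ud(3) by (rule left_mult_one_mat[OF JT])
  finally have UJ: "mat_adjoint U * ?J = ?J * transpose_mat U" .
  have "U * (P * ?J) * transpose_mat U = U * P * ?J * transpose_mat U"
    unfolding assoc_mult_mat[OF Ud(1) P J] ..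
  also have "\<dots> = U * P * (?J * transpose_mat U)" by (rule assoc_mult_mat[OF UP J T])
  also have "\<dots> = U * P * mat_adjoint U * ?J"
    unfolding UJ[symmetric] by (rule assoc_mult_mat[symmetric, OF UP Ud(4) J])
  finally show ?thesis unfolding conj_by_def .
qed

text \<open>On vectorised matrices two copies of U act by sending X to U X U^T, which the symplectic
  condition rewrites as conjugation of the Pauli operator. The remaining copies start in basis
  vector 0 and so contribute column 0 of their tensor power.\<close>

lemma moved_pauli_vec:
  assumes U: "U \<in> USp n" and i: "i < (2 ^ n) ^ Suc (Suc k)"
  shows "moved (2 ^ n) (Suc (Suc k)) (pauli_vec n k a b 0) U i =
    (conj_by U (pauli n a b) * symplectic_form n) $$ (i div (2 ^ n) ^ k div 2 ^ n, i div (2 ^ n) ^ k mod 2 ^ n) /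
      of_real (sqrt (2 ^ n)) * kron_pow k U $$ (i mod (2 ^ n) ^ k, 0)"
proof -
  let ?N = "2 ^ n :: nat" and ?J = "symplectic_form n" and ?s = "complex_of_real (sqrt (2 ^ n))"
  let ?K = "?N ^ k"
  define PJ where "PJ = pauli n a b * ?J"
  have PJ: "PJ \<in> carrier_mat ?N ?N" unfolding PJ_def by (rule mult_carrier_mat[OF pauli_carrier symplectic_form_carrier])
  have Uc: "U \<in> carrier_mat ?N ?N" using U unitary_groupD(1) by (auto simp: USp_def)
  define x y r where "x = i div ?K div ?N" and "y = i div ?K mod ?N" and "r = i mod ?K"
  have i': "i < ?N * ?N * ?K" using i by (simp only: power_Suc_Suc_assoc)
  have xy: "x < ?N" "y < ?N"
    using div_mod_less[OF i'] div_mod_less[of "i div ?K" ?N ?N] by (auto simp: x_def y_def)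
  have "moved ?N (Suc (Suc k)) (pauli_vec n k a b 0) U i =
      (\<Sum>j<?N * ?N * ?K. (U $$ (x, j div ?K div ?N) * PJ $$ (j div ?K div ?N, j div ?K mod ?N) * U $$ (y, j div ?K mod ?N)) / ?s *
        (kron_pow k U $$ (r, j mod ?K) * of_bool (j mod ?K = 0)))"
    unfolding moved_def power_Suc_Suc_assoc
    by (intro sum.cong refl)
      (simp add: kron_pow_Suc_Suc_index[OF Uc i'] pauli_vec_def PJ_def x_def y_def r_def
        del: index_mult_mat kron_pow.simps)
  also have "\<dots> = (\<Sum>x'<?N. \<Sum>y'<?N. \<Sum>s<?K. (U $$ (x, x') * PJ $$ (x', y') * U $$ (y, y')) / ?s *
        (kron_pow k U $$ (r, s) * of_bool (s = 0)))"
    by (rule sum_three_registers)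
  also have "\<dots> = (\<Sum>x'<?N. \<Sum>y'<?N. (U $$ (x, x') * PJ $$ (x', y') * U $$ (y, y')) / ?s * kron_pow k U $$ (r, 0))"
  proof (intro sum.cong refl)
    fix x' y'
    let ?g = "(U $$ (x, x') * PJ $$ (x', y') * U $$ (y, y')) / ?s"
    have "(\<Sum>s<?K. ?g * (kron_pow k U $$ (r, s) * of_bool (s = 0))) =
        (\<Sum>s<?K. if s = 0 then ?g * kron_pow k U $$ (r, s) else 0)"
      by (intro sum.cong refl) auto
    thus "(\<Sum>s<?K. ?g * (kron_pow k U $$ (r, s) * of_bool (s = 0))) = ?g * kron_pow k U $$ (r, 0)"
      by simp
  qed
  also have "\<dots> = (\<Sum>y'<?N. \<Sum>x'<?N. U $$ (x, x') * PJ $$ (x', y') * U $$ (y, y')) / ?s * kron_pow k U $$ (r, 0)"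
    by (subst sum.swap) (simp add: sum_distrib_right sum_divide_distrib)
  also have "(\<Sum>y'<?N. \<Sum>x'<?N. U $$ (x, x') * PJ $$ (x', y') * U $$ (y, y')) = (U * PJ * transpose_mat U) $$ (x, y)"
  proof -
    have UPJ: "U * PJ \<in> carrier_mat ?N ?N" by (rule mult_carrier_mat[OF Uc PJ])
    have "(U * PJ * transpose_mat U) $$ (x, y) = (\<Sum>y'<?N. (U * PJ) $$ (x, y') * transpose_mat U $$ (y', y))"
      by (rule mat_mult_index[OF UPJ _ xy]) (use Uc in simp)
    also have "\<dots> = (\<Sum>y'<?N. (\<Sum>x'<?N. U $$ (x, x') * PJ $$ (x', y')) * U $$ (y, y'))"
      by (intro sum.cong refl arg_cong2[of _ _ _ _ "(*)"] mat_mult_index[OF Uc PJ])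
        (use xy carrier_matD[OF Uc] in auto)
    finally show ?thesis by (simp add: sum_distrib_right)
  qed
  also have "U * PJ * transpose_mat U = conj_by U (pauli n a b) * ?J"
    unfolding PJ_def by (rule USp_sandwich[OF U pauli_carrier])
  finally show ?thesis by (simp only: x_def y_def r_def)
qed

lemma overlap_pauli_vec:
  assumes n: "odd n" and U: "U \<in> USp n" and a: "a < 2 ^ n" and r: "r < (2 ^ n) ^ k"
  shows "overlap (2 ^ n) (Suc (Suc k)) (pauli_vec n k a b r) (pauli_vec n k c d 0) U =
    pauli_coeff n a b (conj_by U (pauli n c d)) * kron_pow k U $$ (r, 0)"
proof -
  have Uc: "U \<in> carrier_mat (2 ^ n) (2 ^ n)" using U unitary_groupD(1) by (auto simp: USp_def)
  have Z: "conj_by U (pauli n c d) \<in> carrier_mat (2 ^ n) (2 ^ n)"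
    unfolding conj_by_def by (intro mult_carrier_mat[of _ "2 ^ n" "2 ^ n"] mat_adjoint_carrier Uc pauli_carrier)
  have "overlap (2 ^ n) (Suc (Suc k)) (pauli_vec n k a b r) (pauli_vec n k c d 0) U =
      (\<Sum>i<(2 ^ n) ^ Suc (Suc k). cnj (pauli_vec n k a b r i) *
      ((conj_by U (pauli n c d) * symplectic_form n) $$ (i div (2 ^ n) ^ k div 2 ^ n, i div (2 ^ n) ^ k mod 2 ^ n) /
        of_real (sqrt (2 ^ n)) * kron_pow k U $$ (i mod (2 ^ n) ^ k, 0)))"
    unfolding overlap_def
    by (intro sum.cong refl arg_cong2[of _ _ _ _ "(*)"] moved_pauli_vec[OF U]) simp
  also have "\<dots> = pauli_coeff n a b (conj_by U (pauli n c d)) * kron_pow k U $$ (r, 0)"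
    by (rule pauli_vec_pairing[OF n Z a r, where \<kappa> = "\<lambda>t. kron_pow k U $$ (t, 0)"])
  finally show ?thesis .
qed

text \<open>Used to sum out the copies beyond the first two: the probabilities of their outcomes add
  up to 1.\<close>

lemma kron_pow_first_column:
  assumes U: "U \<in> unitary_group N" and N: "0 < N"
  shows "(\<Sum>r<N ^ k. (cmod (kron_pow k U $$ (r, 0)))\<^sup>2) = 1"
proof (induction k)
  case (Suc k)
  note Uc = unitary_groupD(1)[OF U]
  have col: "(\<Sum>x<N. (cmod (U $$ (x, 0)))\<^sup>2) = 1"
  proof -
    have "complex_of_real (\<Sum>x<N. (cmod (U $$ (x, 0)))\<^sup>2) = (\<Sum>x<N. cnj (U $$ (x, 0)) * U $$ (x, 0))"
      by (simp only: of_real_sum complex_norm_square mult.commute)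
    also have "\<dots> = 1" using unitary_columns[OF U N N] by simp
    finally show ?thesis by (simp only: of_real_eq_1_iff)
  qed
  have "(\<Sum>r<N ^ Suc k. (cmod (kron_pow (Suc k) U $$ (r, 0)))\<^sup>2) =
      (\<Sum>r<N * N ^ k. (cmod (U $$ (r div N ^ k, 0)))\<^sup>2 * (cmod (kron_pow k U $$ (r mod N ^ k, 0)))\<^sup>2)"
    unfolding power_Suc
    by (intro sum.cong refl)
      (use N in \<open>simp add: kron_pow_Suc_index[OF Uc] norm_mult power_mult_distrib del: kron_pow.simps\<close>)
  also have "\<dots> = (\<Sum>x<N. \<Sum>r<N ^ k. (cmod (U $$ (x, 0)))\<^sup>2 * (cmod (kron_pow k U $$ (r, 0)))\<^sup>2)"
    unfolding sum_divmod by (intro sum.cong refl) auto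
  also have "\<dots> = 1" unfolding sum_distrib_left[symmetric] Suc by (simp add: col)
  finally show ?case .
qed simp

lemma sum_overlap_pauli_vec:
  assumes n: "odd n" and U: "U \<in> USp n" and a: "a < 2 ^ n"
  shows "(\<Sum>r<(2 ^ n) ^ k. (cmod (overlap (2 ^ n) (Suc (Suc k)) (pauli_vec n k a b r) (pauli_vec n k c d 0) U))\<^sup>2) =
    (cmod (pauli_coeff n a b (conj_by U (pauli n c d))))\<^sup>2"
proof -
  have Uu: "U \<in> unitary_group (2 ^ n)" using U by (auto simp: USp_def)
  have "(\<Sum>r<(2 ^ n) ^ k. (cmod (overlap (2 ^ n) (Suc (Suc k)) (pauli_vec n k a b r) (pauli_vec n k c d 0) U))\<^sup>2) =
      (\<Sum>r<(2 ^ n) ^ k. (cmod (pauli_coeff n a b (conj_by U (pauli n c d))))\<^sup>2 * (cmod (kron_pow k U $$ (r, 0)))\<^sup>2)"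
    by (intro sum.cong refl) (simp add: overlap_pauli_vec[OF n U a] norm_mult power_mult_distrib)
  also have "\<dots> = (cmod (pauli_coeff n a b (conj_by U (pauli n c d))))\<^sup>2"
    unfolding sum_distrib_left[symmetric] kron_pow_first_column[OF Uu zero_less_power[OF zero_less_numeral]] by simp
  finally show ?thesis .
qed

section \<open>Haar averages of Pauli weights\<close>

lemma mat_borel_measurableI:
  assumes "\<And>x. x \<in> space M \<Longrightarrow> f x \<in> carrier_mat N N"
    and "\<And>i j. i < N \<Longrightarrow> j < N \<Longrightarrow> (\<lambda>x. f x $$ (i, j)) \<in> borel_measurable M"
  shows "f \<in> M \<rightarrow>\<^sub>M mat_borel N"
  unfolding mat_borel_def
proof (rule measurable_measure_of)
  fix y :: "complex mat set"
  assume "y \<in> {{A \<in> carrier_mat N N. A $$ (i, j) \<in> B} | i j B. i < N \<and> j < N \<and> B \<in> sets borel}"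
  then obtain i j B where y: "y = {A \<in> carrier_mat N N. A $$ (i, j) \<in> B}" "i < N" "j < N" "B \<in> sets borel"
    by blast
  have "f -` y \<inter> space M = (\<lambda>x. f x $$ (i, j)) -` B \<inter> space M" using assms(1) y(1) by auto
  thus "f -` y \<inter> space M \<in> sets M"
    using measurable_sets[OF assms(2)[OF y(2,3)] y(4)] by simp
qed (use assms(1) in auto)

text \<open>The invariance clause of \<open>haar_measure\<close> concerns an image measure. Turning
  it into a statement on integrals requires that left multiplication is measurable, which holds
  because its entries are linear in those of U.\<close>

lemma haar_left_invariant_integral:
  fixes F :: "complex mat \<Rightarrow> real"
  assumes \<mu>: "haar_measure N G \<mu>" and G: "G \<subseteq> carrier_mat N N" and V: "V \<in> G"
    and closed: "\<And>U. U \<in> G \<Longrightarrow> V * U \<in> G" and F: "F \<in> borel_measurable \<mu>"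
  shows "(\<integral>U. F (V * U) \<partial>\<mu>) = (\<integral>U. F U \<partial>\<mu>)"
proof -
  have sp: "space \<mu> = G" and st: "sets \<mu> = sets (restrict_space (mat_borel N) G)"
    and inv: "distr \<mu> \<mu> (\<lambda>U. V * U) = \<mu>"
    using \<mu> V by (auto simp: haar_measure_def)
  have Vc: "V \<in> carrier_mat N N" using G V by blast
  have ent: "(\<lambda>U. U $$ (i, j)) \<in> borel_measurable \<mu>" if "i < N" "j < N" for i j
    using measurable_restrict_space1[OF mat_entry_measurable[OF that], of G] measurable_cong_sets[OF st refl]
    by blast
  have "(\<lambda>U. V * U) \<in> \<mu> \<rightarrow>\<^sub>M mat_borel N"
  proof (rule mat_borel_measurableI)
    fix U assume "U \<in> space \<mu>"
    thus "V * U \<in> carrier_mat N N" using closed G sp by blast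
  next
    fix i j assume ij: "i < N" "j < N"
    have "(\<lambda>U. \<Sum>k<N. V $$ (i, k) * U $$ (k, j)) \<in> borel_measurable \<mu>"
      by (intro borel_measurable_sum borel_measurable_times borel_measurable_const ent) (use ij in auto)
    moreover have "(V * U) $$ (i, j) = (\<Sum>k<N. V $$ (i, k) * U $$ (k, j))" if "U \<in> space \<mu>" for U
      by (rule mat_mult_index[OF Vc _ ij]) (use that sp G in blast)
    ultimately show "(\<lambda>U. (V * U) $$ (i, j)) \<in> borel_measurable \<mu>"
      by (simp cong: measurable_cong)
  qed
  hence "(\<lambda>U. V * U) \<in> \<mu> \<rightarrow>\<^sub>M restrict_space (mat_borel N) G"
    by (intro measurable_restrict_space2) (use closed sp in auto)
  hence m: "(\<lambda>U. V * U) \<in> \<mu> \<rightarrow>\<^sub>M \<mu>" using measurable_cong_sets[OF refl st] by blast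
  have "(\<integral>U. F U \<partial>\<mu>) = (\<integral>U. F U \<partial>distr \<mu> \<mu> (\<lambda>U. V * U))" unfolding inv ..
  also have "\<dots> = (\<integral>U. F (V * U) \<partial>\<mu>)" by (rule integral_distr[OF m F])
  finally show ?thesis ..
qed

lemma conj_by_unitary:
  assumes "U \<in> unitary_group N" "A \<in> unitary_group N"
  shows "conj_by U A \<in> unitary_group N"
  unfolding conj_by_def using assms by (intro unitary_group_mult unitary_group_adjoint)

lemma pauli_unitary:
  assumes "a < 2 ^ n"
  shows "pauli n a b \<in> unitary_group (2 ^ n)"
proof -
  have sq: "chi n a b \<cdot>\<^sub>m (pauli n a b * pauli n a b) = 1\<^sub>m (2 ^ n)"
    unfolding pauli_square[OF assms] smult_smult_matrix by (rule eq_matI) auto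
  have "pauli n a b * mat_adjoint (pauli n a b) = 1\<^sub>m (2 ^ n)"
    unfolding mat_adjoint_pauli[OF assms] mult_smult_distrib[OF pauli_carrier pauli_carrier] by (rule sq)
  moreover have "mat_adjoint (pauli n a b) * pauli n a b = 1\<^sub>m (2 ^ n)"
    unfolding mat_adjoint_pauli[OF assms] mult_smult_assoc_mat[OF pauli_carrier pauli_carrier] by (rule sq)
  ultimately show ?thesis by (simp add: unitary_group_def)
qed

text \<open>The coefficient at the identity string is the normalised trace, which conjugation
  preserves and which vanishes for Z on one qubit.\<close>

lemma pauli_coeff_identity_conj:
  assumes U: "U \<in> unitary_group (2 ^ n)" and q: "q < n"
  shows "pauli_coeff n 0 0 (conj_by U (pauli n 0 (2 ^ q))) = 0"
proof -
  let ?N = "2 ^ n :: nat"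
  note Ud = unitary_groupD[OF U]
  let ?P = "pauli n 0 (2 ^ q)"
  have UP: "U * ?P \<in> carrier_mat ?N ?N" by (rule mult_carrier_mat[OF Ud(1) pauli_carrier])
  have "(\<Sum>j<?N. conj_by U ?P $$ (j, j)) = (\<Sum>j<?N. \<Sum>k<?N. chi n (2 ^ q) k * (cnj (U $$ (j, k)) * U $$ (j, k)))"
  proof (rule sum.cong[OF refl])
    fix j assume "j \<in> {..<?N}"
    hence j: "j < ?N" by simp
    have "conj_by U ?P $$ (j, j) = (\<Sum>k<?N. (U * ?P) $$ (j, k) * mat_adjoint U $$ (k, j))"
      unfolding conj_by_def by (rule mat_mult_index[OF UP Ud(4) j j])
    also have "\<dots> = (\<Sum>k<?N. chi n (2 ^ q) k * (cnj (U $$ (j, k)) * U $$ (j, k)))"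
    proof (rule sum.cong[OF refl])
      fix k assume "k \<in> {..<?N}"
      hence k: "k < ?N" by simp
      have "(U * ?P) $$ (j, k) = U $$ (j, k XOR 0) * chi n (2 ^ q) k"
        by (rule pauli_mult_right_index[OF Ud(1) j k]) simp
      thus "(U * ?P) $$ (j, k) * mat_adjoint U $$ (k, j) = chi n (2 ^ q) k * (cnj (U $$ (j, k)) * U $$ (j, k))"
        using j k carrier_matD[OF Ud(1)] by (simp del: index_mult_mat)
    qed
    finally show "conj_by U ?P $$ (j, j) = (\<Sum>k<?N. chi n (2 ^ q) k * (cnj (U $$ (j, k)) * U $$ (j, k)))" .
  qed
  also have "\<dots> = (\<Sum>k<?N. chi n (2 ^ q) k * (\<Sum>j<?N. cnj (U $$ (j, k)) * U $$ (j, k)))"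
    unfolding sum_distrib_left by (rule sum.swap)
  also have "\<dots> = (\<Sum>k<?N. chi n (2 ^ q) k)"
    by (intro sum.cong refl) (use unitary_columns[OF U] in simp)
  also have "\<dots> = 0" using sum_chi[of "2 ^ q" n] q by simp
  finally show ?thesis by (simp add: pauli_coeff_def)
qed

text \<open>The mean squared coefficients form a distribution on strings. Replacing U by V U with V
  a rotation shows its invariance, and it vanishes at the identity string, so the counting bound for
  low-weight strings applies.\<close>

lemma haar_low_weight_bound:
  assumes n: "odd n" "3 \<le> n" and q: "q < n" and \<mu>: "haar_measure (2 ^ n) (USp n) \<mu>"
  shows "(\<Sum>(a, b)\<in>low_weight n. \<integral>U. (cmod (pauli_coeff n a b (conj_by U (pauli n 0 (2 ^ q)))))\<^sup>2 \<partial>\<mu>) \<le> 2 / 3"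
proof -
  let ?N = "2 ^ n :: nat" and ?P = "pauli n 0 (2 ^ q)"
  have sp: "space \<mu> = USp n" and "prob_space \<mu>" using \<mu> by (auto simp: haar_measure_def)
  interpret prob_space \<mu> by fact
  have r\<mu>: "random_unitary ?N \<mu>" by (rule random_unitary_haar[OF \<mu> USp_subset_unitary])
  define F where "F a b U = (cmod (pauli_coeff n a b (conj_by U ?P)))\<^sup>2" for a b U
  define h where "h a b = (if a < 2 ^ n \<and> b < 2 ^ n then \<integral>U. F a b U \<partial>\<mu> else 0)" for a b
  \<comment> \<open>The instance with no further copies: the squared coefficient is then a single
    squared overlap, hence integrable.\<close>
  have int: "integrable \<mu> (F a b)" if "a < 2 ^ n" for a b
  proof -
    have "integrable \<mu> (\<lambda>U. \<Sum>r<?N ^ 0. (cmod (overlap ?N (Suc (Suc 0)) (pauli_vec n 0 a b r) (pauli_vec n 0 0 (2 ^ q) 0) U))\<^sup>2)"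
      by (intro Bochner_Integration.integrable_sum overlap_square_integrable[OF r\<mu>])
    thus ?thesis
      by (rule Bochner_Integration.integrable_cong[OF refl, THEN iffD1, rotated])
        (use sp that in \<open>simp only: sum_overlap_pauli_vec[OF n(1)] F_def\<close>)
  qed
  have Uu: "U \<in> unitary_group ?N" "U \<in> carrier_mat ?N ?N" if "U \<in> USp n" for U
    using that unitary_groupD(1) by (auto simp: USp_def)
  have inv: "clifford_invariant n h"
    unfolding clifford_invariant_def
  proof (intro allI impI, elim conjE)
    fix a b c d :: nat
    assume lt: "a < 2 ^ n" "b < 2 ^ n" "c < 2 ^ n" "d < 2 ^ n"
      and w: "weight_sign n c d = - 1" and anti: "chi n d a = - chi n b c"
    have V: "rot n c d \<in> USp n" by (rule rot_in_USp[OF lt(3,4) n(1) w])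
    have xs: "a XOR c < 2 ^ n" "b XOR d < 2 ^ n" using lt by (auto intro!: xor_less_power2)
    have "(\<integral>U. F a b U \<partial>\<mu>) = (\<integral>U. F a b (rot n c d * U) \<partial>\<mu>)"
      by (rule haar_left_invariant_integral[symmetric, OF \<mu> _ V])
        (use Uu USp_mult[OF V] borel_measurable_integrable[OF int[OF lt(1)]] in auto)
    also have "\<dots> = (\<integral>U. F (a XOR c) (b XOR d) U \<partial>\<mu>)"
    proof (rule Bochner_Integration.integral_cong[OF refl])
      fix U assume "U \<in> space \<mu>"
      hence Uc: "U \<in> carrier_mat ?N ?N" using sp Uu by blast
      have c: "conj_by U ?P \<in> carrier_mat ?N ?N"
        unfolding conj_by_def by (intro mult_carrier_mat[of _ "2 ^ n" "2 ^ n"] mat_adjoint_carrier Uc pauli_carrier)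
      show "F a b (rot n c d * U) = F (a XOR c) (b XOR d) U"
        unfolding F_def conj_by_mult[OF rot_carrier Uc pauli_carrier]
          pauli_coeff_conj_rot[OF lt(3,4) c lt(1,2) anti] ..
    qed
    finally show "h (a XOR c) (b XOR d) = h a b" using lt xs by (simp add: h_def)
  qed
  have total: "(\<Sum>(a, b)\<in>{..<2 ^ n} \<times> {..<2 ^ n}. h a b) = 1"
  proof -
    have "(\<Sum>(a, b)\<in>{..<2 ^ n} \<times> {..<2 ^ n}. h a b) = (\<Sum>a<2 ^ n. \<Sum>b<2 ^ n. \<integral>U. F a b U \<partial>\<mu>)"
      unfolding sum.cartesian_product[symmetric] by (intro sum.cong refl) (simp add: h_def)
    also have "\<dots> = (\<Sum>a<2 ^ n. \<integral>U. (\<Sum>b<2 ^ n. F a b U) \<partial>\<mu>)"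
      by (intro sum.cong refl Bochner_Integration.integral_sum[symmetric] int) simp
    also have "\<dots> = (\<integral>U. (\<Sum>a<2 ^ n. \<Sum>b<2 ^ n. F a b U) \<partial>\<mu>)"
      by (intro Bochner_Integration.integral_sum[symmetric] Bochner_Integration.integrable_sum int) simp
    also have "\<dots> = (\<integral>U. 1 \<partial>\<mu>)"
    proof (rule Bochner_Integration.integral_cong[OF refl])
      fix U assume "U \<in> space \<mu>"
      thus "(\<Sum>a<2 ^ n. \<Sum>b<2 ^ n. F a b U) = 1"
        unfolding F_def by (intro pauli_parseval_unitary conj_by_unitary pauli_unitary) (use sp Uu in auto)
    qed
    also have "\<dots> = 1" by (simp add: prob_space)
    finally show ?thesis .
  qed
  have zero: "h 0 0 = 0"
  proof -
    have "(\<integral>U. F 0 0 U \<partial>\<mu>) = (\<integral>U. 0 \<partial>\<mu>)"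
      by (rule Bochner_Integration.integral_cong[OF refl])
        (use sp Uu q in \<open>simp add: F_def pauli_coeff_identity_conj\<close>)
    thus ?thesis by (simp add: h_def)
  qed
  have nonneg: "0 \<le> h a b" for a b
    by (simp add: h_def F_def)
  have "(\<Sum>(a, b)\<in>low_weight n. h a b) \<le> 2 / 3"
    by (rule low_weight_sum_le[OF inv nonneg zero total n(2)])
  moreover have "(\<Sum>(a, b)\<in>low_weight n. h a b) = (\<Sum>(a, b)\<in>low_weight n. \<integral>U. F a b U \<partial>\<mu>)"
    by (intro sum.cong refl) (auto simp: h_def low_weight_def)
  ultimately show ?thesis unfolding F_def by simp
qed

text \<open>A string outside \<open>low_weight n\<close> has too large a support to fit into the
  lightcone, so its coefficient vanishes. The remaining strings carry the full Parseval sum.\<close>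

lemma small_lightcone_low_weight:
  assumes C: "valid_circuit n E r C" "circuit_unitary n C \<in> unitary_group (2 ^ n)" and q: "q < n"
    and small: "real (card (lightcone {q} C)) < real n / 4"
  shows "(\<Sum>(a, b)\<in>low_weight n. (cmod (pauli_coeff n a b (conj_by (circuit_unitary n C) (pauli n 0 (2 ^ q)))))\<^sup>2) = 1"
proof -
  let ?O = "conj_by (circuit_unitary n C) (pauli n 0 (2 ^ q))"
  let ?L = "lightcone {q} C"
  have loc: "local_on n ?L ?O" by (rule conj_by_circuit_local[OF C(1) local_on_pauli_Z[OF q]])
  have finL: "finite ?L" using lightcone_bounded[OF C(1), of "{q}"] q finite_subset by auto
  have z: "pauli_coeff n a b ?O = 0" if ab: "a < 2 ^ n" "b < 2 ^ n" "(a, b) \<notin> low_weight n" for a b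
  proof -
    have "\<not> {p. p < n \<and> (bit a p \<or> bit b p)} \<subseteq> ?L"
    proof
      assume "{p. p < n \<and> (bit a p \<or> bit b p)} \<subseteq> ?L"
      hence "card {p. p < n \<and> (bit a p \<or> bit b p)} \<le> card ?L" by (rule card_mono[OF finL])
      thus False using that small by (simp add: low_weight_def)
    qed
    then obtain p where "p \<notin> ?L" "bit a p \<or> bit b p" by blast
    thus ?thesis by (rule pauli_coeff_eq_0_if_local[OF loc ab(1,2)])
  qed
  have "(\<Sum>(a, b)\<in>low_weight n. (cmod (pauli_coeff n a b ?O))\<^sup>2) =
      (\<Sum>(a, b)\<in>{..<2 ^ n} \<times> {..<2 ^ n}. (cmod (pauli_coeff n a b ?O))\<^sup>2)"
  proof (rule sum.mono_neutral_left)
    show "low_weight n \<subseteq> {..<2 ^ n} \<times> {..<2 ^ n}" by (auto simp: low_weight_def)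
    show "\<forall>x\<in>{..<2 ^ n} \<times> {..<2 ^ n} - low_weight n. (case x of (a, b) \<Rightarrow> (cmod (pauli_coeff n a b ?O))\<^sup>2) = 0"
      using z by auto
  qed simp
  also have "\<dots> = (\<Sum>a<2 ^ n. \<Sum>b<2 ^ n. (cmod (pauli_coeff n a b ?O))\<^sup>2)"
    by (rule sum.cartesian_product[symmetric])
  also have "\<dots> = 1"
    by (intro pauli_parseval_unitary conj_by_unitary pauli_unitary C) simp
  finally show ?thesis .
qed

lemma design_has_large_lightcone:
  assumes n: "odd n" and k: "2 \<le> k" and \<epsilon>: "\<epsilon> < 1 / 4"
    and D: "design_circuit_ensemble n E r (USp n) k \<epsilon> M" and q: "q < n"
  shows "\<exists>C\<in>space M. real n / 4 \<le> real (card (lightcone {q} C))"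
proof (rule ccontr)
  assume "\<not> ?thesis"
  hence small: "real (card (lightcone {q} C)) < real n / 4" if "C \<in> space M" for C
    using that by (simp add: not_le)
  let ?N = "2 ^ n :: nat"
  define \<nu> where "\<nu> = unitary_ensemble n M"
  have ens: "circuit_ensemble n E r (USp n) M" and des: "approx_unitary_design ?N (USp n) k \<epsilon> \<nu>"
    using D by (auto simp: design_circuit_ensemble_def \<nu>_def)
  have "prob_space M" and mC: "circuit_unitary n \<in> M \<rightarrow>\<^sub>M mat_borel ?N"
    and valid: "\<And>C. C \<in> space M \<Longrightarrow> valid_circuit n E r C" and inG: "\<And>C. C \<in> space M \<Longrightarrow> circuit_unitary n C \<in> USp n"
    using ens by (auto simp: circuit_ensemble_def)
  interpret prob_space M by fact
  obtain C0 where C0: "C0 \<in> space M" using not_empty by blast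
  \<comment> \<open>Every lightcone contains its starting qubit, so smallness of a single one
    already forces n > 4.\<close>
  have n3: "3 \<le> n"
  proof -
    have "finite (lightcone {q} C0)"
      using lightcone_bounded[OF valid[OF C0], of "{q}"] q finite_subset by auto
    moreover have "q \<in> lightcone {q} C0" using lightcone_subset[of "{q}" C0] by auto
    ultimately have "0 < card (lightcone {q} C0)" by (auto simp: card_gt_0_iff)
    hence "1 \<le> real (card (lightcone {q} C0))" by simp
    thus ?thesis using small[OF C0] by simp
  qed
  obtain k' where k': "k = Suc (Suc k')" using k by (metis Suc_le_D numeral_2_eq_2 Suc_le_mono)
  let ?K = "?N ^ k'"
  define w where "w = (\<lambda>((a, b), r). pauli_vec n k' a b r)"
  \<comment> \<open>The input state: the vectorisation of Z J, with Z acting on qubit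
    \<open>q\<close>, and the other \<open>k'\<close> copies in basis state 0.\<close>
  define v where "v = pauli_vec n k' 0 (2 ^ q) 0"
  \<comment> \<open>The outcomes that are counted: a low-weight string together with an arbitrary
    outcome on the other \<open>k'\<close> copies.\<close>
  define S where "S = low_weight n \<times> {..<?K}"
  have S: "finite S" by (simp add: S_def)
  have on: "orthonormal_on (?N ^ k) S w"
    unfolding k' w_def by (rule orthonormal_pauli_vec[OF n]) (auto simp: S_def low_weight_def)
  have vn: "(\<Sum>i<?N ^ k. (cmod (v i))\<^sup>2) = 1"
  proof -
    have "orthonormal_on (?N ^ k) {((0, 2 ^ q), 0)} w"
      unfolding k' w_def by (rule orthonormal_pauli_vec[OF n]) (use q in auto)
    hence "(\<Sum>i<?N ^ k. cnj (v i) * v i) = 1" by (simp add: orthonormal_on_def w_def v_def)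
    moreover have "complex_of_real (\<Sum>i<?N ^ k. (cmod (v i))\<^sup>2) = (\<Sum>i<?N ^ k. cnj (v i) * v i)"
      by (simp only: of_real_sum complex_norm_square mult.commute)
    ultimately show ?thesis by (simp only: of_real_eq_1_iff)
  qed
  define f where "f x U = (cmod (overlap ?N k (w x) v U))\<^sup>2" for x U
  define F where "F a b U = (cmod (pauli_coeff n a b (conj_by U (pauli n 0 (2 ^ q)))))\<^sup>2" for a b U
  have sumf: "(\<Sum>r<?K. f ((a, b), r) U) = F a b U" if "U \<in> USp n" "a < 2 ^ n" for a b U
    unfolding f_def F_def w_def v_def prod.case k' by (rule sum_overlap_pauli_vec[OF n that])
  obtain \<mu> where \<mu>: "haar_measure ?N (USp n) \<mu>" and r\<mu>: "random_unitary ?N \<mu>" and r\<nu>: "random_unitary ?N \<nu>"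
    and bound: "\<bar>(\<Sum>x\<in>S. \<integral>U. f x U \<partial>\<mu>) - (\<Sum>x\<in>S. \<integral>U. f x U \<partial>\<nu>)\<bar> \<le> \<epsilon>"
    using design_overlap_bound[OF des USp_subset_unitary S on vn] unfolding f_def by blast
  have int\<mu>: "integrable \<mu> (f x)" for x unfolding f_def by (rule overlap_square_integrable[OF r\<mu>])
  have int\<nu>: "integrable \<nu> (f x)" for x unfolding f_def by (rule overlap_square_integrable[OF r\<nu>])
  have "(\<Sum>x\<in>S. \<integral>U. f x U \<partial>\<mu>) = (\<Sum>(a, b)\<in>low_weight n. \<Sum>r<?K. \<integral>U. f ((a, b), r) U \<partial>\<mu>)"
    unfolding S_def sum.cartesian_product' by (simp add: case_prod_beta)
  also have "\<dots> = (\<Sum>(a, b)\<in>low_weight n. \<integral>U. (\<Sum>r<?K. f ((a, b), r) U) \<partial>\<mu>)"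
    by (simp only: Bochner_Integration.integral_sum[OF int\<mu>])
  also have "\<dots> = (\<Sum>(a, b)\<in>low_weight n. \<integral>U. F a b U \<partial>\<mu>)"
  proof (intro sum.cong refl, clarify)
    fix a b assume "(a, b) \<in> low_weight n"
    thus "(\<integral>U. (\<Sum>r<?K. f ((a, b), r) U) \<partial>\<mu>) = (\<integral>U. F a b U \<partial>\<mu>)"
      by (intro Bochner_Integration.integral_cong refl sumf)
        (use \<mu> in \<open>auto simp: haar_measure_def low_weight_def\<close>)
  qed
  also have "\<dots> \<le> 2 / 3" unfolding F_def by (rule haar_low_weight_bound[OF n n3 q \<mu>])
  finally have haar: "(\<Sum>x\<in>S. \<integral>U. f x U \<partial>\<mu>) \<le> 2 / 3" .
  \<comment> \<open>Measurability with respect to \<open>mat_borel\<close> is what allows the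
    integral to be pulled back from the image measure to the circuits.\<close>
  have meas: "(\<lambda>U. \<Sum>x\<in>S. f x U) \<in> borel_measurable (mat_borel ?N)"
  proof -
    have "sets \<nu> = sets (mat_borel ?N)" by (simp add: \<nu>_def unitary_ensemble_def)
    hence "borel_measurable \<nu> = (borel_measurable (mat_borel ?N) :: (complex mat \<Rightarrow> real) set)"
      by (rule measurable_cong_sets) simp
    moreover have "(\<lambda>U. \<Sum>x\<in>S. f x U) \<in> borel_measurable \<nu>"
      by (intro borel_measurable_sum borel_measurable_integrable int\<nu>)
    ultimately show ?thesis by simp
  qed
  have "(\<Sum>x\<in>S. \<integral>U. f x U \<partial>\<nu>) = (\<integral>U. (\<Sum>x\<in>S. f x U) \<partial>\<nu>)"
    by (rule Bochner_Integration.integral_sum[symmetric]) (rule int\<nu>)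
  also have "\<dots> = (\<integral>C. (\<Sum>x\<in>S. f x (circuit_unitary n C)) \<partial>M)"
    unfolding \<nu>_def unitary_ensemble_def by (rule integral_distr[OF mC meas])
  also have "\<dots> = (\<integral>C. 1 \<partial>M)"
  proof (rule Bochner_Integration.integral_cong[OF refl])
    fix C assume C: "C \<in> space M"
    let ?U = "circuit_unitary n C"
    have "(\<Sum>x\<in>S. f x ?U) = (\<Sum>(a, b)\<in>low_weight n. \<Sum>r<?K. f ((a, b), r) ?U)"
      unfolding S_def sum.cartesian_product' by (simp add: case_prod_beta)
    also have "\<dots> = (\<Sum>(a, b)\<in>low_weight n. F a b ?U)"
      by (intro sum.cong refl, clarify, rule sumf[OF inG[OF C]]) (auto simp: low_weight_def)
    also have "\<dots> = 1"
      unfolding F_def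
      by (rule small_lightcone_low_weight[OF valid[OF C] _ q small[OF C]]) (use inG[OF C] USp_subset_unitary in blast)
    finally show "(\<Sum>x\<in>S. f x ?U) = 1" .
  qed
  also have "\<dots> = 1" by (simp add: prob_space)
  finally have "(\<Sum>x\<in>S. \<integral>U. f x U \<partial>\<nu>) = 1" .
  \<comment> \<open>The two probabilities are 1 and at most 2/3, and their difference 1/3 exceeds
    1/4.\<close>
  thus False using haar bound \<epsilon> by linarith
qed

text \<open>The qubit \<open>q\<close> is arbitrary because the first qubit of an arbitrary ordering
  may be any qubit. The depth bounds take \<open>q = 0\<close> and compare n/4 with the linear or
  exponential growth of a lightcone, so the constants depend on \<open>r\<close> alone.\<close>

theorem theoremS23:
  shows
    "(\<forall>n E r k \<epsilon> M q. odd n \<longrightarrow> 2 \<le> k \<longrightarrow> \<epsilon> < 1/4 \<longrightarrow>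
        design_circuit_ensemble n E r (USp n) k \<epsilon> M \<longrightarrow> q < n \<longrightarrow>
        (\<exists>C\<in>space M. real n / 4 \<le> real (card (lightcone {q} C)))) \<and>
     (\<forall>r. \<exists>c>0. \<forall>\<^sub>F n in sequentially. odd n \<longrightarrow>
        (\<forall>E k \<epsilon> M. one_dimensional n E \<longrightarrow> 2 \<le> k \<longrightarrow> \<epsilon> < 1/4 \<longrightarrow>
           design_circuit_ensemble n E r (USp n) k \<epsilon> M \<longrightarrow>
           ereal (c * real n) \<le> ereal_of_enat (ensemble_depth M))) \<and>
     (\<forall>r. \<exists>c>0. \<forall>\<^sub>F n in sequentially. odd n \<longrightarrow>
        (\<forall>k \<epsilon> M. 2 \<le> k \<longrightarrow> \<epsilon> < 1/4 \<longrightarrow>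
           design_circuit_ensemble n (all_to_all n) r (USp n) k \<epsilon> M \<longrightarrow>
           ereal (c * ln (real n)) \<le> ereal_of_enat (ensemble_depth M)))"
proof (intro conjI allI impI)
  fix n E r k \<epsilon> M q
  assume "odd n" "2 \<le> k" "\<epsilon> < 1/4" "design_circuit_ensemble n E r (USp n) k \<epsilon> M" "q < n"
  thus "\<exists>C\<in>space M. real n / 4 \<le> real (card (lightcone {q} C))"
    by (rule design_has_large_lightcone)
next
  fix r :: nat
  \<comment> \<open>At depth d the arc bound gives n/4 <= 2 d r^2 + 1. For n >= 8 the summand 1 is
    at most n/8, hence n <= 16 d r^2. The added 1 in the denominator keeps it positive for r =
    0.\<close>
  define c where "c = 1 / (16 * (real r * real r + 1))"
  have c: "c > 0" by (simp add: c_def add_nonneg_pos)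
  have "\<forall>\<^sub>F n in sequentially. odd n \<longrightarrow>
        (\<forall>E k \<epsilon> M. one_dimensional n E \<longrightarrow> 2 \<le> k \<longrightarrow> \<epsilon> < 1/4 \<longrightarrow>
           design_circuit_ensemble n E r (USp n) k \<epsilon> M \<longrightarrow>
           ereal (c * real n) \<le> ereal_of_enat (ensemble_depth M))"
    using eventually_ge_at_top[of 8]
  proof eventually_elim
    case (elim n)
    show ?case
    proof (intro impI allI)
      fix E k \<epsilon> M
      assume n: "odd n" and E: "one_dimensional n E" and k: "2 \<le> k" and \<epsilon>: "\<epsilon> < 1/4"
        and D: "design_circuit_ensemble n E r (USp n) k \<epsilon> M"
      have q: "0 < n" using elim by simp
      obtain C where C: "C \<in> space M" "real n / 4 \<le> real (card (lightcone {0} C))"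
        using design_has_large_lightcone[OF n k \<epsilon> D q] by blast
      show "ereal (c * real n) \<le> ereal_of_enat (ensemble_depth M)"
      proof (rule ensemble_depth_ge[OF C(1)])
        have "valid_circuit n E r C"
          using D C(1) by (auto simp: design_circuit_ensemble_def circuit_ensemble_def)
        hence "card (lightcone {0} C) \<le> 2 * (length C * (r * r)) + 1"
          by (rule card_lightcone_one_dimensional[OF E _ q])
        hence "real (card (lightcone {0} C)) \<le> real (2 * (length C * (r * r)) + 1)"
          by (simp only: of_nat_le_iff)
        hence "real n / 4 \<le> 2 * (real (length C) * (real r * real r)) + 1" using C(2) by simp
        moreover have "8 \<le> real n" using elim by simp
        ultimately have "real n \<le> 16 * (real (length C) * (real r * real r))" by linarith
        also have "\<dots> \<le> real (length C) * (16 * (real r * real r + 1))" by (simp add: algebra_simps)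
        finally show "c * real n \<le> real (length C)"
          by (simp add: c_def divide_le_eq add_nonneg_pos)
      qed
    qed
  qed
  thus "\<exists>c>0. \<forall>\<^sub>F n in sequentially. odd n \<longrightarrow>
        (\<forall>E k \<epsilon> M. one_dimensional n E \<longrightarrow> 2 \<le> k \<longrightarrow> \<epsilon> < 1/4 \<longrightarrow>
           design_circuit_ensemble n E r (USp n) k \<epsilon> M \<longrightarrow>
           ereal (c * real n) \<le> ereal_of_enat (ensemble_depth M))"
    using c by blast
next
  fix r :: nat
  \<comment> \<open>At depth d one has n/4 <= (r + 1)^d, weakened to (r + 2)^d so that the logarithm
    is positive even for r = 0. For n >= 16 the term ln 4 is at most half of ln n, which gives the
    factor 2.\<close>
  define c where "c = 1 / (2 * ln (real r + 2))"
  have lr: "ln (real r + 2) > 0" by simp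
  have c: "c > 0" using lr by (simp add: c_def)
  have "\<forall>\<^sub>F n in sequentially. odd n \<longrightarrow>
        (\<forall>k \<epsilon> M. 2 \<le> k \<longrightarrow> \<epsilon> < 1/4 \<longrightarrow>
           design_circuit_ensemble n (all_to_all n) r (USp n) k \<epsilon> M \<longrightarrow>
           ereal (c * ln (real n)) \<le> ereal_of_enat (ensemble_depth M))"
    using eventually_ge_at_top[of 16]
  proof eventually_elim
    case (elim n)
    show ?case
    proof (intro impI allI)
      fix k \<epsilon> M
      assume n: "odd n" and k: "2 \<le> k" and \<epsilon>: "\<epsilon> < 1/4"
        and D: "design_circuit_ensemble n (all_to_all n) r (USp n) k \<epsilon> M"
      have q: "0 < n" using elim by simp
      obtain C where C: "C \<in> space M" "real n / 4 \<le> real (card (lightcone {0} C))"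
        using design_has_large_lightcone[OF n k \<epsilon> D q] by blast
      show "ereal (c * ln (real n)) \<le> ereal_of_enat (ensemble_depth M)"
      proof (rule ensemble_depth_ge[OF C(1)])
        have "valid_circuit n (all_to_all n) r C"
          using D C(1) by (auto simp: design_circuit_ensemble_def circuit_ensemble_def)
        hence "card (lightcone {0} C) \<le> (r + 1) ^ length C * card {0 :: nat}"
          by (rule card_lightcone_exponential) simp
        hence "real (card (lightcone {0} C)) \<le> real ((r + 1) ^ length C)"
          by (simp only: of_nat_le_iff) simp
        also have "\<dots> \<le> (real r + 2) ^ length C"
          unfolding of_nat_power by (rule power_mono) simp_all
        finally have le: "real n / 4 \<le> (real r + 2) ^ length C" using C(2) by linarith
        have n16: "16 \<le> real n" using elim by simp
        have "ln (real n) - ln 4 = ln (real n / 4)" using n16 by (simp add: ln_div)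
        also have "\<dots> \<le> ln ((real r + 2) ^ length C)" using le n16 by (subst ln_le_cancel_iff) auto
        also have "\<dots> = real (length C) * ln (real r + 2)" by (rule ln_realpow)
        finally have 1: "ln (real n) - ln 4 \<le> real (length C) * ln (real r + 2)" .
        have "2 * ln 4 = ln (4 ^ 2 :: real)" by (subst ln_realpow) simp_all
        also have "\<dots> \<le> ln (real n)" using n16 by (subst ln_le_cancel_iff) auto
        finally have "ln (real n) \<le> real (length C) * (2 * ln (real r + 2))" using 1 by linarith
        thus "c * ln (real n) \<le> real (length C)"
          using lr by (simp add: c_def divide_le_eq)
      qed
    qed
  qed
  thus "\<exists>c>0. \<forall>\<^sub>F n in sequentially. odd n \<longrightarrow>
        (\<forall>k \<epsilon> M. 2 \<le> k \<longrightarrow> \<epsilon> < 1/4 \<longrightarrow>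
           design_circuit_ensemble n (all_to_all n) r (USp n) k \<epsilon> M \<longrightarrow>
           ereal (c * ln (real n)) \<le> ereal_of_enat (ensemble_depth M))"
    using c by blast
qed

end
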